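(* Let the domain $\Omega$, boundary parts, coefficients $\rho,\alpha,c_0,\boldsymbol C,\boldsymbol K$, finite element spaces $\boldsymbol V_h$, $Q_h$ (with $r\ge 2$ and either the continuous or the discontinuous choice of $Q_h$), forms $A_\gamma, C, B_\gamma$, functionals $F_\gamma, G_\gamma$, time mesh and quadrature $Q_n$ be as defined in the context, and let $k\in\mathbb N_0$. Assume that the stabilization parameters ($\gamma_a,\gamma_b$ for the continuous choice of $Q_h$; $\gamma_a,\gamma$ for the discontinuous choice) are chosen sufficiently large. Then for every $n\in\{1,\dots,N\}$ and all given $\boldsymbol u_h^{n-1}\in \boldsymbol V_h$, $\boldsymbol v_h^{n-1}\in\boldsymbol V_h$, $p_h^{n-1}\in Q_h$, there exists exactly one triple $$(\boldsymbol u_{\tau,h},\boldsymbol v_{\tau,h},p_{\tau,h})\in \mathbb P_k(I_n;\boldsymbol V_h)\times \mathbb P_k(I_n;\boldsymbol V_h)\times\mathbb P_k(I_n;Q_h)$$ such that $$Q_n\big(\langle \partial_t \boldsymbol u_{\tau,h},\boldsymbol\phi_{\tau,h}\rangle-\langle \boldsymbol v_{\tau,h},\boldsymbol\phi_{\tau,h}\rangle\big)+\langle \boldsymbol u_{\tau,h}^+(t_{n-1}),\boldsymbol\phi_{\tau,h}^+(t_{n-1})\rangle=\langle \boldsymbol u_h^{n-1},\boldsymbol\phi_{\tau,h}^+(t_{n-1})\rangle,$$ $$Q_n\big(\langle\rho\,\partial_t\boldsymbol v_{\tau,h},\boldsymbol\chi_{\tau,h}\rangle+A_\gamma(\boldsymbol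 u_{\tau,h},\boldsymbol\chi_{\tau,h})+C(\boldsymbol\chi_{\tau,h},p_{\tau,h})\big)+\langle\rho\,\boldsymbol v_{\tau,h}^+(t_{n-1}),\boldsymbol\chi_{\tau,h}^+(t_{n-1})\rangle=Q_n\big(F_\gamma(\boldsymbol\chi_{\tau,h})\big)+\langle\rho\,\boldsymbol v_h^{n-1},\boldsymbol\chi_{\tau,h}^+(t_{n-1})\rangle,$$ $$Q_n\big(\langle c_0\partial_t p_{\tau,h},\psi_{\tau,h}\rangle-C(\boldsymbol v_{\tau,h},\psi_{\tau,h})+B_\gamma(p_{\tau,h},\psi_{\tau,h})\big)+\langle c_0p_{\tau,h}^+(t_{n-1}),\psi_{\tau,h}^+(t_{n-1})\rangle=Q_n\big(G_\gamma(\psi_{\tau,h})\big)+\langle c_0p_h^{n-1},\psi_{\tau,h}^+(t_{n-1})\rangle$$ for all $(\boldsymbol\phi_{\tau,h},\boldsymbol\chi_{\tau,h},\psi_{\tau,h})\in\mathbb P_k(I_n;\boldsymbol V_h)\times\mathbb P_k(I_n;\boldsymbol V_h)\times\mathbb P_k(I_n;Q_h)$.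
   Context: **Domain and coefficients.** $\Omega\subset\mathbb R^d$, $d\in\{2,3\}$, is an open bounded Lipschitz domain with outer unit normal $\boldsymbol n$; $\partial\Omega=\Gamma^D_{\boldsymbol u}\cup\Gamma^N_{\boldsymbol u}=\Gamma^D_p\cup\Gamma^N_p$ with closed portions $\Gamma^D_{\boldsymbol u},\Gamma^D_p$ of non-zero measure. $\rho,\alpha,c_0>0$ are constants. $\boldsymbol C=(C_{ijkl})$ is a constant symmetric fourth order elasticity tensor and $\boldsymbol K\in\mathbb R^{d,d}$ a constant symmetric matrix such that for some $k_0,k_1>0$: $\sum_{i,j,k,l}\xi_{ij}C_{ijkl}\xi_{kl}\ge k_0\sum_{j,k}|\xi_{jk}|^2$ for all symmetric $\boldsymbol\xi\in\mathbb R^{d,d}$, and $\sum_{i,j}\xi_iK_{ij}\xi_j\ge k_1\sum_i|\xi_i|^2$ for all $\boldsymbol\xi\in\mathbb R^d$. $\boldsymbol\varepsilon(\boldsymbol u)=(\nabla\boldsymbol u+(\nabla\boldsymbol u)^\top)/2$. $\langle\cdot,\cdot\rangle_S$ is the $L^2(S)$ inner product (duality pairing where needed), $\langle\cdot,\cdot\rangle=\langle\cdot,\cdot\rangle_\Omega$. **Time.** $0=t_0<t_1<\dots<t_N=T$, $I_n=(t_{n-1},t_n]$, $\tau_n=t_n-t_{n-1}$. For a Banach space $B$, $\mathbb P_k(I_n;B)$ is the space of polynomials in $t\in I_n$ of degree at most $k$ with coefficients in $B$. $w^+(t_{n-1})=\lim_{t\to t_{n-1}+0}w(t)$. $Q_n(w)=\frac{\tau_n}{2}\sum_{\mu=1}^{k+1}\hat\omega_\mu\,w(t_{n,\mu})$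 is the right-sided $(k+1)$-point Gauss–Radau quadrature formula on $I_n$ (so $t_{n,k+1}=t_n$; it is exact for polynomials of degree at most $2k$). **Space.** $\mathcal T_h$ is a mesh of $\Omega$ consisting of open quadrilaterals ($d=2$) or hexahedra ($d=3$), a member of a quasi-uniform family; boundary faces are compatible with the splittings of $\partial\Omega$. Let $r\ge2$. $\boldsymbol V_h$ is the space of $\boldsymbol v_h\in H^1(\Omega)^d\cap C(\overline\Omega)^d$ with $\boldsymbol v_h|_K$ in the mapped space $\mathbb Q_r^d$ for all $K\in\mathcal T_h$. $Q_h$ is one of: the continuous choice, $\{q_h\in C(\overline\Omega): q_h|_K\in \mathbb Q_{r-1}\text{ (mapped) for all }K\}$; or the discontinuous choice, $\{q_h\in L^2(\Omega): q_h|_K\in\mathbb P_{r-1}\text{ (mapped) for all }K\}$. $\mathcal F_h$ is the set of all (interior and boundary) faces; $\mathcal F_h^{D,\boldsymbol u},\mathcal F_h^{D,p},\mathcal F_h^{N,p}\subset\mathcal F_h$ are the faces on $\Gamma^D_{\boldsymbol u},\Gamma_p^D,\Gamma_p^N$. On an interior face $F=\partial K^+\cap\partial K^-$: $\{\!\{w\}\!\}=\frac12(w^++w^-)$, $[\![w]\!]=w^+-w^-$ (with $\boldsymbol n$ a unit normal of $F$ oriented consistently, from $K^+$ to $K^-$), $h_F=\frac12(|K^+|_d+|K^-|_d)$; on boundary faces $F\subset\partial K\cap\partial\Omega$: $\{\!\{w\}\!\}=[\![w]\!]=w|_K$, $h_F=|K|_d$. Here $|\cdot|_d$ is Hausdorff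 measure. A factor $1/h_F$ in front of an integral over a boundary part is understood facewise. **Forms.** For $\boldsymbol w_h,\boldsymbol\chi_h\in\boldsymbol V_h$, $q_h,\psi_h\in Q_h$, and boundary functions $\boldsymbol w,q$: - $a_\gamma(\boldsymbol w,\boldsymbol\chi_h)=-\langle\boldsymbol w,\boldsymbol C\boldsymbol\varepsilon(\boldsymbol\chi_h)\boldsymbol n\rangle_{\Gamma^D_{\boldsymbol u}}+\frac{\gamma_a}{h_F}\langle\boldsymbol w,\boldsymbol\chi_h\rangle_{\Gamma^D_{\boldsymbol u}}$, - $b_\gamma(q,\psi_h)=-\langle q,\boldsymbol K\nabla\psi_h\cdot\boldsymbol n\rangle_{\Gamma^D_p}+\frac{\gamma_b}{h_F}\langle q,\psi_h\rangle_{\Gamma^D_p}$, - $A_\gamma(\boldsymbol w_h,\boldsymbol\chi_h)=\langle\boldsymbol C\boldsymbol\varepsilon(\boldsymbol w_h),\boldsymbol\varepsilon(\boldsymbol\chi_h)\rangle-\langle\boldsymbol C\boldsymbol\varepsilon(\boldsymbol w_h)\boldsymbol n,\boldsymbol\chi_h\rangle_{\Gamma^D_{\boldsymbol u}}+a_\gamma(\boldsymbol w_h,\boldsymbol\chi_h)$, - $C(\boldsymbol\chi_h,q_h)=-\alpha\langle\nabla\cdot\boldsymbol\chi_h,q_h\rangle+\alpha\langle\boldsymbol\chi_h\cdot\boldsymbol n,q_h\rangle_{\Gamma^D_{\boldsymbol u}}$, - continuous choice of $Q_h$: $B_\gamma(q_h,\psi_h)=\langle\boldsymbol K\nabla q_h,\nabla\psi_h\rangle-\langle\boldsymbol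 K\nabla q_h\cdot\boldsymbol n,\psi_h\rangle_{\Gamma^D_p}+b_\gamma(q_h,\psi_h)$, - discontinuous choice of $Q_h$: $B_\gamma(q_h,\psi_h)=\sum_{K\in\mathcal T_h}\langle\boldsymbol K\nabla q_h,\nabla\psi_h\rangle_K-\sum_{F\in\mathcal F_h}\big(\langle\{\!\{\boldsymbol K\nabla q_h\}\!\}\cdot\boldsymbol n,[\![\psi_h]\!]\rangle_F+\langle[\![q_h]\!],\{\!\{\boldsymbol K\nabla\psi_h\}\!\}\cdot\boldsymbol n\rangle_F\big)+\sum_{F\in\mathcal F_h}\frac{\gamma}{h_F}\langle[\![q_h]\!],[\![\psi_h]\!]\rangle_F$. "Sufficiently large" means: there are thresholds, independent of $n$, the time mesh and the data, such that the assertion holds whenever the parameters exceed them. **Data.** $\boldsymbol f,\boldsymbol u_D,\boldsymbol t_N,g,p_D,p_N$ are given time-dependent data, $\boldsymbol v_D=\partial_t\boldsymbol u_D$, such that at each quadrature node the following are well-defined linear functionals on $\boldsymbol V_h$ and $Q_h$ (e.g. $\boldsymbol f\in\boldsymbol H^{-1}$, $\boldsymbol u_D\in\boldsymbol H^{1/2}(\Gamma^D_{\boldsymbol u})$, $\boldsymbol t_N\in\boldsymbol H^{-1/2}(\Gamma^N_{\boldsymbol u})$, $g\in H^{-1}$, $p_D\in H^{1/2}(\Gamma^D_p)$, $p_N\in H^{-1/2}(\Gamma^N_p)$ in the continuous case, suitably adapted in the discontinuous case): - $F_\gamma(\boldsymbol\chi_h)=\langle\boldsymbol f,\boldsymbol\chi_h\rangle-\langle\boldsymbol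 t_N,\boldsymbol\chi_h\rangle_{\Gamma^N_{\boldsymbol u}}+a_\gamma(\boldsymbol u_D,\boldsymbol\chi_h)$, - continuous choice: $G_\gamma(\psi_h)=\langle g,\psi_h\rangle-\alpha\langle\boldsymbol v_D\cdot\boldsymbol n,\psi_h\rangle_{\Gamma^D_{\boldsymbol u}}-\langle p_N,\psi_h\rangle_{\Gamma^N_p}+b_\gamma(p_D,\psi_h)$, - discontinuous choice: $G_\gamma(\psi_h)=\langle g,\psi_h\rangle-\sum_{F\in\mathcal F_h^{D,\boldsymbol u}}\alpha\langle\boldsymbol v_D\cdot\boldsymbol n,\psi_h\rangle_F-\sum_{F\in\mathcal F_h^{D,p}}\langle p_D,\{\!\{\boldsymbol K\nabla\psi_h\}\!\}\cdot\boldsymbol n\rangle_F+\sum_{F\in\mathcal F_h^{D,p}}\frac{\gamma}{h_F}\langle p_D,[\![\psi_h]\!]\rangle_F-\sum_{F\in\mathcal F_h^{N,p}}\langle p_N,[\![\psi_h]\!]\rangle_F$. *)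

theory Defs
  imports "HOL-Analysis.Analysis" "HOL-Computational_Algebra.Polynomial"
begin

section \<open>Hausdorff measure\<close>

text \<open>
  Normalised so that the \<open>d\<close>-dimensional measure on \<open>d\<close>-space is Lebesgue measure. Only used for
  positive dimension \<open>s\<close> (the term for a one-point set would be wrong for \<open>s = 0\<close>).
  \<open>hausdorff\<close> is the outer measure, so it is meaningful on every set.
\<close>

definition hausdorff_content :: "real \<Rightarrow> real \<Rightarrow> 'a::metric_space set \<Rightarrow> ennreal" where
  "hausdorff_content s \<delta> A =
     (INF U \<in> {U :: nat \<Rightarrow> 'a set. A \<subseteq> (\<Union>i. U i) \<and> (\<forall>i. bounded (U i) \<and> diameter (U i) < \<delta>)}.
        \<Sum>i. ennreal (unit_ball_vol s * (diameter (U i) / 2) powr s))"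

definition hausdorff :: "real \<Rightarrow> 'a::metric_space set \<Rightarrow> ennreal" where
  "hausdorff s A = (SUP \<delta> \<in> {0<..}. hausdorff_content s \<delta> A)"

definition hausdorff_measure :: "real \<Rightarrow> 'a::metric_space measure" where
  "hausdorff_measure s = measure_of UNIV (sets borel) (hausdorff s)"

definition surface_area :: "(real^'n) set \<Rightarrow> ennreal" where
  "surface_area = hausdorff (real CARD('n) - 1)"

definition surface_measure :: "(real^'n) measure" where
  "surface_measure = hausdorff_measure (real CARD('n) - 1)"


section \<open>Lipschitz domains and the outer normal\<close>

definition lipschitz_domain :: "'a::euclidean_space set \<Rightarrow> bool" where
  "lipschitz_domain \<Omega> \<longleftrightarrow>
     open \<Omega> \<and> connected \<Omega> \<and> \<Omega> \<noteq> {} \<and>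
     (\<forall>p \<in> frontier \<Omega>. \<exists>U \<nu> \<phi> L. open U \<and> p \<in> U \<and> norm \<nu> = 1 \<and> L-lipschitz_on UNIV \<phi> \<and>
        \<Omega> \<inter> U = {x \<in> U. x \<bullet> \<nu> < \<phi> (x - (x \<bullet> \<nu>) *\<^sub>R \<nu>)})"

text \<open>
  \<open>\<nu>\<close> is the outer normal at \<open>x\<close> if near \<open>x\<close> the set looks, to first order, like the half space
  \<open>(y - x) \<bullet> \<nu> < 0\<close>. On a Lipschitz boundary such a vector exists almost everywhere.
\<close>

definition is_outer_normal :: "'a::euclidean_space set \<Rightarrow> 'a \<Rightarrow> 'a \<Rightarrow> bool" where
  "is_outer_normal S x \<nu> \<longleftrightarrow> norm \<nu> = 1 \<and>
     (\<forall>\<epsilon>>0. \<exists>\<delta>>0. \<forall>y. dist y x < \<delta> \<longrightarrow>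
        ((y - x) \<bullet> \<nu> > \<epsilon> * norm (y - x) \<longrightarrow> y \<notin> S) \<and>
        ((y - x) \<bullet> \<nu> < - \<epsilon> * norm (y - x) \<longrightarrow> y \<in> S))"

definition outer_normal :: "'a::euclidean_space set \<Rightarrow> 'a \<Rightarrow> 'a" where
  "outer_normal S x = (if \<exists>!\<nu>. is_outer_normal S x \<nu> then THE \<nu>. is_outer_normal S x \<nu> else 0)"


section \<open>Lebesgue and Sobolev spaces\<close>

definition L2_on :: "'a measure \<Rightarrow> 'a set \<Rightarrow> ('a \<Rightarrow> 'b::euclidean_space) \<Rightarrow> bool" where
  "L2_on \<mu> S f \<longleftrightarrow> set_borel_measurable \<mu> S f \<and> set_integrable \<mu> S (\<lambda>x. (norm (f x))\<^sup>2)"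

definition ip :: "'a::euclidean_space set \<Rightarrow> ('a \<Rightarrow> 'b::euclidean_space) \<Rightarrow> ('a \<Rightarrow> 'b) \<Rightarrow> real" where
  "ip S f g = (LINT x:S|lebesgue. f x \<bullet> g x)"

definition surface_ip ::
  "(real^'n) set \<Rightarrow> (real^'n \<Rightarrow> 'b::euclidean_space) \<Rightarrow> (real^'n \<Rightarrow> 'b) \<Rightarrow> real" where
  "surface_ip S f g = (LINT x:S|surface_measure. f x \<bullet> g x)"

primrec C_k :: "nat \<Rightarrow> (real^'n \<Rightarrow> real) \<Rightarrow> bool" where
  "C_k 0 f \<longleftrightarrow> continuous_on UNIV f"
| "C_k (Suc m) f \<longleftrightarrow> (\<forall>x. f differentiable (at x)) \<and>
     (\<forall>i. C_k m (\<lambda>x. frechet_derivative f (at x) (axis i 1)))"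

definition test_functions :: "(real^'n) set \<Rightarrow> (real^'n \<Rightarrow> real) set" where
  "test_functions \<Omega> =
     {\<phi>. (\<forall>m. C_k m \<phi>) \<and> (\<exists>S. compact S \<and> S \<subseteq> \<Omega> \<and> (\<forall>x. x \<notin> S \<longrightarrow> \<phi> x = 0))}"

definition H1 :: "(real^'n) set \<Rightarrow> (real^'n \<Rightarrow> real) \<Rightarrow> bool" where
  "H1 \<Omega> v \<longleftrightarrow> L2_on lebesgue \<Omega> v \<and>
     (\<exists>w :: real^'n \<Rightarrow> real^'n. L2_on lebesgue \<Omega> w \<and>
        (\<forall>\<phi> \<in> test_functions \<Omega>. \<forall>i.
           ip \<Omega> v (\<lambda>x. frechet_derivative \<phi> (at x) (axis i 1)) = - ip \<Omega> (\<lambda>x. w x $ i) \<phi>))"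


section \<open>Differential operators and traces\<close>

text \<open>
  Classical derivatives. All finite element functions below are smooth in every open cell, and the
  union of the cell boundaries is a null set, so these are the weak derivatives where those exist
  and the cellwise (broken) derivatives otherwise.
\<close>

definition grad :: "(real^'n \<Rightarrow> real) \<Rightarrow> real^'n \<Rightarrow> real^'n" where
  "grad q x = (\<chi> i. frechet_derivative q (at x) (axis i 1))"

definition strain :: "(real^'n \<Rightarrow> real^'n) \<Rightarrow> real^'n \<Rightarrow> real^'n^'n" where
  "strain u x = (1/2) *\<^sub>R (jacobian u (at x) + transpose (jacobian u (at x)))"

definition divergence :: "(real^'n \<Rightarrow> real^'n) \<Rightarrow> real^'n \<Rightarrow> real" where
  "divergence u x = trace (jacobian u (at x))"

definition tr :: "'a::topological_space set \<Rightarrow> ('a \<Rightarrow> 'b::t2_space) \<Rightarrow> 'a \<Rightarrow> 'b" where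
  "tr K w x = Lim (at x within K) w"


section \<open>Domain and coefficients\<close>

record ('n::finite) biot =
  Omega :: "(real^'n) set"
  GuD :: "(real^'n) set"
  GuN :: "(real^'n) set"
  GpD :: "(real^'n) set"
  GpN :: "(real^'n) set"
  rho :: real
  alpha :: real
  c0 :: real
  Cten :: "'n \<Rightarrow> 'n \<Rightarrow> 'n \<Rightarrow> 'n \<Rightarrow> real"
  Kmat :: "real^'n^'n"

definition tensor_app :: "('n \<Rightarrow> 'n \<Rightarrow> 'n \<Rightarrow> 'n \<Rightarrow> real) \<Rightarrow> real^'n^'n \<Rightarrow> real^'n^'n" where
  "tensor_app C \<xi> = (\<chi> i j. \<Sum>k\<in>UNIV. \<Sum>l\<in>UNIV. C i j k l * \<xi> $ k $ l)"

definition elasticity_tensor :: "('n::finite \<Rightarrow> 'n \<Rightarrow> 'n \<Rightarrow> 'n \<Rightarrow> real) \<Rightarrow> bool" where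
  "elasticity_tensor C \<longleftrightarrow>
     (\<forall>i j k l. C i j k l = C k l i j \<and> C i j k l = C j i k l \<and> C i j k l = C i j l k) \<and>
     (\<exists>k0>0. \<forall>\<xi> :: real^'n^'n. transpose \<xi> = \<xi> \<longrightarrow>
        (\<Sum>i\<in>UNIV. \<Sum>j\<in>UNIV. \<Sum>k\<in>UNIV. \<Sum>l\<in>UNIV. \<xi> $ i $ j * C i j k l * \<xi> $ k $ l)
          \<ge> k0 * (\<Sum>j\<in>UNIV. \<Sum>k\<in>UNIV. \<bar>\<xi> $ j $ k\<bar>\<^sup>2))"

definition permeability :: "real^'n^'n \<Rightarrow> bool" where
  "permeability K \<longleftrightarrow> transpose K = K \<and>
     (\<exists>k1>0. \<forall>\<xi> :: real^'n. (\<Sum>i\<in>UNIV. \<Sum>j\<in>UNIV. \<xi> $ i * K $ i $ j * \<xi> $ j)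
        \<ge> k1 * (\<Sum>i\<in>UNIV. \<bar>\<xi> $ i\<bar>\<^sup>2))"

text \<open>The Dirichlet and Neumann parts may share their common (null) relative boundary.\<close>

definition boundary_splitting :: "(real^'n) set \<Rightarrow> (real^'n) set \<Rightarrow> (real^'n) set \<Rightarrow> bool" where
  "boundary_splitting \<Omega> D N \<longleftrightarrow> frontier \<Omega> = D \<union> N \<and> closed D \<and>
     surface_area D \<noteq> 0 \<and> surface_area (D \<inter> N) = 0"

definition biot_problem :: "'n::finite biot \<Rightarrow> bool" where
  "biot_problem P \<longleftrightarrow>
     lipschitz_domain (Omega P) \<and> bounded (Omega P) \<and>
     boundary_splitting (Omega P) (GuD P) (GuN P) \<and> boundary_splitting (Omega P) (GpD P) (GpN P) \<and>
     rho P > 0 \<and> alpha P > 0 \<and> c0 P > 0 \<and>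
     elasticity_tensor (Cten P) \<and> permeability (Kmat P)"


section \<open>Meshes of quadrilaterals and hexahedra\<close>

definition Q_poly :: "nat \<Rightarrow> (real^'n \<Rightarrow> real) set" where
  "Q_poly r = {q. \<exists>c :: ('n \<Rightarrow> nat) \<Rightarrow> real. \<forall>x.
     q x = (\<Sum>a | \<forall>i. a i \<le> r. c a * (\<Prod>i\<in>UNIV. (x $ i) ^ a i))}"

definition P_poly :: "nat \<Rightarrow> (real^'n \<Rightarrow> real) set" where
  "P_poly r = {q. \<exists>c :: ('n \<Rightarrow> nat) \<Rightarrow> real. \<forall>x.
     q x = (\<Sum>a | (\<Sum>i\<in>UNIV. a i) \<le> r. c a * (\<Prod>i\<in>UNIV. (x $ i) ^ a i))}"

text \<open>
  \<open>refmap M K\<close> maps the unit cube onto \<open>K\<close>. \<open>Kplus M F\<close> and \<open>Kminus M F\<close> are the cells on the two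
  sides of an interior face \<open>F\<close>; for a boundary face, \<open>Kplus M F\<close> is the adjacent cell.
\<close>

record ('n::finite) mesh =
  cells :: "(real^'n) set set"
  refmap :: "(real^'n) set \<Rightarrow> real^'n \<Rightarrow> real^'n"
  Kplus :: "(real^'n) set \<Rightarrow> (real^'n) set"
  Kminus :: "(real^'n) set \<Rightarrow> (real^'n) set"

text \<open>
  Faces of positive codimension of the unit cube: \<open>ref_faces\<close> of any dimension, \<open>ref_facets\<close> of
  codimension one.
\<close>

definition ref_faces :: "(real^'n) set set" where
  "ref_faces = {{x \<in> cbox 0 1. \<forall>i\<in>I. x $ i = c i} | I c. I \<noteq> {} \<and> (\<forall>i. c i \<in> {0, 1})}"

definition ref_facets :: "(real^'n) set set" where
  "ref_facets = {{x \<in> cbox 0 1. x $ i = c} | i c. c \<in> {0, 1}}"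

definition facets :: "'n::finite mesh \<Rightarrow> (real^'n) set \<Rightarrow> (real^'n) set set" where
  "facets M K = (\<lambda>E. refmap M K ` E) ` ref_facets"

definition boundary_faces :: "'n::finite biot \<Rightarrow> 'n mesh \<Rightarrow> (real^'n) set set" where
  "boundary_faces P M = {F. \<exists>K \<in> cells M. F \<in> facets M K \<and> F \<subseteq> frontier (Omega P)}"

definition interior_faces :: "'n::finite mesh \<Rightarrow> (real^'n) set set" where
  "interior_faces M = {F. \<exists>K \<in> cells M. \<exists>K' \<in> cells M. K \<noteq> K' \<and>
     F = frontier K \<inter> frontier K' \<and> F \<in> facets M K \<and> F \<in> facets M K'}"

definition faces :: "'n::finite biot \<Rightarrow> 'n mesh \<Rightarrow> (real^'n) set set" where
  "faces P M = interior_faces M \<union> boundary_faces P M"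

text \<open>
  Up to null sets, so that it does not matter to which part of the boundary the common relative
  boundary of the Dirichlet and Neumann parts is counted.
\<close>

definition faces_on :: "'n::finite biot \<Rightarrow> 'n mesh \<Rightarrow> (real^'n) set \<Rightarrow> (real^'n) set set" where
  "faces_on P M G = {F \<in> boundary_faces P M. surface_area (F - G) = 0}"

definition boundary_compatible :: "'n::finite biot \<Rightarrow> 'n mesh \<Rightarrow> bool" where
  "boundary_compatible P M \<longleftrightarrow>
     (\<forall>G \<in> {GuD P, GuN P, GpD P, GpN P}. surface_area (G - \<Union>(faces_on P M G)) = 0)"

text \<open>
  Maps of degree at most one in each variable send the open square to strictly convex open
  quadrilaterals and the open cube to hexahedra. Nondegeneracy is required up to the boundary.
\<close>

definition cell_map :: "(real^'n \<Rightarrow> real^'n) \<Rightarrow> bool" where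
  "cell_map \<Phi> \<longleftrightarrow> (\<forall>i. (\<lambda>x. \<Phi> x $ i) \<in> Q_poly 1) \<and> inj_on \<Phi> (cbox 0 1) \<and>
     (\<forall>x \<in> cbox 0 1. det (jacobian \<Phi> (at x)) \<noteq> 0)"

text \<open>The mesh is conforming: closed cells meet in common vertices, edges or faces.\<close>

definition mesh_of :: "'n::finite biot \<Rightarrow> 'n mesh \<Rightarrow> bool" where
  "mesh_of P M \<longleftrightarrow>
     finite (cells M) \<and>
     (\<forall>K \<in> cells M. K \<subseteq> Omega P \<and> cell_map (refmap M K) \<and> K = refmap M K ` box 0 1) \<and>
     pairwise disjnt (cells M) \<and>
     closure (Omega P) = (\<Union>K \<in> cells M. closure K) \<and>
     (\<forall>K \<in> cells M. \<forall>K' \<in> cells M. K \<noteq> K' \<longrightarrow> closure K \<inter> closure K' = {} \<or>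
        (\<exists>E \<in> ref_faces. \<exists>E' \<in> ref_faces.
           closure K \<inter> closure K' = refmap M K ` E \<and> closure K \<inter> closure K' = refmap M K' ` E')) \<and>
     (\<forall>F \<in> boundary_faces P M. Kplus M F \<in> cells M \<and> F \<in> facets M (Kplus M F)) \<and>
     (\<forall>F \<in> interior_faces M. Kplus M F \<in> cells M \<and> Kminus M F \<in> cells M \<and>
        Kplus M F \<noteq> Kminus M F \<and> F = frontier (Kplus M F) \<inter> frontier (Kminus M F) \<and>
        F \<in> facets M (Kplus M F) \<and> F \<in> facets M (Kminus M F))"

definition mesh_size :: "'n::finite mesh \<Rightarrow> real" where
  "mesh_size M = Max (diameter ` cells M)"

text \<open>Every cell contains a ball whose radius is comparable to the largest cell diameter.\<close>

definition quasi_uniform :: "'n::finite biot \<Rightarrow> 'n mesh set \<Rightarrow> bool" where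
  "quasi_uniform P \<T> \<longleftrightarrow> (\<forall>M \<in> \<T>. mesh_of P M) \<and>
     (\<exists>\<sigma>>0. \<forall>M \<in> \<T>. \<forall>K \<in> cells M. \<exists>x. ball x (\<sigma> * mesh_size M) \<subseteq> K)"

definition volume :: "(real^'n) set \<Rightarrow> real" where
  "volume K = enn2real (hausdorff (real CARD('n)) K)"

definition h_face :: "'n::finite biot \<Rightarrow> 'n mesh \<Rightarrow> (real^'n) set \<Rightarrow> real" where
  "h_face P M F = (if F \<in> boundary_faces P M then volume (Kplus M F)
     else (volume (Kplus M F) + volume (Kminus M F)) / 2)"

definition normal :: "'n::finite biot \<Rightarrow> 'n mesh \<Rightarrow> (real^'n) set \<Rightarrow> real^'n \<Rightarrow> real^'n" where
  "normal P M F = outer_normal (if F \<in> boundary_faces P M then Omega P else Kplus M F)"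

definition average ::
  "'n::finite biot \<Rightarrow> 'n mesh \<Rightarrow> (real^'n) set \<Rightarrow> (real^'n \<Rightarrow> 'b::euclidean_space) \<Rightarrow> real^'n \<Rightarrow> 'b" where
  "average P M F w x = (if F \<in> boundary_faces P M then tr (Kplus M F) w x
     else (1/2) *\<^sub>R (tr (Kplus M F) w x + tr (Kminus M F) w x))"

definition jump ::
  "'n::finite biot \<Rightarrow> 'n mesh \<Rightarrow> (real^'n) set \<Rightarrow> (real^'n \<Rightarrow> 'b::euclidean_space) \<Rightarrow> real^'n \<Rightarrow> 'b" where
  "jump P M F w x = (if F \<in> boundary_faces P M then tr (Kplus M F) w x
     else tr (Kplus M F) w x - tr (Kminus M F) w x)"


section \<open>Finite element spaces\<close>

datatype pressure_space = Continuous | Discontinuous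

text \<open>
  To make equality of functions the equality of the paper (on the closed domain, respectively
  almost everywhere), functions are set to 0 outside the closed domain, respectively outside the
  union of the open cells.
\<close>

definition Vh :: "'n::finite biot \<Rightarrow> 'n mesh \<Rightarrow> nat \<Rightarrow> (real^'n \<Rightarrow> real^'n) set" where
  "Vh P M r = {v. (\<forall>i. H1 (Omega P) (\<lambda>x. v x $ i)) \<and> continuous_on (closure (Omega P)) v \<and>
     (\<forall>x. x \<notin> closure (Omega P) \<longrightarrow> v x = 0) \<and>
     (\<forall>K \<in> cells M. \<forall>i. \<exists>q \<in> Q_poly r. \<forall>x \<in> box 0 1. v (refmap M K x) $ i = q x)}"

fun Qh :: "'n::finite biot \<Rightarrow> 'n mesh \<Rightarrow> nat \<Rightarrow> pressure_space \<Rightarrow> (real^'n \<Rightarrow> real) set" where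
  "Qh P M r Continuous = {q. continuous_on (closure (Omega P)) q \<and>
     (\<forall>x. x \<notin> closure (Omega P) \<longrightarrow> q x = 0) \<and>
     (\<forall>K \<in> cells M. \<exists>p \<in> Q_poly (r - 1). \<forall>x \<in> box 0 1. q (refmap M K x) = p x)}"
| "Qh P M r Discontinuous = {q. L2_on lebesgue (Omega P) q \<and>
     (\<forall>x. x \<notin> \<Union>(cells M) \<longrightarrow> q x = 0) \<and>
     (\<forall>K \<in> cells M. \<exists>p \<in> P_poly (r - 1). \<forall>x \<in> box 0 1. q (refmap M K x) = p x)}"


section \<open>Bilinear forms\<close>

text \<open>
  Integrals over a boundary part are written as sums over the faces on that part. Derivatives of
  finite element functions on a boundary face, and discontinuous functions there, are the traces
  from the adjacent cell.
\<close>

definition traction ::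
  "'n::finite biot \<Rightarrow> 'n mesh \<Rightarrow> (real^'n) set \<Rightarrow> (real^'n \<Rightarrow> real^'n) \<Rightarrow> real^'n \<Rightarrow> real^'n" where
  "traction P M F w x =
     tensor_app (Cten P) (tr (Kplus M F) (strain w) x) *v normal P M F x"

definition flux ::
  "'n::finite biot \<Rightarrow> 'n mesh \<Rightarrow> (real^'n) set \<Rightarrow> (real^'n \<Rightarrow> real) \<Rightarrow> real^'n \<Rightarrow> real" where
  "flux P M F q x = average P M F (\<lambda>y. Kmat P *v grad q y) x \<bullet> normal P M F x"

definition a_form ::
  "'n::finite biot \<Rightarrow> 'n mesh \<Rightarrow> real \<Rightarrow> (real^'n \<Rightarrow> real^'n) \<Rightarrow> (real^'n \<Rightarrow> real^'n) \<Rightarrow> real" where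
  "a_form P M \<gamma>\<^sub>a w \<eta> =
     - (\<Sum>F \<in> faces_on P M (GuD P). surface_ip F w (traction P M F \<eta>))
     + (\<Sum>F \<in> faces_on P M (GuD P). \<gamma>\<^sub>a / h_face P M F * surface_ip F w \<eta>)"

definition b_form ::
  "'n::finite biot \<Rightarrow> 'n mesh \<Rightarrow> real \<Rightarrow> (real^'n \<Rightarrow> real) \<Rightarrow> (real^'n \<Rightarrow> real) \<Rightarrow> real" where
  "b_form P M \<gamma>\<^sub>b q \<psi> =
     - (\<Sum>F \<in> faces_on P M (GpD P). surface_ip F q (flux P M F \<psi>))
     + (\<Sum>F \<in> faces_on P M (GpD P). \<gamma>\<^sub>b / h_face P M F * surface_ip F q \<psi>)"

definition A_form ::
  "'n::finite biot \<Rightarrow> 'n mesh \<Rightarrow> real \<Rightarrow> (real^'n \<Rightarrow> real^'n) \<Rightarrow> (real^'n \<Rightarrow> real^'n) \<Rightarrow> real" where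
  "A_form P M \<gamma>\<^sub>a w \<eta> =
     ip (Omega P) (\<lambda>x. tensor_app (Cten P) (strain w x)) (strain \<eta>)
     - (\<Sum>F \<in> faces_on P M (GuD P). surface_ip F (traction P M F w) \<eta>)
     + a_form P M \<gamma>\<^sub>a w \<eta>"

definition C_form ::
  "'n::finite biot \<Rightarrow> 'n mesh \<Rightarrow> (real^'n \<Rightarrow> real^'n) \<Rightarrow> (real^'n \<Rightarrow> real) \<Rightarrow> real" where
  "C_form P M \<eta> q =
     - alpha P * ip (Omega P) (divergence \<eta>) q
     + alpha P * (\<Sum>F \<in> faces_on P M (GuD P).
         surface_ip F (\<lambda>x. \<eta> x \<bullet> normal P M F x) (tr (Kplus M F) q))"

text \<open>\<open>\<gamma>\<close> is the parameter of the chosen pressure space.\<close>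

fun B_form :: "'n::finite biot \<Rightarrow> 'n mesh \<Rightarrow> pressure_space \<Rightarrow> real \<Rightarrow>
    (real^'n \<Rightarrow> real) \<Rightarrow> (real^'n \<Rightarrow> real) \<Rightarrow> real" where
  "B_form P M Continuous \<gamma> q \<psi> =
     ip (Omega P) (\<lambda>x. Kmat P *v grad q x) (grad \<psi>)
     - (\<Sum>F \<in> faces_on P M (GpD P). surface_ip F (flux P M F q) \<psi>)
     + b_form P M \<gamma> q \<psi>"
| "B_form P M Discontinuous \<gamma> q \<psi> =
     (\<Sum>K \<in> cells M. ip K (\<lambda>x. Kmat P *v grad q x) (grad \<psi>))
     - (\<Sum>F \<in> faces P M. surface_ip F (flux P M F q) (jump P M F \<psi>)
                        + surface_ip F (jump P M F q) (flux P M F \<psi>))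
     + (\<Sum>F \<in> faces P M. \<gamma> / h_face P M F * surface_ip F (jump P M F q) (jump P M F \<psi>))"


section \<open>Data\<close>

text \<open>
  The volume forces and the Neumann data are given by their duality pairings: \<open>f_pair D t \<eta>\<close>
  and \<open>g_pair D t \<psi>\<close> are pairings over the domain, \<open>tN_pair D t \<eta>\<close> is the pairing over \<open>GuN\<close>, and
  \<open>pN_pair D t S \<psi>\<close> is the pairing over the boundary part \<open>S\<close> (the whole of \<open>GpN\<close> or one face).
\<close>

record ('n::finite) biot_data =
  f_pair :: "real \<Rightarrow> (real^'n \<Rightarrow> real^'n) \<Rightarrow> real"
  uD :: "real \<Rightarrow> real^'n \<Rightarrow> real^'n"
  vD :: "real \<Rightarrow> real^'n \<Rightarrow> real^'n"
  tN_pair :: "real \<Rightarrow> (real^'n \<Rightarrow> real^'n) \<Rightarrow> real"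
  g_pair :: "real \<Rightarrow> (real^'n \<Rightarrow> real) \<Rightarrow> real"
  pD :: "real \<Rightarrow> real^'n \<Rightarrow> real"
  pN_pair :: "real \<Rightarrow> (real^'n) set \<Rightarrow> (real^'n \<Rightarrow> real) \<Rightarrow> real"

definition F_functional :: "'n::finite biot \<Rightarrow> 'n mesh \<Rightarrow> real \<Rightarrow> 'n biot_data \<Rightarrow> real \<Rightarrow>
    (real^'n \<Rightarrow> real^'n) \<Rightarrow> real" where
  "F_functional P M \<gamma>\<^sub>a D t \<eta> = f_pair D t \<eta> - tN_pair D t \<eta> + a_form P M \<gamma>\<^sub>a (uD D t) \<eta>"

fun G_functional :: "'n::finite biot \<Rightarrow> 'n mesh \<Rightarrow> pressure_space \<Rightarrow> real \<Rightarrow> 'n biot_data \<Rightarrow> real \<Rightarrow>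
    (real^'n \<Rightarrow> real) \<Rightarrow> real" where
  "G_functional P M Continuous \<gamma> D t \<psi> =
     g_pair D t \<psi>
     - alpha P * (\<Sum>F \<in> faces_on P M (GuD P). surface_ip F (\<lambda>x. vD D t x \<bullet> normal P M F x) \<psi>)
     - pN_pair D t (GpN P) \<psi>
     + b_form P M \<gamma> (pD D t) \<psi>"
| "G_functional P M Discontinuous \<gamma> D t \<psi> =
     g_pair D t \<psi>
     - (\<Sum>F \<in> faces_on P M (GuD P).
          alpha P * surface_ip F (\<lambda>x. vD D t x \<bullet> normal P M F x) (tr (Kplus M F) \<psi>))
     - (\<Sum>F \<in> faces_on P M (GpD P). surface_ip F (pD D t) (flux P M F \<psi>))
     + (\<Sum>F \<in> faces_on P M (GpD P). \<gamma> / h_face P M F * surface_ip F (pD D t) (jump P M F \<psi>))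
     - (\<Sum>F \<in> faces_on P M (GpN P). pN_pair D t F (jump P M F \<psi>))"

definition linear_functional_on ::
  "('a \<Rightarrow> 'b::real_vector) set \<Rightarrow> (('a \<Rightarrow> 'b) \<Rightarrow> real) \<Rightarrow> bool" where
  "linear_functional_on B l \<longleftrightarrow> (\<forall>v \<in> B. \<forall>w \<in> B. \<forall>a b.
     l (\<lambda>x. a *\<^sub>R v x + b *\<^sub>R w x) = a * l v + b * l w)"

definition depends_on :: "'a set \<Rightarrow> (('a \<Rightarrow> 'b) \<Rightarrow> real) \<Rightarrow> bool" where
  "depends_on S l \<longleftrightarrow> (\<forall>v w. (\<forall>x \<in> S. v x = w x) \<longrightarrow> l v = l w)"

text \<open>\<open>v = \<partial>\<^sub>t u\<close> at time \<open>t\<close> as a map into the space of square integrable functions on \<open>G\<close>.\<close>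

definition L2_derivative :: "(real^'n) set \<Rightarrow> real set \<Rightarrow> (real \<Rightarrow> real^'n \<Rightarrow> real^'n) \<Rightarrow>
    (real^'n \<Rightarrow> real^'n) \<Rightarrow> real \<Rightarrow> bool" where
  "L2_derivative G J u v t \<longleftrightarrow>
     (\<forall>\<^sub>F s in at t within J. L2_on surface_measure G (u s)) \<and>
     L2_on surface_measure G (u t) \<and> L2_on surface_measure G v \<and>
     ((\<lambda>s. LINT x:G|surface_measure. (norm ((1 / (s - t)) *\<^sub>R (u s x - u t x) - v x))\<^sup>2)
        \<longlongrightarrow> 0) (at t within J)"

definition admissible_data_at :: "'n::finite biot \<Rightarrow> 'n mesh \<Rightarrow> nat \<Rightarrow> pressure_space \<Rightarrow> real \<Rightarrow>
    'n biot_data \<Rightarrow> real \<Rightarrow> bool" where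
  "admissible_data_at P M r ch T D t \<longleftrightarrow>
     linear_functional_on (Vh P M r) (f_pair D t) \<and>
     linear_functional_on (Vh P M r) (tN_pair D t) \<and> depends_on (GuN P) (tN_pair D t) \<and>
     linear_functional_on (Qh P M r ch) (g_pair D t) \<and>
     L2_derivative (GuD P) {0..T} (uD D) (vD D t) t \<and>
     L2_on surface_measure (GpD P) (pD D t) \<and>
     (case ch of
        Continuous \<Rightarrow> linear_functional_on (Qh P M r ch) (pN_pair D t (GpN P)) \<and>
          depends_on (GpN P) (pN_pair D t (GpN P))
      | Discontinuous \<Rightarrow> (\<forall>F \<in> faces_on P M (GpN P).
          linear_functional_on (Qh P M r ch) (\<lambda>\<psi>. pN_pair D t F (jump P M F \<psi>)) \<and>
          depends_on F (pN_pair D t F)))"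


section \<open>Time discretization\<close>

definition time_mesh :: "nat \<Rightarrow> real \<Rightarrow> (nat \<Rightarrow> real) \<Rightarrow> bool" where
  "time_mesh N T t \<longleftrightarrow> N \<ge> 1 \<and> t 0 = 0 \<and> t N = T \<and> (\<forall>n \<in> {1..N}. t (n - 1) < t n)"

definition time_interval :: "(nat \<Rightarrow> real) \<Rightarrow> nat \<Rightarrow> real set" where
  "time_interval t n = {t (n - 1) <.. t n}"

text \<open>
  Nodes and weights, indexed by \<open>1..k+1\<close>, of the right-sided Gauss-Radau formula on \<open>[-1, 1]\<close>,
  which is characterized by the fixed right end point and its degree of exactness.
\<close>

definition gauss_radau :: "nat \<Rightarrow> (nat \<Rightarrow> real) \<Rightarrow> (nat \<Rightarrow> real) \<Rightarrow> bool" where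
  "gauss_radau k \<zeta> \<omega> \<longleftrightarrow>
     strict_mono_on {1..k+1} \<zeta> \<and> (\<forall>\<mu> \<in> {1..k+1}. -1 < \<zeta> \<mu> \<and> \<zeta> \<mu> \<le> 1) \<and> \<zeta> (k+1) = 1 \<and>
     (\<forall>p :: real poly. degree p \<le> 2 * k \<longrightarrow>
        (\<Sum>\<mu>=1..k+1. \<omega> \<mu> * poly p (\<zeta> \<mu>)) = integral {-1..1} (poly p))"

definition quad_node :: "(nat \<Rightarrow> real) \<Rightarrow> (nat \<Rightarrow> real) \<Rightarrow> nat \<Rightarrow> nat \<Rightarrow> real" where
  "quad_node \<zeta> t n \<mu> = t (n - 1) + (t n - t (n - 1)) / 2 * (\<zeta> \<mu> + 1)"

definition quad :: "nat \<Rightarrow> (nat \<Rightarrow> real) \<Rightarrow> (nat \<Rightarrow> real) \<Rightarrow> (nat \<Rightarrow> real) \<Rightarrow> nat \<Rightarrow>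
    (real \<Rightarrow> real) \<Rightarrow> real" where
  "quad k \<zeta> \<omega> t n w = (t n - t (n - 1)) / 2 * (\<Sum>\<mu>=1..k+1. \<omega> \<mu> * w (quad_node \<zeta> t n \<mu>))"

definition admissible_data :: "'n::finite biot \<Rightarrow> 'n mesh \<Rightarrow> nat \<Rightarrow> pressure_space \<Rightarrow> nat \<Rightarrow>
    (nat \<Rightarrow> real) \<Rightarrow> nat \<Rightarrow> real \<Rightarrow> (nat \<Rightarrow> real) \<Rightarrow> 'n biot_data \<Rightarrow> bool" where
  "admissible_data P M r ch k \<zeta> N T t D \<longleftrightarrow>
     (\<forall>n \<in> {1..N}. \<forall>\<mu> \<in> {1..k+1}. admissible_data_at P M r ch T D (quad_node \<zeta> t n \<mu>))"

text \<open>
  As functions of time these live on \<open>I\<close> only; setting them to 0 outside \<open>I\<close> makes them unique.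
\<close>

definition time_poly ::
  "nat \<Rightarrow> real set \<Rightarrow> ('a \<Rightarrow> 'b::real_vector) set \<Rightarrow> (real \<Rightarrow> 'a \<Rightarrow> 'b) set" where
  "time_poly k I B = {w. \<exists>c :: nat \<Rightarrow> 'a \<Rightarrow> 'b. (\<forall>j \<le> k. c j \<in> B) \<and>
     (\<forall>s \<in> I. w s = (\<lambda>x. \<Sum>j\<le>k. s ^ j *\<^sub>R c j x)) \<and> (\<forall>s. s \<notin> I \<longrightarrow> w s = (\<lambda>x. 0))}"

definition dt :: "real set \<Rightarrow> (real \<Rightarrow> 'a \<Rightarrow> 'b::real_normed_vector) \<Rightarrow> real \<Rightarrow> 'a \<Rightarrow> 'b" where
  "dt I w s x = vector_derivative (\<lambda>\<sigma>. w \<sigma> x) (at s within I)"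

definition right_lim :: "real \<Rightarrow> (real \<Rightarrow> 'a \<Rightarrow> 'b::t2_space) \<Rightarrow> 'a \<Rightarrow> 'b" where
  "right_lim s w x = Lim (at_right s) (\<lambda>\<sigma>. w \<sigma> x)"

end

(*
  Only symmetry and positive semidefiniteness of the two Nitsche forms are needed, not coercivity.
  For a fixed mesh they follow for large parameters because the traction (flux) on the faces vanishes
  whenever the strain (gradient) vanishes on the cells, so that on the finite dimensional spaces its
  square norm is bounded by the energy.

  The space-time problem is a square linear system, so it suffices to show that the homogeneous
  problem has only the zero solution. Since all quadrature weights are positive and the formula is
  exact up to degree 2k, the first equation gives v = u' + kappa u(t_{n-1}+) at the nodes. Testing the
  other two equations with v and p, the coupling terms cancel and the energy identity shows that v
  vanishes at both end points, p vanishes at the left one, and u(t_{n-1}+) and the nodal values of p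
  lie in the kernels of the forms. Hence, as polynomials in time, rho v'' + A v + C* p' = 0 and
  c_0 p' = C v. Comparing the top coefficients leaves only polynomials v of degree at most 1, which
  are zero because of their two zeros; then p = 0 and u = 0.
*)

theory Submission
  imports Defs "HOL-Library.Function_Algebras"
begin

text \<open>The energy identity controls \<open>v\<close> only at the two ends of the time interval,
  and \<open>A\<close> and \<open>B\<close> may have kernels, so it does not bring the interior
  nodal values to zero. Hence the passage to coefficients in time: an identity of degree at most
  \<open>k\<close> that holds at the \<open>k + 1\<close> nodes holds for polynomials and may be
  differentiated. In v = u' + kappa u(t_{n-1}+) the correction kappa consists of values of the
  Lagrange basis polynomials at the left end, divided by the weights. Interpolation sums them to the
  very term that gives the initial elastic energy a positive sign; afterwards A u(t_{n-1}+) = 0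
  removes kappa from A v = A u'.

  Much of the analysis has one source: integrals are additive only on integrable functions.
  Bilinearity of the forms thus rests on bounded measurable traces, a Borel measurable outer normal
  and faces of finite area. The weights \<open>h_face\<close> must be positive, which takes cell
  volumes that are positive and finite, and boundary data must restrict to single faces, which
  belong to a boundary part only up to null sets.\<close>

section \<open>Linear algebra on finite dimensional subspaces\<close>

text \<open>Turns sets of functions into subsets of a real vector space, with the addition of
  \<open>Function_Algebras\<close>, so that spans and bases apply to finite element functions and to
  their polynomials in time.\<close>

instantiation "fun" :: (type, real_vector) real_vector
begin

definition "c *\<^sub>R f = (\<lambda>x. c *\<^sub>R f x)"

instance
  by standard (auto simp: scaleR_fun_def fun_eq_iff algebra_simps)

end

lemma scaleR_fun_apply [simp]: "(c *\<^sub>R f) x = c *\<^sub>R f x"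
  by (simp add: scaleR_fun_def)

lemma sum_fun_apply: "(\<Sum>i\<in>A. f i) x = (\<Sum>i\<in>A. f i x)"
  by (induction A rule: infinite_finite_induct) auto

text \<open>Relative to a set, because derivatives, traces and integrals are linear only on
  functions that are regular enough.\<close>

definition lin_on :: "'a::real_vector set \<Rightarrow> ('a \<Rightarrow> 'b::real_vector) \<Rightarrow> bool" where
  "lin_on S f \<longleftrightarrow> (\<forall>x\<in>S. \<forall>y\<in>S. \<forall>a b. f (a *\<^sub>R x + b *\<^sub>R y) = a *\<^sub>R f x + b *\<^sub>R f y)"

lemma lin_onI:
  "(\<And>x y a b. x \<in> S \<Longrightarrow> y \<in> S \<Longrightarrow> f (a *\<^sub>R x + b *\<^sub>R y) = a *\<^sub>R f x + b *\<^sub>R f y) \<Longrightarrow> lin_on S f"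
  by (simp add: lin_on_def)

lemma lin_onD:
  "lin_on S f \<Longrightarrow> x \<in> S \<Longrightarrow> y \<in> S \<Longrightarrow> f (a *\<^sub>R x + b *\<^sub>R y) = a *\<^sub>R f x + b *\<^sub>R f y"
  by (simp add: lin_on_def)

lemma lin_on_add: "lin_on S f \<Longrightarrow> x \<in> S \<Longrightarrow> y \<in> S \<Longrightarrow> f (x + y) = f x + f y"
  using lin_onD[of S f x y 1 1] by simp

lemma lin_on_diff: "lin_on S f \<Longrightarrow> x \<in> S \<Longrightarrow> y \<in> S \<Longrightarrow> f (x - y) = f x - f y"
  using lin_onD[of S f x y 1 "-1"] by simp

lemma lin_on_scale: "lin_on S f \<Longrightarrow> x \<in> S \<Longrightarrow> f (a *\<^sub>R x) = a *\<^sub>R f x"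
  using lin_onD[of S f x x a 0] by simp

lemma lin_on_zero: "lin_on S f \<Longrightarrow> 0 \<in> S \<Longrightarrow> f 0 = 0"
  using lin_on_scale[of S f 0 0] by simp

lemma lin_on_sum:
  assumes "lin_on S f" "subspace S" "\<And>i. i \<in> A \<Longrightarrow> x i \<in> S"
  shows "f (\<Sum>i\<in>A. c i *\<^sub>R x i) = (\<Sum>i\<in>A. c i *\<^sub>R f (x i))"
  using assms(3)
proof (induction A rule: infinite_finite_induct)
  case (insert i A)
  have "(\<Sum>i\<in>A. c i *\<^sub>R x i) \<in> S"
    using insert.prems by (intro subspace_sum subspace_scale assms(2)) auto
  moreover have "c i *\<^sub>R x i \<in> S"
    using insert.prems by (intro subspace_scale assms(2)) auto
  ultimately show ?case
    using insert assms(1) by (simp add: lin_on_add lin_on_scale)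
qed (use assms in \<open>auto intro: lin_on_zero subspace_0\<close>)

lemma lin_on_combination:
  assumes "lin_on S f" "subspace S" "A \<subseteq> S"
  shows "f (\<Sum>e\<in>A. c e *\<^sub>R e) = (\<Sum>e\<in>A. c e *\<^sub>R f e)"
  by (rule lin_on_sum[OF assms(1,2)]) (use assms(3) in auto)

lemma lin_on_const_zero: "lin_on S (\<lambda>x. 0)"
  by (simp add: lin_on_def)

lemma lin_on_plus: "lin_on S f \<Longrightarrow> lin_on S g \<Longrightarrow> lin_on S (\<lambda>x. f x + g x)"
  by (auto simp: lin_on_def algebra_simps)

lemma lin_on_minus: "lin_on S f \<Longrightarrow> lin_on S g \<Longrightarrow> lin_on S (\<lambda>x. f x - g x)"
  by (auto simp: lin_on_def algebra_simps)

lemma lin_on_uminus: "lin_on S f \<Longrightarrow> lin_on S (\<lambda>x. - f x)"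
  by (auto simp: lin_on_def algebra_simps)

lemma lin_on_mult:
  fixes f :: "'a::real_vector \<Rightarrow> real"
  shows "lin_on S f \<Longrightarrow> lin_on S (\<lambda>x. c * f x)"
  by (auto simp: lin_on_def algebra_simps)

lemma lin_on_setsum: "(\<And>i. i \<in> A \<Longrightarrow> lin_on S (f i)) \<Longrightarrow> lin_on S (\<lambda>x. \<Sum>i\<in>A. f i x)"
  by (auto simp: lin_on_def sum.distrib scaleR_sum_right)

definition bilin_on ::
  "'a::real_vector set \<Rightarrow> 'b::real_vector set \<Rightarrow> ('a \<Rightarrow> 'b \<Rightarrow> real) \<Rightarrow> bool" where
  "bilin_on S T f \<longleftrightarrow> (\<forall>y\<in>T. lin_on S (\<lambda>x. f x y)) \<and> (\<forall>x\<in>S. lin_on T (f x))"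

lemma bilin_on_left: "bilin_on S T f \<Longrightarrow> y \<in> T \<Longrightarrow> lin_on S (\<lambda>x. f x y)"
  and bilin_on_right: "bilin_on S T f \<Longrightarrow> x \<in> S \<Longrightarrow> lin_on T (f x)"
  by (auto simp: bilin_on_def)

section \<open>Finite dimension and square linear systems\<close>

definition fin_dim :: "'a::real_vector set \<Rightarrow> bool" where
  "fin_dim S \<longleftrightarrow> subspace S \<and> (\<exists>B. finite B \<and> S \<subseteq> span B)"

lemma span_combination: "finite B \<Longrightarrow> x \<in> span B \<Longrightarrow> \<exists>d. x = (\<Sum>e\<in>B. d e *\<^sub>R e)"
  by (auto simp: span_finite)

lemma fin_dim_basis:
  assumes "fin_dim S"
  obtains B where "finite B" "B \<subseteq> S" "independent B" "S = span B"
proof -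
  obtain C where C: "finite C" "S \<subseteq> span C" and S: "subspace S"
    using assms unfolding fin_dim_def by blast
  obtain B where B: "B \<subseteq> S" "independent B" "S \<subseteq> span B"
    using basis_exists[of S] by metis
  show ?thesis
  proof (rule that)
    show "finite B"
      using independent_span_bound[OF C(1) B(2)] B C by blast
    show "S = span B"
      using B S by (simp add: span_minimal subset_antisym)
  qed fact+
qed

text \<open>A basis of \<open>S\<close> has an independent image inside the span of a finite set,
  hence is finite itself.\<close>

lemma fin_dim_inj_image:
  assumes S: "subspace S" and f: "linear f" "inj_on f S" "f ` S \<subseteq> span C" "finite C"
  shows "fin_dim S"
proof -
  obtain B where B: "B \<subseteq> S" "independent B" "S \<subseteq> span B"
    using basis_exists[of S] by metis
  have SB: "span B = S"
    using B S by (simp add: span_minimal subset_antisym)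
  have "independent (f ` B)"
    using linear_independent_injective_image[OF f(1) B(2)] f(2) SB by simp
  moreover have "f ` B \<subseteq> span C"
    using B f(3) by blast
  ultimately have "finite (f ` B)"
    using independent_span_bound f(4) by blast
  moreover have "inj_on f B"
    using B f(2) inj_on_subset by blast
  ultimately show ?thesis
    using S B finite_imageD unfolding fin_dim_def by blast
qed

lemma span_Times_subset:
  "span A \<times> span B \<subseteq> span ((\<lambda>a. (a, 0)) ` A \<union> (\<lambda>b. (0, b)) ` B)" (is "_ \<subseteq> span ?C")
proof clarify
  fix a b assume ab: "a \<in> span A" "b \<in> span B"
  have "linear (\<lambda>a::'a. (a, 0::'b))" "linear (\<lambda>b::'b. (0::'a, b))"
    by (auto intro!: linearI)
  from this[THEN linear_span_image] ab
  have "(a, 0) \<in> span ((\<lambda>a::'a. (a, 0::'b)) ` A)" "(0, b) \<in> span ((\<lambda>b::'b. (0::'a, b)) ` B)"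
    by auto
  then have "(a, 0) \<in> span ?C" "(0, b) \<in> span ?C"
    by (meson UnCI span_mono subsetD subsetI)+
  from span_add[OF this] show "(a, b) \<in> span ?C"
    by simp
qed

lemma fin_dim_Times:
  assumes "fin_dim S" "fin_dim T"
  shows "fin_dim (S \<times> T)"
proof -
  obtain A B where A: "finite A" "S \<subseteq> span A" and B: "finite B" "T \<subseteq> span B"
    and sub: "subspace S" "subspace T"
    using assms unfolding fin_dim_def by blast
  let ?C = "(\<lambda>a. (a, 0)) ` A \<union> (\<lambda>b. (0, b)) ` B"
  have "S \<times> T \<subseteq> span ?C"
    by (rule order_trans[OF Sigma_mono[OF A(2) B(2)] span_Times_subset])
  moreover have "finite ?C"
    using A B by simp
  moreover have "subspace (S \<times> T)"
    by (rule subspace_Times[OF sub])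
  ultimately show ?thesis
    unfolding fin_dim_def by metis
qed

text \<open>Gaussian elimination by induction on the equations: one with a nonzero coefficient at
  \<open>j0\<close> is solved for that unknown, which leaves the reduced matrix \<open>G'\<close>
  for the others.\<close>

lemma underdetermined_system:
  fixes G :: "'i \<Rightarrow> 'j \<Rightarrow> real"
  assumes "finite I" "finite J" "card I < card J"
  shows "\<exists>c. (\<exists>j\<in>J. c j \<noteq> 0) \<and> (\<forall>i\<in>I. (\<Sum>j\<in>J. G i j * c j) = 0)"
  using assms
proof (induction I arbitrary: J G rule: finite_induct)
  case empty
  then show ?case
    by (intro exI[of _ "\<lambda>_. 1"]) (auto simp: card_gt_0_iff)
next
  case (insert i0 I)
  show ?case
  proof (cases "\<forall>j\<in>J. G i0 j = 0")
    case True
    then show ?thesis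
      using insert.IH[of J G] insert.prems insert.hyps by auto
  next
    case False
    then obtain j0 where j0: "j0 \<in> J" "G i0 j0 \<noteq> 0"
      by auto
    define J' where "J' = J - {j0}"
    define G' where "G' i j = G i j - G i j0 * G i0 j / G i0 j0" for i j
    have J: "J = insert j0 J'" "finite J'" "j0 \<notin> J'"
      using j0 insert.prems by (auto simp: J'_def)
    have "card I < card J'"
      using insert.prems insert.hyps J by auto
    then obtain c where c: "\<exists>j\<in>J'. c j \<noteq> 0" "\<And>i. i \<in> I \<Longrightarrow> (\<Sum>j\<in>J'. G' i j * c j) = 0"
      using insert.IH[of J' G'] J by auto
    define s where "s = (\<Sum>j\<in>J'. G i0 j * c j)"
    define d where "d = c(j0 := - s / G i0 j0)"
    have sum_d: "(\<Sum>j\<in>J. G i j * d j) = (\<Sum>j\<in>J'. G i j * c j) - G i j0 * s / G i0 j0" for i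
    proof -
      have "(\<Sum>j\<in>J'. G i j * d j) = (\<Sum>j\<in>J'. G i j * c j)"
        using J by (intro sum.cong) (auto simp: d_def)
      then show ?thesis
        using J by (simp add: d_def)
    qed
    have "(\<Sum>j\<in>J. G i j * d j) = 0" if "i \<in> I" for i
    proof -
      have "(\<Sum>j\<in>J'. G' i j * c j) = (\<Sum>j\<in>J'. G i j * c j) - G i j0 / G i0 j0 * s"
        by (simp add: G'_def s_def algebra_simps sum_subtractf sum_distrib_left)
      then show ?thesis
        using c(2)[OF that] by (simp add: sum_d)
    qed
    moreover have "(\<Sum>j\<in>J. G i0 j * d j) = 0"
      using j0 by (simp add: sum_d s_def)
    moreover have "\<exists>j\<in>J. d j \<noteq> 0"
      using c(1) J by (auto simp: d_def)
    ultimately show ?thesis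
      by blast
  qed
qed

text \<open>Uniqueness yields existence by counting. A multiplier of the right-hand side, the index
  \<open>None\<close>, joins the coordinates of \<open>x\<close>, so there are more unknowns than
  basis equations. In a nontrivial solution the multiplier is nonzero, since otherwise nondegeneracy
  and independence force all coordinates to vanish; division by it gives \<open>z\<close>.\<close>

lemma galerkin:
  assumes S: "fin_dim S" and bil: "bilin_on S S b" and l: "lin_on S l"
    and nondeg: "\<And>x. x \<in> S \<Longrightarrow> (\<And>y. y \<in> S \<Longrightarrow> b x y = 0) \<Longrightarrow> x = 0"
  shows "\<exists>!x. x \<in> S \<and> (\<forall>y\<in>S. b x y = l y)"
proof -
  obtain B where B: "finite B" "B \<subseteq> S" "independent B" "S = span B"
    using fin_dim_basis[OF S] .
  have sub: "subspace S"
    using S by (simp add: fin_dim_def)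
  define J where "J = insert None (Some ` B)"
  have J: "finite J" "card B < card J"
    using B by (auto simp: J_def card_image)
  define G where "G e j = (case j of None \<Rightarrow> - l e | Some e' \<Rightarrow> b e' e)" for e j
  obtain c where c: "\<exists>j\<in>J. c j \<noteq> 0" "\<And>e. e \<in> B \<Longrightarrow> (\<Sum>j\<in>J. G e j * c j) = 0"
    using underdetermined_system[OF B(1) J, of G] by auto
  define x where "x = (\<Sum>e\<in>B. c (Some e) *\<^sub>R e)"
  have x: "x \<in> S"
    unfolding x_def using B by (intro subspace_sum subspace_scale sub) auto
  have on_basis: "b x e = c None * l e" if "e \<in> B" for e
  proof -
    have "(\<Sum>j\<in>J. G e j * c j) = - l e * c None + (\<Sum>e'\<in>B. c (Some e') * b e' e)"
      using B(1) by (simp add: J_def G_def sum.reindex mult.commute)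
    moreover have "b x e = (\<Sum>e'\<in>B. c (Some e') * b e' e)"
      unfolding x_def
      using lin_on_combination[OF bilin_on_left[OF bil] sub B(2), of e "\<lambda>e. c (Some e)"] B(2) that
      by (simp add: subset_iff)
    ultimately show ?thesis
      using c(2)[OF that] by simp
  qed
  have eq: "b x y = c None * l y" if yS: "y \<in> S" for y
  proof -
    obtain d where y: "y = (\<Sum>e\<in>B. d e *\<^sub>R e)"
      using span_combination[OF B(1) yS[unfolded B(4)]] by blast
    have "b x y = (\<Sum>e\<in>B. d e * b x e)" "l y = (\<Sum>e\<in>B. d e * l e)"
      unfolding y using lin_on_combination[OF bilin_on_right[OF bil x] sub B(2)]
        lin_on_combination[OF l sub B(2)] by simp_all
    then show ?thesis
      by (simp add: on_basis sum_distrib_left mult.left_commute)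
  qed
  have "c None \<noteq> 0"
  proof
    assume 0: "c None = 0"
    then have "x = 0"
      using nondeg[OF x] eq by simp
    then have "c (Some e) = 0" if "e \<in> B" for e
      using that B independentD[OF B(3,1) subset_refl] unfolding x_def by auto
    then show False
      using c(1) 0 by (auto simp: J_def)
  qed
  define z where "z = (1 / c None) *\<^sub>R x"
  have z: "z \<in> S"
    unfolding z_def by (intro subspace_scale sub x)
  have bz: "b z y = l y" if "y \<in> S" for y
    using lin_on_scale[OF bilin_on_left[OF bil that] x, of "1 / c None"] \<open>c None \<noteq> 0\<close> eq[OF that]
    by (simp add: z_def)
  show ?thesis
  proof (rule ex1I[of _ z])
    show "z \<in> S \<and> (\<forall>y\<in>S. b z y = l y)"
      using z bz by blast
    fix w assume w: "w \<in> S \<and> (\<forall>y\<in>S. b w y = l y)"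
    have "b (w - z) y = 0" if "y \<in> S" for y
      using lin_on_diff[OF bilin_on_left[OF bil that], of w z] w z bz that by simp
    then have "w - z = 0"
      using nondeg[of "w - z"] w z sub subspace_diff by blast
    then show "w = z"
      by simp
  qed
qed

section \<open>Positive semidefinite forms\<close>

definition psd_form :: "'a::real_vector set \<Rightarrow> ('a \<Rightarrow> 'a \<Rightarrow> real) \<Rightarrow> bool" where
  "psd_form S f \<longleftrightarrow> bilin_on S S f \<and> (\<forall>x\<in>S. \<forall>y\<in>S. f x y = f y x) \<and> (\<forall>x\<in>S. f x x \<ge> 0)"

lemma psd_formD:
  assumes "psd_form S f"
  shows "bilin_on S S f" "x \<in> S \<Longrightarrow> y \<in> S \<Longrightarrow> f x y = f y x" "x \<in> S \<Longrightarrow> f x x \<ge> 0"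
  using assms by (auto simp: psd_form_def)

text \<open>As \<open>f x x = 0\<close>, the quadratic form at \<open>c *\<^sub>R x + y\<close> is
  affine in \<open>c\<close> with slope \<open>2 * f x y\<close>. A nonzero slope would allow
  negative values; \<open>c\<close> is chosen to produce -1.\<close>

lemma psd_form_kernel:
  assumes f: "psd_form S f" and S: "subspace S" and x: "x \<in> S" "f x x = 0" and y: "y \<in> S"
  shows "f x y = 0"
proof (rule ccontr)
  assume ne: "f x y \<noteq> 0"
  define c where "c = - (f y y + 1) / (2 * f x y)"
  have bil: "bilin_on S S f"
    using f by (simp add: psd_form_def)
  have z: "c *\<^sub>R x + y \<in> S" "c *\<^sub>R x \<in> S"
    using x y S by (auto intro: subspace_add subspace_scale)
  have "f (c *\<^sub>R x + y) (c *\<^sub>R x + y) = c * (f x (c *\<^sub>R x + y)) + f y (c *\<^sub>R x + y)"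
    using lin_onD[OF bilin_on_left[OF bil z(1)] x(1) y, of c 1] by simp
  also have "f x (c *\<^sub>R x + y) = c * f x x + f x y"
    using lin_onD[OF bilin_on_right[OF bil x(1)] x(1) y, of c 1] by simp
  also have "f y (c *\<^sub>R x + y) = c * f y x + f y y"
    using lin_onD[OF bilin_on_right[OF bil y] x(1) y, of c 1] by simp
  also have "f y x = f x y"
    using f x y by (simp add: psd_form_def)
  finally have "f (c *\<^sub>R x + y) (c *\<^sub>R x + y) = 2 * c * f x y + f y y"
    using x by simp
  also have "\<dots> = -1"
    using ne by (simp add: c_def field_simps)
  finally show False
    using f z by (force simp: psd_form_def)
qed

text \<open>Gram-Schmidt for a form that may be degenerate. A vector \<open>e\<close> with
  \<open>f e e = 0\<close> gets the coefficient \<open>f b e / f e e = 0\<close> by the convention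
  on division by zero, and orthogonality to it is automatic by
  \<open>psd_form_kernel\<close>.\<close>

lemma psd_form_orthogonal_basis:
  assumes f: "psd_form S f" and S: "subspace S" and B: "finite B" "B \<subseteq> S"
  shows "\<exists>B'. finite B' \<and> B' \<subseteq> S \<and> B \<subseteq> span B' \<and>
    (\<forall>x\<in>B'. \<forall>y\<in>B'. x \<noteq> y \<longrightarrow> f x y = 0)"
  using B
proof (induction B rule: finite_induct)
  case empty
  then show ?case by (intro exI[of _ "{}"]) auto
next
  case (insert b B)
  then obtain B' where B': "finite B'" "B' \<subseteq> S" "B \<subseteq> span B'"
    and orth: "\<And>x y. x \<in> B' \<Longrightarrow> y \<in> B' \<Longrightarrow> x \<noteq> y \<Longrightarrow> f x y = 0"
    by auto
  have b: "b \<in> S" and bil: "bilin_on S S f" and sym: "\<And>x y. x \<in> S \<Longrightarrow> y \<in> S \<Longrightarrow> f x y = f y x"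
    using insert.prems f by (auto simp: psd_form_def)
  define p where "p = (\<Sum>e\<in>B'. (f b e / f e e) *\<^sub>R e)"
  have p: "p \<in> S" "p \<in> span B'"
    unfolding p_def using B'
    by (blast intro: subspace_sum subspace_scale S, blast intro: span_sum span_scale span_base)
  have b'S: "b - p \<in> S"
    using b p S by (simp add: subspace_diff)
  have ort: "f (b - p) e = 0" if e: "e \<in> B'" for e
  proof (cases "f e e = 0")
    case True
    then show ?thesis
      using psd_form_kernel[OF f S _ True b'S] sym[of e "b - p"] e B' b'S by auto
  next
    case False
    have eS: "e \<in> S"
      using e B' by auto
    have "f p e = (\<Sum>e'\<in>B'. (f b e' / f e' e') * f e' e)"
      unfolding p_def using lin_on_combination[OF bilin_on_left[OF bil eS] S B'(2)] by simp
    also have "\<dots> = (\<Sum>e'\<in>B'. if e' = e then f b e else 0)"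
      using orth e False by (intro sum.cong) auto
    also have "\<dots> = f b e"
      using e B' by simp
    finally show ?thesis
      using lin_on_diff[OF bilin_on_left[OF bil eS] b p(1)] by simp
  qed
  show ?case
  proof (intro exI[of _ "insert (b - p) B'"] conjI ballI impI)
    have "b - p \<in> span (insert (b - p) B')" "p \<in> span (insert (b - p) B')"
      using p(2) span_mono[of B' "insert (b - p) B'"] by (auto intro: span_base)
    from span_add[OF this] have "b \<in> span (insert (b - p) B')"
      by simp
    then show "insert b B \<subseteq> span (insert (b - p) B')"
      using B'(3) span_mono[of B' "insert (b - p) B'"] by auto
    fix x y assume xy: "x \<in> insert (b - p) B'" "y \<in> insert (b - p) B'" "x \<noteq> y"
    then show "f x y = 0"
      using orth ort sym[of _ "b - p"] b'S B' by (metis insert_iff subsetD)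
  qed (use B' b'S in auto)
qed

text \<open>Replaces inverse trace inequalities: on a fixed finite dimensional space the inclusion of the
  kernels suffices.\<close>

lemma psd_form_dominated:
  assumes f: "psd_form S f" and g: "psd_form S g" and S: "fin_dim S"
    and ker: "\<And>x. x \<in> S \<Longrightarrow> f x x = 0 \<Longrightarrow> g x x = 0"
  shows "\<exists>C\<ge>0. \<forall>x\<in>S. g x x \<le> C * f x x"
proof -
  have sub: "subspace S"
    using S by (simp add: fin_dim_def)
  obtain B0 where B0: "finite B0" "B0 \<subseteq> S" "independent B0" "S = span B0"
    using fin_dim_basis[OF S] .
  obtain B where B: "finite B" "B \<subseteq> S" "B0 \<subseteq> span B"
    and orth: "\<And>x y. x \<in> B \<Longrightarrow> y \<in> B \<Longrightarrow> x \<noteq> y \<Longrightarrow> f x y = 0"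
    using psd_form_orthogonal_basis[OF f sub B0(1,2)] by auto
  have SB: "S \<subseteq> span B"
    unfolding B0(4) by (rule span_minimal[OF B(3) subspace_span])
  have expand: "h x x = (\<Sum>e\<in>B. \<Sum>e'\<in>B. c e * c e' * h e e')"
    if "bilin_on S S h" "x = (\<Sum>e\<in>B. c e *\<^sub>R e)" "x \<in> S" for h :: "'a \<Rightarrow> 'a \<Rightarrow> real" and x c
  proof -
    have "h x x = (\<Sum>e\<in>B. c e * h e x)"
      using lin_on_combination[OF bilin_on_left[OF that(1,3)] sub B(2), of c] that(2) by simp
    also have "\<dots> = (\<Sum>e\<in>B. c e * (\<Sum>e'\<in>B. c e' * h e e'))"
    proof (intro sum.cong refl)
      fix e assume "e \<in> B"
      then show "c e * h e x = c e * (\<Sum>e'\<in>B. c e' * h e e')"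
        using lin_on_combination[OF bilin_on_right[OF that(1)] sub B(2), of e c] B(2) that(2)
        by (simp add: subset_iff)
    qed
    finally show ?thesis
      by (simp add: sum_distrib_left mult.assoc)
  qed
  \<comment> \<open>The factor \<open>card B\<close> comes from removing the mixed terms of
    \<open>g\<close>, and each quotient from \<open>(c e)\<^sup>2 * f e e \<le> f x x\<close>. If
    \<open>f e e = 0\<close> the quotient is 0 by convention, in accordance with
    \<open>g e e = 0\<close> from \<open>ker\<close>.\<close>
  define C where "C = real (card B) * (\<Sum>e\<in>B. g e e / f e e)"
  have nn: "f x x \<ge> 0" "g x x \<ge> 0" if "x \<in> S" for x
    using that f g by (auto simp: psd_form_def)
  have C0: "C \<ge> 0"
    unfolding C_def using nn B by (intro mult_nonneg_nonneg sum_nonneg divide_nonneg_nonneg) auto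
  have "g x x \<le> C * f x x" if x: "x \<in> S" for x
  proof -
    obtain c where c: "x = (\<Sum>e\<in>B. c e *\<^sub>R e)"
      using span_combination[OF B(1) subsetD[OF SB x]] by blast
    have bf: "bilin_on S S f" and bg: "bilin_on S S g"
      using f g by (auto simp: psd_form_def)
    have fx: "f x x = (\<Sum>e\<in>B. (c e)\<^sup>2 * f e e)"
    proof -
      have "f x x = (\<Sum>e\<in>B. \<Sum>e'\<in>B. c e * c e' * f e e')"
        by (rule expand[OF bf c x])
      also have "\<dots> = (\<Sum>e\<in>B. \<Sum>e'\<in>B. if e' = e then (c e)\<^sup>2 * f e e else 0)"
        using orth by (intro sum.cong) (auto simp: power2_eq_square)
      finally show ?thesis
        using B by simp
    qed
    \<comment> \<open>Nonnegativity of \<open>g\<close> at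
      \<open>c e *\<^sub>R e - c e' *\<^sub>R e'\<close>. It handles the mixed terms of
      \<open>g\<close>, for which \<open>B\<close> need not be orthogonal.\<close>
    have gb: "2 * (c e * c e' * g e e') \<le> (c e)\<^sup>2 * g e e + (c e')\<^sup>2 * g e' e'"
      if "e \<in> B" "e' \<in> B" for e e'
    proof -
      let ?d = "c e *\<^sub>R e + (- c e') *\<^sub>R e'"
      have m: "e \<in> S" "e' \<in> S"
        using that B by auto
      then have m: "e \<in> S" "e' \<in> S" "?d \<in> S"
        by (blast intro: subspace_add subspace_scale sub)+
      have "0 \<le> g ?d ?d"
        using nn m by blast
      also have "g ?d ?d = c e * g e ?d + (- c e') * g e' ?d"
        using lin_onD[OF bilin_on_left[OF bg m(3)] m(1,2), of "c e" "- c e'"] by simp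
      also have "g e ?d = c e * g e e + (- c e') * g e e'"
        using lin_onD[OF bilin_on_right[OF bg m(1)] m(1,2), of "c e" "- c e'"] by simp
      also have "g e' ?d = c e * g e' e + (- c e') * g e' e'"
        using lin_onD[OF bilin_on_right[OF bg m(2)] m(1,2), of "c e" "- c e'"] by simp
      also have "g e' e = g e e'"
        using g m by (simp add: psd_form_def)
      finally show ?thesis
        by (simp add: algebra_simps power2_eq_square)
    qed
    have "2 * g x x = (\<Sum>e\<in>B. \<Sum>e'\<in>B. 2 * (c e * c e' * g e e'))"
      using expand[OF bg c x] by (simp add: sum_distrib_left)
    also have "\<dots> \<le> (\<Sum>e\<in>B. \<Sum>e'\<in>B. (c e)\<^sup>2 * g e e + (c e')\<^sup>2 * g e' e')"
      using gb by (intro sum_mono) auto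
    also have "\<dots> = 2 * (real (card B) * (\<Sum>e\<in>B. (c e)\<^sup>2 * g e e))"
      by (simp add: sum.distrib flip: sum_distrib_left)
    finally have 1: "g x x \<le> real (card B) * (\<Sum>e\<in>B. (c e)\<^sup>2 * g e e)"
      by simp
    have 2: "(c e)\<^sup>2 * g e e \<le> g e e / f e e * f x x" if e: "e \<in> B" for e
    proof -
      have eS: "e \<in> S"
        using e B by auto
      have "(c e)\<^sup>2 * f e e \<le> f x x"
        unfolding fx using e B nn by (intro member_le_sum) auto
      then have "g e e / f e e * ((c e)\<^sup>2 * f e e) \<le> g e e / f e e * f x x"
        using nn eS by (intro mult_left_mono) auto
      moreover have "(c e)\<^sup>2 * g e e = g e e / f e e * ((c e)\<^sup>2 * f e e)"
        using ker[OF eS] by (cases "f e e = 0") auto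
      ultimately show ?thesis by simp
    qed
    have "(\<Sum>e\<in>B. (c e)\<^sup>2 * g e e) \<le> (\<Sum>e\<in>B. g e e / f e e * f x x)"
      using 2 by (intro sum_mono) auto
    then have "real (card B) * (\<Sum>e\<in>B. (c e)\<^sup>2 * g e e) \<le> C * f x x"
      unfolding C_def by (simp add: mult_left_mono sum_distrib_right mult.assoc)
    with 1 show ?thesis by linarith
  qed
  with C0 show ?thesis by blast
qed

section \<open>Uniqueness for the discontinuous Galerkin time step\<close>

definition peval :: "nat \<Rightarrow> (nat \<Rightarrow> 'a::real_vector) \<Rightarrow> real \<Rightarrow> 'a" where
  "peval k c s = (\<Sum>j\<le>k. s ^ j *\<^sub>R c j)"

text \<open>The derivative of \<open>peval\<close>. For \<open>j = 0\<close> the exponent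
  \<open>j - 1\<close> is truncated to 0 and the factor \<open>real j\<close> removes the
  term.\<close>

definition pdiff :: "nat \<Rightarrow> (nat \<Rightarrow> 'a::real_vector) \<Rightarrow> real \<Rightarrow> 'a" where
  "pdiff k c s = (\<Sum>j\<le>k. (real j * s ^ (j - 1)) *\<^sub>R c j)"

lemma peval_in: "subspace V \<Longrightarrow> (\<And>j. j \<le> k \<Longrightarrow> c j \<in> V) \<Longrightarrow> peval k c s \<in> V"
  and pdiff_in: "subspace V \<Longrightarrow> (\<And>j. j \<le> k \<Longrightarrow> c j \<in> V) \<Longrightarrow> pdiff k c s \<in> V"
  unfolding peval_def pdiff_def by (auto intro!: subspace_sum subspace_scale)

lemma peval_poly_scale:
  assumes "degree l \<le> k"
  shows "peval k (\<lambda>j. coeff l j *\<^sub>R x) s = poly l s *\<^sub>R x"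
proof -
  have "poly l s = (\<Sum>j\<le>k. coeff l j * s ^ j)"
    unfolding poly_altdef using assms
    by (intro sum.mono_neutral_left) (auto intro: coeff_eq_0)
  then show ?thesis
    by (simp add: peval_def scaleR_sum_left mult.commute)
qed

text \<open>A linear functional applied to the coefficients of a vector-valued polynomial produces
  such a scalar polynomial, for which root counting and exactness of quadrature are
  available.\<close>

definition cpoly :: "nat \<Rightarrow> (nat \<Rightarrow> real) \<Rightarrow> real poly" where
  "cpoly k c = (\<Sum>j\<le>k. monom (c j) j)"

lemma poly_cpoly: "poly (cpoly k c) s = (\<Sum>j\<le>k. s ^ j * c j)"
  by (simp add: cpoly_def poly_sum poly_monom mult.commute)

lemma coeff_cpoly: "coeff (cpoly k c) j = (if j \<le> k then c j else 0)"
  by (simp add: cpoly_def coeff_sum)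

lemma degree_cpoly: "degree (cpoly k c) \<le> k"
  by (rule degree_le) (simp add: coeff_cpoly)

lemma pderiv_sum: "pderiv (\<Sum>i\<in>A. f i) = (\<Sum>i\<in>A. pderiv (f i))"
  by (induction A rule: infinite_finite_induct) (auto simp: pderiv_add)

lemma degree_pderiv_bound: "degree P \<le> k \<Longrightarrow> degree (pderiv P :: real poly) \<le> k"
  by (simp add: degree_pderiv)

lemma poly_pderiv_cpoly: "poly (pderiv (cpoly k c)) s = (\<Sum>j\<le>k. real j * s ^ (j - 1) * c j)"
  by (simp add: cpoly_def pderiv_sum pderiv_monom poly_sum poly_monom mult_ac)

lemma peval_lin_on:
  assumes "lin_on V f" "subspace V" "\<And>j. j \<le> k \<Longrightarrow> c j \<in> V"
  shows "f (peval k c s) = poly (cpoly k (\<lambda>j. f (c j))) s"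
    and "f (pdiff k c s) = poly (pderiv (cpoly k (\<lambda>j. f (c j)))) s"
  unfolding peval_def pdiff_def poly_cpoly poly_pderiv_cpoly
  using lin_on_sum[OF assms(1,2), of "{..k}" c] assms(3) by auto

text \<open>The energy along a trajectory of degree \<open>k\<close> has degree at most
  \<open>2 * k\<close>, so its derivative is within the exactness of the quadrature.\<close>

lemma bilin_on_diagonal_poly:
  assumes f: "bilin_on V V f" and V: "subspace V" and c: "\<And>j. j \<le> k \<Longrightarrow> c j \<in> V"
  obtains P :: "real poly" where "degree P \<le> 2 * k"
    "\<And>s. poly P s = f (peval k c s) (peval k c s)"
    "\<And>s. poly (pderiv P) s = f (pdiff k c s) (peval k c s) + f (peval k c s) (pdiff k c s)"
proof
  define P where "P = (\<Sum>i\<le>k. monom 1 i * cpoly k (\<lambda>j. f (c i) (c j)))"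
  have in_V: "peval k c s \<in> V" "pdiff k c s \<in> V" for s
    using peval_in pdiff_in V c by blast+
  show "degree P \<le> 2 * k"
    unfolding P_def
  proof (intro degree_sum_le finite_atMost)
    fix i assume "i \<in> {..k}"
    then show "degree (monom 1 i * cpoly k (\<lambda>j. f (c i) (c j))) \<le> 2 * k"
      using degree_mult_le[of "monom 1 i" "cpoly k (\<lambda>j. f (c i) (c j))"]
        degree_monom_le[of "1::real" i] degree_cpoly[of k "\<lambda>j. f (c i) (c j)"] by simp
  qed
  have inner: "poly (cpoly k (\<lambda>j. f (c i) (c j))) s = f (c i) (peval k c s)"
     "poly (pderiv (cpoly k (\<lambda>j. f (c i) (c j)))) s = f (c i) (pdiff k c s)" if "i \<le> k" for i s
    using peval_lin_on[OF bilin_on_right[OF f c[OF that]] V c, where k=k] by simp_all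
  have outer: "f (peval k c s) y = (\<Sum>i\<le>k. s ^ i * f (c i) y)"
     "f (pdiff k c s) y = (\<Sum>i\<le>k. real i * s ^ (i - 1) * f (c i) y)" if "y \<in> V" for s y
    using peval_lin_on[OF bilin_on_left[OF f that] V c, where k=k]
    by (simp_all add: poly_cpoly poly_pderiv_cpoly)
  fix s
  show "poly P s = f (peval k c s) (peval k c s)"
    using outer(1)[OF in_V(1), of s s] inner(1)
    by (simp add: P_def poly_sum poly_monom)
  show "poly (pderiv P) s = f (pdiff k c s) (peval k c s) + f (peval k c s) (pdiff k c s)"
    using outer(1)[OF in_V(2), of s s] outer(2)[OF in_V(1), of s s] inner
    by (simp add: P_def poly_sum pderiv_sum pderiv_mult pderiv_monom poly_monom sum.distrib algebra_simps)
qed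

section \<open>Lagrange interpolation at the nodes\<close>

definition lagrange :: "(nat \<Rightarrow> real) \<Rightarrow> nat \<Rightarrow> nat \<Rightarrow> real poly" where
  "lagrange s k \<mu> = (\<Prod>\<nu>\<in>{1..k+1} - {\<mu>}. smult (1 / (s \<mu> - s \<nu>)) [:- s \<nu>, 1:])"

lemma degree_lagrange:
  assumes "\<mu> \<in> {1..k+1}"
  shows "degree (lagrange s k \<mu>) \<le> k"
proof -
  have "degree (lagrange s k \<mu>) \<le> sum (degree \<circ> (\<lambda>\<nu>. smult (1 / (s \<mu> - s \<nu>)) [:- s \<nu>, 1:])) ({1..k+1} - {\<mu>})"
    unfolding lagrange_def by (rule degree_prod_sum_le) simp
  also have "\<dots> \<le> (\<Sum>\<nu>\<in>{1..k+1} - {\<mu>}. 1)"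
    by (rule sum_mono) (simp add: degree_smult_le)
  also have "\<dots> = k"
    using assms by simp
  finally show ?thesis .
qed

lemma poly_lagrange:
  assumes "inj_on s {1..k+1}" "\<mu> \<in> {1..k+1}" "\<nu> \<in> {1..k+1}"
  shows "poly (lagrange s k \<mu>) (s \<nu>) = (if \<mu> = \<nu> then 1 else 0)"
proof (cases "\<mu> = \<nu>")
  case True
  have "s \<mu> - s \<nu>' \<noteq> 0" if "\<nu>' \<in> {1..k+1} - {\<mu>}" for \<nu>'
    using that assms by (auto dest: inj_onD)
  then show ?thesis
    using True by (simp add: lagrange_def poly_prod prod.neutral divide_simps)
next
  case False
  then show ?thesis
    using assms by (auto simp: lagrange_def poly_prod intro!: bexI[of _ \<nu>])
qed

lemma poly_zero_at_nodes:
  fixes P :: "real poly"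
  assumes "inj_on s {1..k+1}" "degree P \<le> k" "\<And>\<mu>. \<mu> \<in> {1..k+1} \<Longrightarrow> poly P (s \<mu>) = 0"
  shows "P = 0"
proof (rule ccontr)
  assume "P \<noteq> 0"
  then have "card {x. poly P x = 0} \<le> k" "finite {x. poly P x = 0}"
    using card_poly_roots_bound[of P] poly_roots_finite[of P] assms(2) by auto
  moreover have "s ` {1..k+1} \<subseteq> {x. poly P x = 0}"
    using assms(3) by auto
  ultimately have "card (s ` {1..k+1}) \<le> k"
    by (meson card_mono order_trans)
  then show False
    using card_image[OF assms(1)] by simp
qed

lemma lagrange_interpolation:
  fixes P :: "real poly"
  assumes "inj_on s {1..k+1}" "degree P \<le> k"
  shows "(\<Sum>\<mu>=1..k+1. poly (lagrange s k \<mu>) x * poly P (s \<mu>)) = poly P x"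
proof -
  let ?L = "\<Sum>\<mu>=1..k+1. smult (poly P (s \<mu>)) (lagrange s k \<mu>)"
  have "?L - P = 0"
  proof (rule poly_zero_at_nodes[OF assms(1)])
    have "degree ?L \<le> k"
      using degree_lagrange by (intro degree_sum_le) (auto intro: order_trans[OF degree_smult_le])
    then show "degree (?L - P) \<le> k"
      using assms(2) by (rule degree_diff_le)
    fix \<nu> assume \<nu>: "\<nu> \<in> {1..k+1}"
    have "poly ?L (s \<nu>) = (\<Sum>\<mu>=1..k+1. if \<mu> = \<nu> then poly P (s \<nu>) else 0)"
      unfolding poly_sum by (intro sum.cong) (use poly_lagrange[OF assms(1) _ \<nu>] in auto)
    then show "poly (?L - P) (s \<nu>) = 0"
      using \<nu> by simp
  qed
  then have "poly ?L x = poly P x"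
    by simp
  then show ?thesis
    by (simp add: poly_sum mult.commute)
qed

section \<open>Quadrature on one time interval\<close>

text \<open>Exactness in degree \<open>2 * k\<close> is put as the fundamental theorem of calculus
  for \<open>P\<close> of degree \<open>2 * k + 1\<close>, the form in which the energy identities
  use it. The weights include the half length of the interval.\<close>

locale radau_rule =
  fixes k :: nat and a b :: real and s w :: "nat \<Rightarrow> real"
  assumes inj: "inj_on s {1..k+1}"
    and weight_pos: "\<And>\<mu>. \<mu> \<in> {1..k+1} \<Longrightarrow> w \<mu> > 0"
    and interval: "a < b"
    and exact: "\<And>P. degree P \<le> 2 * k + 1 \<Longrightarrow>
      (\<Sum>\<mu>=1..k+1. w \<mu> * poly (pderiv P) (s \<mu>)) = poly P b - poly P a"
begin

text \<open>The derivative of f(x, x) / 2 is f(x', x) by symmetry, and the quadrature integrates it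
  exactly.\<close>

lemma energy:
  assumes f: "psd_form V f" and V: "subspace V" and c: "\<And>j. j \<le> k \<Longrightarrow> c j \<in> V"
  shows "(\<Sum>\<mu>=1..k+1. w \<mu> * f (pdiff k c (s \<mu>)) (peval k c (s \<mu>))) =
    (f (peval k c b) (peval k c b) - f (peval k c a) (peval k c a)) / 2"
proof -
  have bil: "bilin_on V V f" and sym: "\<And>x y. x \<in> V \<Longrightarrow> y \<in> V \<Longrightarrow> f x y = f y x"
    using f by (auto simp: psd_form_def)
  obtain P where P: "degree P \<le> 2 * k" "\<And>s. poly P s = f (peval k c s) (peval k c s)"
    "\<And>s. poly (pderiv P) s = f (pdiff k c s) (peval k c s) + f (peval k c s) (pdiff k c s)"
    using bilin_on_diagonal_poly[OF bil V, where c=c] c by blast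
  have "peval k c t \<in> V" "pdiff k c t \<in> V" for t
    using peval_in[OF V, where c=c] pdiff_in[OF V, where c=c] c by blast+
  then have "poly (pderiv P) t = 2 * f (pdiff k c t) (peval k c t)" for t
    using P(3)[of t] sym by simp
  then have "(\<Sum>\<mu>=1..k+1. w \<mu> * (2 * f (pdiff k c (s \<mu>)) (peval k c (s \<mu>)))) = poly P b - poly P a"
    using exact[of P] P(1) by simp
  then have "2 * (\<Sum>\<mu>=1..k+1. w \<mu> * f (pdiff k c (s \<mu>)) (peval k c (s \<mu>))) = poly P b - poly P a"
    by (simp add: sum_distrib_left mult_ac)
  then show ?thesis
    by (simp add: P(2))
qed

text \<open>The Lagrange basis polynomial of one node, times \<open>x\<close>, isolates that node in
  the sum. The term at \<open>a\<close> survives, because the Lagrange polynomial need not vanish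
  there.\<close>

lemma test_at_node:
  assumes f: "\<And>\<mu>. \<mu> \<in> {1..k+1} \<Longrightarrow> lin_on V (f \<mu>)" and g: "lin_on V g" and V: "subspace V"
    and eq: "\<And>\<phi>. (\<And>j. \<phi> j \<in> V) \<Longrightarrow>
      (\<Sum>\<nu>=1..k+1. w \<nu> * f \<nu> (peval k \<phi> (s \<nu>))) + g (peval k \<phi> a) = 0"
    and x: "x \<in> V" and \<mu>: "\<mu> \<in> {1..k+1}"
  shows "w \<mu> * f \<mu> x + poly (lagrange s k \<mu>) a * g x = 0"
proof -
  let ?l = "lagrange s k \<mu>"
  let ?\<phi> = "\<lambda>j. coeff ?l j *\<^sub>R x"
  have pe: "peval k ?\<phi> t = poly ?l t *\<^sub>R x" for t
    by (rule peval_poly_scale[OF degree_lagrange[OF \<mu>]])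
  have "(\<Sum>\<nu>=1..k+1. w \<nu> * f \<nu> (peval k ?\<phi> (s \<nu>))) = (\<Sum>\<nu>=1..k+1. if \<nu> = \<mu> then w \<mu> * f \<mu> x else 0)"
  proof (intro sum.cong refl)
    fix \<nu> assume \<nu>: "\<nu> \<in> {1..k+1}"
    show "w \<nu> * f \<nu> (peval k ?\<phi> (s \<nu>)) = (if \<nu> = \<mu> then w \<mu> * f \<mu> x else 0)"
      unfolding pe using lin_on_scale[OF f[OF \<nu>] x] poly_lagrange[OF inj \<mu> \<nu>] by auto
  qed
  also have "\<dots> = w \<mu> * f \<mu> x"
    using \<mu> by simp
  finally show ?thesis
    using eq[of ?\<phi>] x V lin_on_scale[OF g x] by (simp add: pe subspace_scale)
qed

end

section \<open>The homogeneous time step\<close>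

locale biot_forms =
  fixes V :: "'v::real_vector set" and W :: "'w::real_vector set"
    and mV :: "'v \<Rightarrow> 'v \<Rightarrow> real" and mW :: "'w \<Rightarrow> 'w \<Rightarrow> real"
    and A :: "'v \<Rightarrow> 'v \<Rightarrow> real" and C :: "'v \<Rightarrow> 'w \<Rightarrow> real" and B :: "'w \<Rightarrow> 'w \<Rightarrow> real"
    and \<rho> c :: real
  assumes V: "subspace V" and W: "subspace W"
    and mV: "psd_form V mV" and mW: "psd_form W mW" and A: "psd_form V A" and B: "psd_form W B"
    and mV_definite: "\<And>x. x \<in> V \<Longrightarrow> mV x x = 0 \<Longrightarrow> x = 0"
    and mW_definite: "\<And>x. x \<in> W \<Longrightarrow> mW x x = 0 \<Longrightarrow> x = 0"
    and C: "bilin_on V W C"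
    and \<rho>_pos: "\<rho> > 0" and c_pos: "c > 0"

text \<open>The unknowns are coefficient sequences. Extended by zero above \<open>k\<close>, they
  allow a comparison of coefficients without a case distinction at the top degree.\<close>

locale biot_homogeneous = radau_rule k a b s w + biot_forms V W mV mW A C B \<rho> c
  for k and a b :: real and s w :: "nat \<Rightarrow> real"
    and V :: "'v::real_vector set" and W :: "'w::real_vector set"
    and mV mW A C B and \<rho> c :: real +
  fixes u v :: "nat \<Rightarrow> 'v" and p :: "nat \<Rightarrow> 'w"
  assumes coeffs: "\<And>j. u j \<in> V" "\<And>j. v j \<in> V" "\<And>j. p j \<in> W"
    and coeffs_above: "\<And>j. j > k \<Longrightarrow> u j = 0 \<and> v j = 0 \<and> p j = 0"
    and eq1: "\<And>\<phi>. (\<And>j. \<phi> j \<in> V) \<Longrightarrow>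
      (\<Sum>\<mu>=1..k+1. w \<mu> * (mV (pdiff k u (s \<mu>)) (peval k \<phi> (s \<mu>)) - mV (peval k v (s \<mu>)) (peval k \<phi> (s \<mu>))))
      + mV (peval k u a) (peval k \<phi> a) = 0"
    and eq2: "\<And>\<eta>. (\<And>j. \<eta> j \<in> V) \<Longrightarrow>
      (\<Sum>\<mu>=1..k+1. w \<mu> * (\<rho> * mV (pdiff k v (s \<mu>)) (peval k \<eta> (s \<mu>)) + A (peval k u (s \<mu>)) (peval k \<eta> (s \<mu>))
        + C (peval k \<eta> (s \<mu>)) (peval k p (s \<mu>))))
      + \<rho> * mV (peval k v a) (peval k \<eta> a) = 0"
    and eq3: "\<And>\<psi>. (\<And>j. \<psi> j \<in> W) \<Longrightarrow>
      (\<Sum>\<mu>=1..k+1. w \<mu> * (c * mW (pdiff k p (s \<mu>)) (peval k \<psi> (s \<mu>)) - C (peval k v (s \<mu>)) (peval k \<psi> (s \<mu>))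
        + B (peval k p (s \<mu>)) (peval k \<psi> (s \<mu>))))
      + c * mW (peval k p a) (peval k \<psi> a) = 0"
begin

lemma values_in:
  "peval k u t \<in> V" "peval k v t \<in> V" "peval k p t \<in> W"
  "pdiff k u t \<in> V" "pdiff k v t \<in> V" "pdiff k p t \<in> W"
  by (simp_all add: peval_in pdiff_in V W coeffs)

text \<open>The first equation at one node says that the residual \<open>z\<close> is orthogonal to
  \<open>V\<close>. Testing with \<open>z\<close> itself gives \<open>z = 0\<close>, an identity in
  \<open>V\<close> to which any bilinear form may then be applied, in particular
  \<open>A\<close>.\<close>

lemma velocity_at_node:
  assumes f: "bilin_on V V f" and y: "y \<in> V" and \<mu>: "\<mu> \<in> {1..k+1}"
  shows "w \<mu> * f (peval k v (s \<mu>)) y =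
    w \<mu> * f (pdiff k u (s \<mu>)) y + poly (lagrange s k \<mu>) a * f (peval k u a) y"
proof -
  define d where "d = pdiff k u (s \<mu>) - peval k v (s \<mu>)"
  define z where "z = w \<mu> *\<^sub>R d + poly (lagrange s k \<mu>) a *\<^sub>R peval k u a"
  have d: "d \<in> V" and z: "z \<in> V"
    unfolding z_def d_def by (auto intro!: subspace_add subspace_diff subspace_scale V values_in)
  have bil: "bilin_on V V mV"
    using mV by (simp add: psd_form_def)
  have form_z: "f z y = w \<mu> * (f (pdiff k u (s \<mu>)) y - f (peval k v (s \<mu>)) y)
      + poly (lagrange s k \<mu>) a * f (peval k u a) y" if "bilin_on V V f" "y \<in> V" for f y
    unfolding z_def
    using lin_onD[OF bilin_on_left[OF that] d values_in(1)[of a]]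
      lin_on_diff[OF bilin_on_left[OF that] values_in(4,2)] by (simp add: d_def)
  have "w \<mu> * (mV (pdiff k u (s \<mu>)) z - mV (peval k v (s \<mu>)) z) + poly (lagrange s k \<mu>) a * mV (peval k u a) z = 0"
    by (rule test_at_node[where V=V and f="\<lambda>\<mu> x. mV (pdiff k u (s \<mu>)) x - mV (peval k v (s \<mu>)) x"
          and g="mV (peval k u a)"])
      (use eq1 V z \<mu> in \<open>auto intro!: lin_on_minus bilin_on_right[OF bil] values_in\<close>)
  then have "mV z z = 0"
    using form_z[OF bil z] by simp
  then have "z = 0"
    using mV_definite z by blast
  moreover have "f 0 y = 0"
    using lin_on_zero[OF bilin_on_left[OF f y] subspace_0[OF V]] .
  ultimately show ?thesis
    using form_z[OF f y] by (simp add: algebra_simps)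
qed

text \<open>Replacing \<open>v\<close> by \<open>u'\<close> leaves the difference of the end
  energies. The corrections at the nodes form the Lagrange interpolant of
  \<open>A (peval k u a) (peval k u t)\<close> at \<open>t = a\<close>, so they add
  \<open>A (peval k u a) (peval k u a)\<close> and turn the minus sign of the initial energy into a
  plus.\<close>

lemma elastic_energy:
  "(\<Sum>\<mu>=1..k+1. w \<mu> * A (peval k u (s \<mu>)) (peval k v (s \<mu>))) =
    (A (peval k u b) (peval k u b) + A (peval k u a) (peval k u a)) / 2"
proof -
  have bil: "bilin_on V V A" and sym: "\<And>x y. x \<in> V \<Longrightarrow> y \<in> V \<Longrightarrow> A x y = A y x"
    using A by (auto simp: psd_form_def)
  let ?P = "cpoly k (\<lambda>j. A (peval k u a) (u j))"
  have P: "poly ?P t = A (peval k u a) (peval k u t)" for t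
    using peval_lin_on(1)[OF bilin_on_right[OF bil values_in(1)] V coeffs(1), where k=k and s=t] by simp
  have "(\<Sum>\<mu>=1..k+1. w \<mu> * A (peval k u (s \<mu>)) (peval k v (s \<mu>))) =
    (\<Sum>\<mu>=1..k+1. w \<mu> * A (pdiff k u (s \<mu>)) (peval k u (s \<mu>)) + poly (lagrange s k \<mu>) a * poly ?P (s \<mu>))"
    unfolding P using velocity_at_node[OF bil values_in(1)] sym values_in by (intro sum.cong) auto
  also have "\<dots> = (A (peval k u b) (peval k u b) - A (peval k u a) (peval k u a)) / 2 + poly ?P a"
    unfolding sum.distrib energy[OF A V coeffs(1)]
      lagrange_interpolation[OF inj degree_cpoly] ..
  finally show ?thesis
    by (simp add: P field_simps)
qed

lemma energy_vanishes:
  "mV (peval k v b) (peval k v b) = 0" "mV (peval k v a) (peval k v a) = 0"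
  "mW (peval k p a) (peval k p a) = 0" "A (peval k u a) (peval k u a) = 0"
  "\<mu> \<in> {1..k+1} \<Longrightarrow> B (peval k p (s \<mu>)) (peval k p (s \<mu>)) = 0"
proof -
  define bs where "bs = (\<Sum>\<mu>=1..k+1. w \<mu> * B (peval k p (s \<mu>)) (peval k p (s \<mu>)))"
  have nn: "mV (peval k v t) (peval k v t) \<ge> 0" "mW (peval k p t) (peval k p t) \<ge> 0"
    "A (peval k u t) (peval k u t) \<ge> 0" "B (peval k p t) (peval k p t) \<ge> 0" for t
    using values_in mV mW A B by (auto simp: psd_form_def)
  have "0 = ((\<Sum>\<mu>=1..k+1. w \<mu> * (\<rho> * mV (pdiff k v (s \<mu>)) (peval k v (s \<mu>)) + A (peval k u (s \<mu>)) (peval k v (s \<mu>))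
        + C (peval k v (s \<mu>)) (peval k p (s \<mu>))))
      + \<rho> * mV (peval k v a) (peval k v a)) +
      ((\<Sum>\<mu>=1..k+1. w \<mu> * (c * mW (pdiff k p (s \<mu>)) (peval k p (s \<mu>)) - C (peval k v (s \<mu>)) (peval k p (s \<mu>))
        + B (peval k p (s \<mu>)) (peval k p (s \<mu>))))
      + c * mW (peval k p a) (peval k p a))"
    using eq2[of v] eq3[of p] coeffs by simp
  also have "\<dots> = \<rho> * (\<Sum>\<mu>=1..k+1. w \<mu> * mV (pdiff k v (s \<mu>)) (peval k v (s \<mu>))) + \<rho> * mV (peval k v a) (peval k v a)
      + (\<Sum>\<mu>=1..k+1. w \<mu> * A (peval k u (s \<mu>)) (peval k v (s \<mu>)))
      + c * (\<Sum>\<mu>=1..k+1. w \<mu> * mW (pdiff k p (s \<mu>)) (peval k p (s \<mu>))) + c * mW (peval k p a) (peval k p a) + bs"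
    unfolding bs_def by (simp only: sum_distrib_left sum.distrib sum_subtractf algebra_simps)
  \<comment> \<open>The jump terms at \<open>a\<close> reverse the sign of the initial kinetic and
    pressure energies left by \<open>energy\<close>, so all contributions are nonnegative.\<close>
  also have "\<dots> = \<rho> / 2 * mV (peval k v b) (peval k v b) + \<rho> / 2 * mV (peval k v a) (peval k v a)
      + A (peval k u b) (peval k u b) / 2 + A (peval k u a) (peval k u a) / 2
      + c / 2 * mW (peval k p b) (peval k p b) + c / 2 * mW (peval k p a) (peval k p a) + bs"
    unfolding energy[OF mV V coeffs(2)] energy[OF mW W coeffs(3)] elastic_energy
    by (simp add: field_simps)
  finally have sum0: "\<rho> / 2 * mV (peval k v b) (peval k v b) + \<rho> / 2 * mV (peval k v a) (peval k v a)
      + A (peval k u b) (peval k u b) / 2 + A (peval k u a) (peval k u a) / 2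
      + c / 2 * mW (peval k p b) (peval k p b) + c / 2 * mW (peval k p a) (peval k p a) + bs = 0"
    by simp
  have terms: "\<rho> / 2 * mV (peval k v t) (peval k v t) \<ge> 0" "c / 2 * mW (peval k p t) (peval k p t) \<ge> 0" for t
    using nn \<rho>_pos c_pos by auto
  have "bs \<ge> 0"
    unfolding bs_def using nn weight_pos by (intro sum_nonneg mult_nonneg_nonneg) (auto intro: less_imp_le)
  then have "\<rho> / 2 * mV (peval k v b) (peval k v b) = 0" "\<rho> / 2 * mV (peval k v a) (peval k v a) = 0"
    "A (peval k u a) (peval k u a) = 0" "c / 2 * mW (peval k p a) (peval k p a) = 0" and bs0: "bs = 0"
    using sum0 terms(1)[of a] terms(1)[of b] terms(2)[of a] terms(2)[of b] nn(3)[of a] nn(3)[of b]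
    by linarith+
  then show "mV (peval k v b) (peval k v b) = 0" "mV (peval k v a) (peval k v a) = 0"
    "mW (peval k p a) (peval k p a) = 0" "A (peval k u a) (peval k u a) = 0"
    using \<rho>_pos c_pos by auto
  assume \<mu>: "\<mu> \<in> {1..k+1}"
  have "w \<mu> * B (peval k p (s \<mu>)) (peval k p (s \<mu>)) = 0"
    using bs0 \<mu> nn weight_pos unfolding bs_def
    by (subst (asm) sum_nonneg_eq_0_iff) (auto intro!: mult_nonneg_nonneg intro: less_imp_le)
  then show "B (peval k p (s \<mu>)) (peval k p (s \<mu>)) = 0"
    using weight_pos[OF \<mu>] by simp
qed

lemma end_values: "peval k v a = 0" "peval k v b = 0" "peval k p a = 0"
  using energy_vanishes mV_definite mW_definite values_in by blast+

lemma bilin: "bilin_on V V mV" "bilin_on W W mW" "bilin_on V V A" "bilin_on W W B"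
  using mV mW A B by (auto simp: psd_form_def)

lemma form_zero_left: "bilin_on V V f \<Longrightarrow> y \<in> V \<Longrightarrow> f 0 y = 0"
  using lin_on_zero[OF bilin_on_left subspace_0[OF V]] .

text \<open>The jump term at \<open>a\<close> is absent because the velocity vanishes there. What
  remains has degree at most \<open>k\<close> and holds at \<open>k + 1\<close> nodes.\<close>

lemma momentum_poly:
  assumes x: "x \<in> V"
  shows "smult \<rho> (pderiv (cpoly k (\<lambda>j. mV (v j) x))) + cpoly k (\<lambda>j. A (u j) x) + cpoly k (\<lambda>j. C x (p j)) = 0"
    (is "?P = 0")
proof (rule poly_zero_at_nodes[OF inj])
  show "degree ?P \<le> k"
    by (intro degree_add_le order_trans[OF degree_smult_le] degree_pderiv_bound degree_cpoly)
  fix \<mu> assume \<mu>: "\<mu> \<in> {1..k+1}"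
  have "w \<mu> * (\<rho> * mV (pdiff k v (s \<mu>)) x + A (peval k u (s \<mu>)) x + C x (peval k p (s \<mu>)))
      + poly (lagrange s k \<mu>) a * (\<rho> * mV (peval k v a) x) = 0"
    by (rule test_at_node[where V=V and g="\<lambda>x. \<rho> * mV (peval k v a) x" and
        f="\<lambda>\<mu> x. \<rho> * mV (pdiff k v (s \<mu>)) x + A (peval k u (s \<mu>)) x + C x (peval k p (s \<mu>))"])
      (use eq2 V x \<mu> in \<open>auto intro!: lin_on_plus lin_on_mult bilin_on_right[OF bilin(1)] bilin_on_right[OF bilin(3)]
        bilin_on_left[OF C] values_in\<close>)
  then have "\<rho> * mV (pdiff k v (s \<mu>)) x + A (peval k u (s \<mu>)) x + C x (peval k p (s \<mu>)) = 0"
    using weight_pos[OF \<mu>] x by (simp add: end_values form_zero_left[OF bilin(1)])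
  then show "poly ?P (s \<mu>) = 0"
    using peval_lin_on[OF bilin_on_left[OF bilin(1) x] V coeffs(2), of k]
      peval_lin_on[OF bilin_on_left[OF bilin(3) x] V coeffs(1), of k]
      peval_lin_on[OF bilin_on_right[OF C x] W coeffs(3), of k] by simp
qed

text \<open>Two terms disappear: the jump, because \<open>p\<close> vanishes at \<open>a\<close>,
  and \<open>B\<close>, because the nodal pressures have zero energy and so lie in its
  kernel.\<close>

lemma pressure_poly:
  assumes y: "y \<in> W"
  shows "smult c (pderiv (cpoly k (\<lambda>j. mW (p j) y))) - cpoly k (\<lambda>j. C (v j) y) = 0"
    (is "?P = 0")
proof (rule poly_zero_at_nodes[OF inj])
  show "degree ?P \<le> k"
    by (intro degree_diff_le order_trans[OF degree_smult_le] degree_pderiv_bound degree_cpoly)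
  fix \<mu> assume \<mu>: "\<mu> \<in> {1..k+1}"
  have "w \<mu> * (c * mW (pdiff k p (s \<mu>)) y - C (peval k v (s \<mu>)) y + B (peval k p (s \<mu>)) y)
      + poly (lagrange s k \<mu>) a * (c * mW (peval k p a) y) = 0"
    by (rule test_at_node[where V=W and g="\<lambda>y. c * mW (peval k p a) y" and
        f="\<lambda>\<mu> y. c * mW (pdiff k p (s \<mu>)) y - C (peval k v (s \<mu>)) y + B (peval k p (s \<mu>)) y"])
      (use eq3 W y \<mu> in \<open>auto intro!: lin_on_plus lin_on_minus lin_on_mult bilin_on_right[OF bilin(2)] bilin_on_right[OF bilin(4)]
        bilin_on_right[OF C] values_in\<close>)
  moreover have "B (peval k p (s \<mu>)) y = 0"
    using psd_form_kernel[OF B W values_in(3) energy_vanishes(5)[OF \<mu>] y] .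
  ultimately have "c * mW (pdiff k p (s \<mu>)) y - C (peval k v (s \<mu>)) y = 0"
    using weight_pos[OF \<mu>] y lin_on_zero[OF bilin_on_left[OF bilin(2) y] subspace_0[OF W]]
    by (simp add: end_values)
  then show "poly ?P (s \<mu>) = 0"
    using peval_lin_on[OF bilin_on_left[OF bilin(2) y] W coeffs(3), of k]
      peval_lin_on[OF bilin_on_left[OF C y] V coeffs(2), of k] by simp
qed

text \<open>The correction between v and u' is a multiple of \<open>peval k u a\<close>, which lies
  in the kernel of \<open>A\<close>.\<close>

lemma elastic_velocity_poly:
  assumes x: "x \<in> V"
  shows "pderiv (cpoly k (\<lambda>j. A (u j) x)) - cpoly k (\<lambda>j. A (v j) x) = 0" (is "?P = 0")
proof (rule poly_zero_at_nodes[OF inj])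
  show "degree ?P \<le> k"
    by (intro degree_diff_le degree_pderiv_bound degree_cpoly)
  fix \<mu> assume \<mu>: "\<mu> \<in> {1..k+1}"
  have "A (peval k v (s \<mu>)) x = A (pdiff k u (s \<mu>)) x"
    using velocity_at_node[OF bilin(3) x \<mu>] weight_pos[OF \<mu>]
      psd_form_kernel[OF A V values_in(1) energy_vanishes(4) x] by simp
  then show "poly ?P (s \<mu>) = 0"
    using peval_lin_on[OF bilin_on_left[OF bilin(3) x] V coeffs(1), of k]
      peval_lin_on[OF bilin_on_left[OF bilin(3) x] V coeffs(2), of k] by simp
qed

lemma coeff_form:
  assumes "bilin_on V V f" "x \<in> V"
  shows "coeff (cpoly k (\<lambda>j. f (v j) x)) j = f (v j) x"
  using coeffs_above[of j] form_zero_left[OF assms] by (simp add: coeff_cpoly)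

text \<open>Differentiating \<open>momentum_poly\<close> brings in A u', which
  \<open>elastic_velocity_poly\<close> replaces by A v; this eliminates the displacement. The
  identity is read off at order \<open>j\<close>.\<close>

lemma wave_coeffs:
  assumes x: "x \<in> V"
  shows "\<rho> * (real (j + 2) * real (j + 1)) * mV (v (j + 2)) x + A (v j) x + real (j + 1) * C x (p (j + 1)) = 0"
proof -
  have "0 = coeff (pderiv (smult \<rho> (pderiv (cpoly k (\<lambda>j. mV (v j) x))) + cpoly k (\<lambda>j. A (u j) x)
      + cpoly k (\<lambda>j. C x (p j)))) j"
    by (simp add: momentum_poly[OF x])
  also have "\<dots> = \<rho> * (real (Suc j) * (real (Suc (Suc j)) * coeff (cpoly k (\<lambda>j. mV (v j) x)) (Suc (Suc j))))
      + coeff (pderiv (cpoly k (\<lambda>j. A (u j) x))) j + real (Suc j) * coeff (cpoly k (\<lambda>j. C x (p j))) (Suc j)"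
    by (simp add: pderiv_add pderiv_smult coeff_pderiv algebra_simps)
  also have "coeff (pderiv (cpoly k (\<lambda>j. A (u j) x))) j = coeff (cpoly k (\<lambda>j. A (v j) x)) j"
    using elastic_velocity_poly[OF x] by simp
  also have "\<dots> = A (v j) x"
    by (rule coeff_form[OF bilin(3) x])
  also have "coeff (cpoly k (\<lambda>j. mV (v j) x)) (Suc (Suc j)) = mV (v (Suc (Suc j))) x"
    by (rule coeff_form[OF bilin(1) x])
  also have "coeff (cpoly k (\<lambda>j. C x (p j))) (Suc j) = C x (p (Suc j))"
    using coeffs_above[of "Suc j"] lin_on_zero[OF bilin_on_right[OF C x] subspace_0[OF W]]
    by (simp add: coeff_cpoly)
  finally show ?thesis
    by (simp add: algebra_simps)
qed

lemma pressure_coeffs: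
  assumes y: "y \<in> W"
  shows "c * real (j + 1) * mW (p (j + 1)) y = C (v j) y"
proof -
  have "0 = coeff (smult c (pderiv (cpoly k (\<lambda>j. mW (p j) y))) - cpoly k (\<lambda>j. C (v j) y)) j"
    by (simp add: pressure_poly[OF y])
  also have "\<dots> = c * (real (Suc j) * coeff (cpoly k (\<lambda>j. mW (p j) y)) (Suc j)) - coeff (cpoly k (\<lambda>j. C (v j) y)) j"
    by (simp add: coeff_pderiv)
  also have "coeff (cpoly k (\<lambda>j. mW (p j) y)) (Suc j) = mW (p (Suc j)) y"
    using coeffs_above[of "Suc j"] lin_on_zero[OF bilin_on_left[OF bilin(2) y] subspace_0[OF W]]
    by (simp add: coeff_cpoly)
  also have "coeff (cpoly k (\<lambda>j. C (v j) y)) j = C (v j) y"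
    using coeffs_above[of j] lin_on_zero[OF bilin_on_left[OF C y] subspace_0[OF V]]
    by (simp add: coeff_cpoly)
  finally show ?thesis
    by simp
qed

text \<open>The velocity solves \<open>\<rho> v'' + S v = 0\<close> with a symmetric positive semidefinite \<open>S\<close>. Its top
  coefficient \<open>v N\<close> lies in the kernel of \<open>S\<close>, so testing the coefficient of order \<open>N - 2\<close> with \<open>v N\<close>
  eliminates \<open>v N\<close> if \<open>N \<ge> 2\<close>.\<close>

lemma velocity_zero: "v j = 0"
proof (rule ccontr)
  assume "v j \<noteq> 0"
  define N where "N = (GREATEST j. v j \<noteq> 0)"
  have bound: "\<And>j. v j \<noteq> 0 \<Longrightarrow> j \<le> k"
    using coeffs_above by (meson linorder_not_less)
  have vN: "v N \<noteq> 0"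
    unfolding N_def by (rule GreatestI_nat[where P="\<lambda>j. v j \<noteq> 0", OF \<open>v j \<noteq> 0\<close>]) (use bound in auto)
  have above: "v i = 0" if "i > N" for i
    using that Greatest_le_nat[of "\<lambda>j. v j \<noteq> 0" i k] bound unfolding N_def by force
  have "N \<le> k"
    using bound vN by blast
  \<comment> \<open>Order \<open>N\<close> of the wave equation tested with \<open>v N\<close>,
    where \<open>v (N + 2)\<close> is zero. By \<open>pressure_coeffs\<close> the coupling term
    equals \<open>c * (N + 1)\<^sup>2\<close> times the square norm of \<open>p (N + 1)\<close>, so
    two nonnegative terms add up to zero.\<close>
  have "A (v N) (v N) + real (N + 1) * C (v N) (p (N + 1)) = 0"
    using wave_coeffs[OF coeffs(2)[of N], of N] above[of "N + 2"] form_zero_left[OF bilin(1) coeffs(2)[of N]] by simp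
  moreover have "c * real (N + 1) * mW (p (N + 1)) (p (N + 1)) = C (v N) (p (N + 1))"
    by (rule pressure_coeffs[OF coeffs(3)])
  moreover have "A (v N) (v N) \<ge> 0" "mW (p (N + 1)) (p (N + 1)) \<ge> 0"
    using A mW coeffs by (auto simp: psd_form_def)
  ultimately have "A (v N) (v N) = 0" and pN: "mW (p (N + 1)) (p (N + 1)) = 0"
  proof -
    let ?q = "mW (p (N + 1)) (p (N + 1))" and ?f = "c * real (N + 1) * real (N + 1)"
    assume *: "A (v N) (v N) + real (N + 1) * C (v N) (p (N + 1)) = 0"
      "c * real (N + 1) * ?q = C (v N) (p (N + 1))" "A (v N) (v N) \<ge> 0" "?q \<ge> 0"
    have f: "?f > 0"
      using c_pos by simp
    have "A (v N) (v N) + ?f * ?q = 0"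
      using *(1) unfolding *(2)[symmetric] by (simp add: mult_ac)
    moreover have "?f * ?q \<ge> 0"
      by (rule mult_nonneg_nonneg[OF less_imp_le[OF f] *(4)])
    ultimately have "A (v N) (v N) = 0" "?f * ?q = 0"
      using *(3) by linarith+
    then show "A (v N) (v N) = 0" "?q = 0"
      using f by auto
  qed
  then have AvN: "A (v N) x = 0" if "x \<in> V" for x
    using psd_form_kernel[OF A V coeffs(2)] that by blast
  have "p (N + 1) = 0"
    using mW_definite pN coeffs by blast
  then have CvN: "C (v N) y = 0" if "y \<in> W" for y
    using pressure_coeffs[OF that, of N] lin_on_zero[OF bilin_on_left[OF bilin(2) that] subspace_0[OF W]] by simp
  show False
  proof (cases "N \<ge> 2")
    case True
    then obtain i where i: "N = i + 2"
      using le_Suc_ex by (metis add.commute)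
    have "A (v i) (v N) = 0"
      using AvN[OF coeffs(2)] A coeffs by (metis psd_formD(2))
    then have "\<rho> * (real (i + 2) * real (i + 1)) * mV (v N) (v N) = 0"
      using wave_coeffs[OF coeffs(2), of i N] CvN[OF coeffs(3)] i by simp
    then have "mV (v N) (v N) = 0"
      using \<rho>_pos by simp
    then show False
      using mV_definite coeffs vN by blast
  next
    case False
    have two: "peval k v t = v 0 + t *\<^sub>R v 1" for t
    proof -
      \<comment> \<open>The range is enlarged to \<open>k + 1\<close> so that it contains the index
        1 also for \<open>k = 0\<close>.\<close>
      have "peval k v t = (\<Sum>j\<in>{..k + 1}. t ^ j *\<^sub>R v j)"
        unfolding peval_def using coeffs_above by (intro sum.mono_neutral_left) auto
      also have "\<dots> = (\<Sum>j\<in>{0, 1}. t ^ j *\<^sub>R v j)"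
        using above False by (intro sum.mono_neutral_right) auto
      finally show ?thesis by simp
    qed
    have "(b - a) *\<^sub>R v 1 = 0"
      using end_values(1,2) unfolding two by (metis add_diff_cancel_left diff_0_right scaleR_diff_left)
    then have "v 1 = 0"
      using interval by simp
    moreover from this have "v 0 = 0"
      using end_values(1) unfolding two by simp
    moreover have "N = 0 \<or> N = 1"
      using False by linarith
    ultimately show False
      using vN by auto
  qed
qed

text \<open>With \<open>v = 0\<close> the relation c p' = C v leaves a constant, which vanishes
  because \<open>p\<close> vanishes at \<open>a\<close>.\<close>

lemma pressure_zero: "p j = 0"
proof -
  have pos: "p (Suc i) = 0" for i
  proof -
    have "c * real (i + 1) * mW (p (Suc i)) (p (Suc i)) = 0"
      using pressure_coeffs[OF coeffs(3)[of "Suc i"], of i] velocity_zero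
        lin_on_zero[OF bilin_on_left[OF C coeffs(3)] subspace_0[OF V]] by simp
    then show ?thesis
      using c_pos mW_definite coeffs by auto
  qed
  have "peval k p a = (\<Sum>j\<le>k. if j = 0 then p 0 else 0)"
    unfolding peval_def using pos by (intro sum.cong) (auto simp: gr0_conv_Suc)
  then have "p 0 = 0"
    using end_values(3) by simp
  then show ?thesis
    using pos by (cases j) auto
qed

text \<open>With \<open>v = 0\<close> the first equation is the homogeneous scheme for u' = 0.
  Tested with \<open>u\<close> it yields \<open>peval k u a = 0\<close>; then u' vanishes at all
  nodes and \<open>u\<close> is the constant 0.\<close>

lemma displacement_zero: "u j = 0"
proof -
  let ?m = "\<lambda>t. mV (peval k u t) (peval k u t)"
  have v0: "peval k v t = 0" for t
    by (simp add: peval_def velocity_zero)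
  have nn: "?m t \<ge> 0" for t
    using mV values_in by (simp add: psd_form_def)
  have "(\<Sum>\<mu>=1..k+1. w \<mu> * mV (pdiff k u (s \<mu>)) (peval k u (s \<mu>))) + ?m a = 0"
    using eq1[of u] coeffs form_zero_left[OF bilin(1)] values_in by (simp add: v0)
  then have "?m b + ?m a = 0"
    unfolding energy[OF mV V coeffs(1)] by (simp add: field_simps)
  then have ua: "peval k u a = 0"
    using nn[of a] nn[of b] mV_definite values_in(1) by (smt (verit))
  have zero: "coeff (cpoly k (\<lambda>j. mV (u j) (u i))) i = mV (u i) (u i)" for i
    using coeffs_above[of i] form_zero_left[OF bilin(1) subspace_0[OF V]] by (simp add: coeff_cpoly)
  have pd: "pderiv (cpoly k (\<lambda>j. mV (u j) x)) = 0" if x: "x \<in> V" for x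
  proof (rule poly_zero_at_nodes[OF inj])
    show "degree (pderiv (cpoly k (\<lambda>j. mV (u j) x))) \<le> k"
      by (intro degree_pderiv_bound degree_cpoly)
    fix \<mu> assume \<mu>: "\<mu> \<in> {1..k+1}"
    have "mV (pdiff k u (s \<mu>)) x = 0"
      using velocity_at_node[OF bilin(1) x \<mu>] weight_pos[OF \<mu>] form_zero_left[OF bilin(1) x]
      by (simp add: v0 ua)
    then show "poly (pderiv (cpoly k (\<lambda>j. mV (u j) x))) (s \<mu>) = 0"
      using peval_lin_on(2)[OF bilin_on_left[OF bilin(1) x] V coeffs(1), of k] by simp
  qed
  have pos: "u (Suc i) = 0" for i
  proof -
    have "coeff (pderiv (cpoly k (\<lambda>j. mV (u j) (u (Suc i))))) i = 0"
      by (simp add: pd coeffs)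
    then have "mV (u (Suc i)) (u (Suc i)) = 0"
      using zero[of "Suc i"] by (simp add: coeff_pderiv)
    then show ?thesis
      using mV_definite coeffs by blast
  qed
  have "peval k u a = (\<Sum>j\<le>k. if j = 0 then u 0 else 0)"
    unfolding peval_def using pos by (intro sum.cong) (auto simp: gr0_conv_Suc)
  then have "u 0 = 0"
    using ua by simp
  then show ?thesis
    using pos by (cases j) auto
qed

end

section \<open>The Gauss-Radau formula\<close>

text \<open>The square of a Lagrange basis polynomial has degree at most \<open>2 * k\<close>, so
  the formula is exact for it: the weight is the integral of this square.\<close>

lemma gauss_radau_weight_pos:
  assumes "gauss_radau k \<zeta> \<omega>" "\<mu> \<in> {1..k+1}"
  shows "\<omega> \<mu> > 0"
proof -
  have inj: "inj_on \<zeta> {1..k+1}"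
    and ex: "\<And>p :: real poly. degree p \<le> 2 * k \<Longrightarrow> (\<Sum>\<mu>=1..k+1. \<omega> \<mu> * poly p (\<zeta> \<mu>)) = integral {-1..1} (poly p)"
    using assms(1) by (auto simp: gauss_radau_def intro: strict_mono_on_imp_inj_on)
  let ?l = "lagrange \<zeta> k \<mu>"
  have "degree (?l * ?l) \<le> 2 * k"
    using degree_mult_le[of ?l ?l] degree_lagrange[OF assms(2), of \<zeta>] by simp
  then have "(\<Sum>\<nu>=1..k+1. \<omega> \<nu> * poly (?l * ?l) (\<zeta> \<nu>)) = integral {-1..1} (poly (?l * ?l))"
    by (rule ex)
  moreover have "(\<Sum>\<nu>=1..k+1. \<omega> \<nu> * poly (?l * ?l) (\<zeta> \<nu>)) = (\<Sum>\<nu>=1..k+1. if \<nu> = \<mu> then \<omega> \<mu> else 0)"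
    by (intro sum.cong) (use poly_lagrange[OF inj assms(2)] in auto)
  ultimately have \<omega>: "\<omega> \<mu> = integral {-1..1} (poly (?l * ?l))"
    using assms(2) by simp
  have cont: "continuous_on {-1..1} (poly (?l * ?l))"
    by (intro continuous_intros)
  have "integral {-1..1} (poly (?l * ?l)) \<ge> 0"
    by (intro integral_nonneg integrable_continuous_real cont) auto
  moreover have "integral {-1..1} (poly (?l * ?l)) \<noteq> 0"
  proof
    assume "integral {-1..1} (poly (?l * ?l)) = 0"
    then have "\<forall>x\<in>{-1..1}. poly (?l * ?l) x = 0"
      by (subst (asm) integral_eq_0_iff) (use cont in auto)
    moreover have "\<zeta> \<mu> \<in> {-1..1}"
      using assms by (auto simp: gauss_radau_def intro: less_imp_le)
    ultimately have "poly (?l * ?l) (\<zeta> \<mu>) = 0"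
      by blast
    then show False
      using poly_lagrange[OF inj assms(2,2)] by simp
  qed
  ultimately show ?thesis
    using \<omega> by simp
qed

lemma gauss_radau_rule:
  assumes gr: "gauss_radau k \<zeta> \<omega>" and ab: "t (n - 1) < t n"
  shows "radau_rule k (t (n - 1)) (t n) (quad_node \<zeta> t n) (\<lambda>\<mu>. (t n - t (n - 1)) / 2 * \<omega> \<mu>)"
proof
  define h where "h = (t n - t (n - 1)) / 2"
  have h: "h > 0"
    using ab by (simp add: h_def)
  have node: "quad_node \<zeta> t n \<mu> = t (n - 1) + h * (\<zeta> \<mu> + 1)" for \<mu>
    by (simp add: quad_node_def h_def)
  have "inj_on \<zeta> {1..k+1}"
    using gr by (auto simp: gauss_radau_def intro: strict_mono_on_imp_inj_on)
  then show "inj_on (quad_node \<zeta> t n) {1..k+1}"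
    using h by (auto simp: inj_on_def node)
  show "(t n - t (n - 1)) / 2 * \<omega> \<mu> > 0" if "\<mu> \<in> {1..k+1}" for \<mu>
    using gauss_radau_weight_pos[OF gr that] ab by simp
  show "t (n - 1) < t n" by fact
  fix P :: "real poly" assume P: "degree P \<le> 2 * k + 1"
  \<comment> \<open>Pull-back of \<open>P\<close> to [-1, 1]; the factor \<open>h\<close> in its
    derivative is the one in the scaled weights.\<close>
  define R where "R = pcompose P [:t (n - 1) + h, h:]"
  have pR: "poly (pderiv R) x = h * poly (pderiv P) (t (n - 1) + h * (x + 1))" for x
    by (simp add: R_def pderiv_pcompose poly_pcompose pderiv_pCons algebra_simps)
  have "degree R \<le> degree P * degree [:t (n - 1) + h, h:]"
    unfolding R_def by (rule degree_pcompose_le)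
  also have "\<dots> \<le> 2 * k + 1"
    using P h by simp
  finally have "degree (pderiv R) \<le> 2 * k"
    by (simp add: degree_pderiv)
  then have "(\<Sum>\<mu>=1..k+1. \<omega> \<mu> * poly (pderiv R) (\<zeta> \<mu>)) = integral {-1..1} (poly (pderiv R))"
    using gr unfolding gauss_radau_def by blast
  also have "(poly (pderiv R) has_integral (poly R 1 - poly R (-1))) {-1..1}"
    by (rule fundamental_theorem_of_calculus)
      (auto intro!: has_real_derivative_iff_has_vector_derivative[THEN iffD1] DERIV_subset[OF poly_DERIV])
  then have "integral {-1..1} (poly (pderiv R)) = poly R 1 - poly R (-1)"
    by (rule integral_unique)
  also have "\<dots> = poly P (t n) - poly P (t (n - 1))"
    by (simp add: R_def poly_pcompose h_def field_simps)
  finally show "(\<Sum>\<mu>=1..k+1. (t n - t (n - 1)) / 2 * \<omega> \<mu> * poly (pderiv P) (quad_node \<zeta> t n \<mu>)) =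
      poly P (t n) - poly P (t (n - 1))"
    unfolding pR node h_def[symmetric] by (simp only: mult_ac)
qed

section \<open>Hausdorff measure of faces\<close>

lemma hausdorff_content_mono: "A \<subseteq> B \<Longrightarrow> hausdorff_content s \<delta> A \<le> hausdorff_content s \<delta> B"
  unfolding hausdorff_content_def by (intro INF_superset_mono) auto

lemma hausdorff_mono: "A \<subseteq> B \<Longrightarrow> hausdorff s A \<le> hausdorff s B"
  unfolding hausdorff_def by (intro SUP_mono) (auto intro: hausdorff_content_mono)

text \<open>The inequality spares the proof that \<open>hausdorff\<close> is countably additive on the Borel sets: without
  countable additivity \<open>measure_of\<close> would yield the zero measure.\<close>

lemma emeasure_surface_measure_le: "emeasure surface_measure A \<le> surface_area A"
  unfolding surface_measure_def hausdorff_measure_def surface_area_def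
  by (simp add: emeasure_measure_of_conv)

lemma sets_surface_measure [simp, measurable_cong]: "sets surface_measure = sets borel"
  and space_surface_measure [simp]: "space surface_measure = UNIV"
  unfolding surface_measure_def hausdorff_measure_def
  using sets.sigma_sets_eq[of borel] by (simp_all add: sets_measure_of_conv space_measure_of_conv)

lemma hausdorff_content_finite_cover:
  assumes X: "finite X" "A \<subseteq> (\<Union>a\<in>X. f a)"
    and f: "\<And>a. a \<in> X \<Longrightarrow> bounded (f a)" "\<And>a. a \<in> X \<Longrightarrow> diameter (f a) \<le> d"
    and d: "0 \<le> d" "d < \<delta>" and s: "s > 0"
  shows "hausdorff_content s \<delta> A \<le> ennreal (card X * (unit_ball_vol s * (d / 2) powr s))"
proof -
  define n where "n = card X"
  obtain e where e: "bij_betw e {0..<n} X"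
    using ex_bij_betw_nat_finite[OF X(1)] n_def by blast
  \<comment> \<open>The empty sets that continue the sequence contribute nothing, since their
    diameter is 0 and \<open>0 powr s = 0\<close>.\<close>
  define U where "U i = (if i < n then f (e i) else {})" for i
  have eX: "e i \<in> X" if "i < n" for i
    using e that by (auto simp: bij_betw_def)
  have "A \<subseteq> (\<Union>i. U i)"
  proof
    fix x assume "x \<in> A"
    then obtain a where a: "a \<in> X" "x \<in> f a"
      using X by auto
    then obtain i where "i < n" "e i = a"
      using e by (auto simp: bij_betw_def)
    then show "x \<in> (\<Union>i. U i)"
      using a by (auto simp: U_def)
  qed
  moreover have "bounded (U i) \<and> diameter (U i) < \<delta>" for i
    using f eX d by (auto simp: U_def intro: le_less_trans)
  ultimately have "hausdorff_content s \<delta> A \<le> (\<Sum>i. ennreal (unit_ball_vol s * (diameter (U i) / 2) powr s))"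
    unfolding hausdorff_content_def by (intro INF_lower) auto
  also have "\<dots> = (\<Sum>i<n. ennreal (unit_ball_vol s * (diameter (U i) / 2) powr s))"
    by (rule suminf_finite) (auto simp: U_def)
  also have "\<dots> \<le> (\<Sum>i<n. ennreal (unit_ball_vol s * (d / 2) powr s))"
  proof (intro sum_mono ennreal_leI mult_left_mono powr_mono2)
    fix i assume "i \<in> {..<n}"
    then show "diameter (U i) / 2 \<le> d / 2"
      using f eX by (simp add: U_def)
    show "0 \<le> diameter (U i) / 2"
      using diameter_ge_0[OF f(1)[OF eX]] by (simp add: U_def)
  qed (use s in auto)
  also have "\<dots> = ennreal (card X * (unit_ball_vol s * (d / 2) powr s))"
    using s by (simp add: n_def ennreal_mult' ennreal_of_nat_eq_real_of_nat)
  finally show ?thesis .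
qed

lemma powr_card_eq: "x \<ge> 0 \<Longrightarrow> n > 0 \<Longrightarrow> x powr real n = x ^ n"
  by (cases "x = 0") (auto simp: powr_realpow)

text \<open>Division into \<open>m ^ card J\<close> subcubes of side \<open>1 / m\<close> gives
  images of diameter at most \<open>D / m\<close>, so the sum over the cover is independent of
  \<open>m\<close>. With one coordinate fixed this bounds the area of a facet, with none the volume
  of a cell.\<close>

lemma hausdorff_lipschitz_cube:
  fixes f :: "real^'n \<Rightarrow> real^'n"
  assumes f: "L-lipschitz_on (cbox 0 1) f" and J: "J \<noteq> {}"
  shows "hausdorff (real (card J)) (f ` {x \<in> cbox 0 1. \<forall>i\<in>- J. x $ i = c i}) < \<infinity>"
    (is "hausdorff ?s (f ` ?E) < _")
proof -
  define D where "D = L * real CARD('n)"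
  have L: "L \<ge> 0"
    using f by (simp add: lipschitz_on_def)
  then have D: "D \<ge> 0"
    by (simp add: D_def)
  have card_J: "card J > 0"
    using J by (simp add: card_gt_0_iff)
  let ?b = "ennreal (unit_ball_vol ?s * (D / 2) powr ?s)"
  have "hausdorff_content ?s \<delta> (f ` ?E) \<le> ?b" if \<delta>: "\<delta> > 0" for \<delta>
  proof -
    obtain m :: nat where m: "D / \<delta> < real m"
      using reals_Archimedean2 by blast
    then have m0: "m > 0"
      using D \<delta> by (metis divide_nonneg_pos not_less of_nat_0 gr0I)
    have Dm: "D / m < \<delta>"
      using m m0 \<delta> by (simp add: field_simps)
    define X where "X = (\<Pi>\<^sub>E j\<in>J. {..<m})"
    define g where "g a = f ` {x \<in> ?E. \<forall>j\<in>J. real (a j) / m \<le> x $ j \<and> x $ j \<le> (real (a j) + 1) / m}" for a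
    have card_X: "card X = m ^ card J" "finite X"
      by (simp_all add: X_def card_PiE finite_PiE)
    have cover: "f ` ?E \<subseteq> (\<Union>a\<in>X. g a)"
    proof
      fix y assume "y \<in> f ` ?E"
      then obtain x where x: "x \<in> ?E" "y = f x" by auto
      \<comment> \<open>The minimum with \<open>m - 1\<close> puts coordinates equal to 1 into the
        last subinterval.\<close>
      define a where "a = (\<lambda>j\<in>J. min (nat \<lfloor>x $ j * m\<rfloor>) (m - 1))"
      have "real (a j) / m \<le> x $ j \<and> x $ j \<le> (real (a j) + 1) / m" if j: "j \<in> J" for j
      proof -
        have x01: "0 \<le> x $ j" "x $ j \<le> 1"
          using x by (auto simp: mem_box_cart)
        have fl: "real (nat \<lfloor>x $ j * m\<rfloor>) \<le> x $ j * m" "x $ j * m < real (nat \<lfloor>x $ j * m\<rfloor>) + 1"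
          using x01 by (auto simp: of_nat_nat) 
        have le: "x $ j * m \<le> m"
          using x01 m0 by (simp add: mult_left_le_one_le)
        have "real (a j) \<le> x $ j * m"
          using fl j by (auto simp: a_def min_def)
        moreover have "x $ j * m \<le> real (a j) + 1"
          using fl j le m0 by (auto simp: a_def min_def of_nat_diff)
        ultimately show ?thesis
          using m0 by (simp add: field_simps)
      qed
      moreover have "a \<in> X"
        using m0 by (auto simp: X_def a_def)
      ultimately show "y \<in> (\<Union>a\<in>X. g a)"
        using x by (auto simp: g_def)
    qed
    have dist_g: "dist y z \<le> D / m" if yz: "y \<in> g a" "z \<in> g a" for a y z
    proof -
      obtain x x' where x: "y = f x" "z = f x'" "x \<in> ?E" "x' \<in> ?E"
        "\<And>j. j \<in> J \<Longrightarrow> real (a j) / m \<le> x $ j \<and> x $ j \<le> (real (a j) + 1) / m"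
        "\<And>j. j \<in> J \<Longrightarrow> real (a j) / m \<le> x' $ j \<and> x' $ j \<le> (real (a j) + 1) / m"
        using yz by (auto simp: g_def)
      have comp: "\<bar>(x - x') $ i\<bar> \<le> 1 / m" for i
      proof (cases "i \<in> J")
        case True
        then show ?thesis
          using x(5,6)[OF True] by (auto simp: abs_le_iff add_divide_distrib)
      next
        case False
        then show ?thesis
          using x(3,4) by auto
      qed
      have "dist y z \<le> L * dist x x'"
        unfolding x(1,2) using f x(3,4) by (intro lipschitz_onD) auto
      also have "dist x x' \<le> (\<Sum>i\<in>UNIV. \<bar>(x - x') $ i\<bar>)"
        unfolding dist_norm by (rule norm_le_l1_cart)
      also have "\<dots> \<le> (\<Sum>i\<in>(UNIV::'n set). 1 / m)"
        using comp by (intro sum_mono) auto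
      finally show ?thesis
        using L by (simp add: D_def mult_left_mono)
    qed
    have "bounded (g a)" for a
    proof (cases "g a = {}")
      case False
      then obtain y where "y \<in> g a" by auto
      then show ?thesis
        using dist_g[of y a] unfolding bounded_def by blast
    qed simp
    moreover have "diameter (g a) \<le> D / m" for a
      using dist_g D by (intro diameter_le) (auto simp: dist_norm)
    ultimately have "hausdorff_content ?s \<delta> (f ` ?E) \<le> ennreal (card X * (unit_ball_vol ?s * (D / m / 2) powr ?s))"
      using card_X D Dm card_J cover by (intro hausdorff_content_finite_cover[of X _ g]) auto
    also have "real (card X) * (unit_ball_vol ?s * (D / m / 2) powr ?s) = unit_ball_vol ?s * (D / 2) powr ?s"
      using m0 D card_J by (simp add: card_X powr_card_eq power_divide)
    finally show ?thesis .
  qed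
  then have "hausdorff ?s (f ` ?E) \<le> ?b"
    unfolding hausdorff_def by (intro SUP_least) auto
  then show ?thesis
    by (rule le_less_trans) simp
qed

text \<open>A cover of \<open>f ` E\<close> by sets of diameter \<open>d\<close> yields a cover of a cylinder over \<open>E\<close> by boxes with
  sides of length at most \<open>2 * L * d\<close> in the directions \<open>J\<close> and \<open>1\<close> in the others.\<close>

lemma hausdorff_pos:
  fixes f :: "real^'n \<Rightarrow> real^'n"
  assumes f: "\<And>x y. x \<in> E \<Longrightarrow> y \<in> E \<Longrightarrow> norm (x - y) \<le> L * norm (f x - f y)" and L: "L > 0"
    and J: "J \<noteq> {}"
    and B: "\<And>b. b \<in> cbox l u \<Longrightarrow> (\<exists>x\<in>E. \<forall>j\<in>J. x $ j = b $ j) \<and> (\<forall>i\<in>- J. 0 \<le> b $ i \<and> b $ i \<le> 1)"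
    and lu: "\<And>i. l $ i < u $ i"
  shows "hausdorff (real (card J)) (f ` E) > 0"
proof -
  let ?s = "real (card J)"
  have card_J: "card J > 0"
    using J by (simp add: card_gt_0_iff)
  have ubv: "unit_ball_vol ?s > 0"
    by simp
  define \<beta> where "\<beta> = measure lborel (cbox l u)"
  have \<beta>: "\<beta> > 0"
    unfolding \<beta>_def using lu by (subst content_cbox_cart) (auto simp: interval_ne_empty_cart less_imp_le intro!: prod_pos)
  have em: "emeasure lborel (cbox l u) = ennreal \<beta>"
    unfolding \<beta>_def by (intro emeasure_eq_ennreal_measure)
      (metis emeasure_lborel_cbox_finite infinity_ennreal_def less_irrefl)
  \<comment> \<open>The ratio between the volume \<open>(2 * L * d) ^ card J\<close> of a box and
    the term that a set of diameter \<open>d\<close> contributes to the Hausdorff content.\<close>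
  define K where "K = (4 * L) ^ card J / unit_ball_vol ?s"
  have K: "K > 0"
    using L ubv by (simp add: K_def)
  \<comment> \<open>The scale 1 is arbitrary: \<open>hausdorff\<close> is the supremum over all
    scales, so one positive lower bound is enough.\<close>
  have "ennreal (\<beta> / K) \<le> hausdorff_content ?s 1 (f ` E)"
    unfolding hausdorff_content_def
  proof (intro INF_greatest)
    fix U :: "nat \<Rightarrow> (real^'n) set"
    assume "U \<in> {U. f ` E \<subseteq> (\<Union>i. U i) \<and> (\<forall>i. bounded (U i) \<and> diameter (U i) < 1)}"
    then have U: "f ` E \<subseteq> (\<Union>i. U i)" "\<And>i. bounded (U i)"
      by auto
    define d where "d i = diameter (U i)" for i
    have d: "d i \<ge> 0" for i
      by (simp add: d_def diameter_ge_0 U)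
    define y where "y i = (SOME x. x \<in> E \<and> f x \<in> U i)" for i
    \<comment> \<open>The box is centred at \<open>y i\<close>, a point of \<open>E\<close> mapped
      into \<open>U i\<close> if there is one. In the directions outside \<open>J\<close> it fills
      [0, 1], where \<open>B\<close> confines the cylinder.\<close>
    define lo where "lo i = (\<chi> j. if j \<in> J then y i $ j - L * d i else 0)" for i
    define hi where "hi i = (\<chi> j. if j \<in> J then y i $ j + L * d i else 1)" for i
    define Q where "Q i = cbox (lo i) (hi i)" for i
    have cover: "cbox l u \<subseteq> (\<Union>i. Q i)"
    proof
      fix b assume b: "b \<in> cbox l u"
      then obtain x where x: "x \<in> E" "\<And>j. j \<in> J \<Longrightarrow> x $ j = b $ j"
        using B by blast
      then obtain i where i: "f x \<in> U i"
        using U(1) by auto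
      then have y: "y i \<in> E" "f (y i) \<in> U i"
        using someI[of "\<lambda>x. x \<in> E \<and> f x \<in> U i" x] x(1) by (auto simp: y_def)
      have "norm (x - y i) \<le> L * norm (f x - f (y i))"
        by (rule f[OF x(1) y(1)])
      also have "\<dots> \<le> L * d i"
        unfolding d_def using L diameter_bounded_bound[OF U(2) i y(2)] by (simp add: dist_norm)
      finally have "\<bar>x $ j - y i $ j\<bar> \<le> L * d i" for j
        using component_le_norm_cart[of "x - y i" j] by simp
      then have "b \<in> Q i"
        using x(2) B[OF b] by (auto simp: Q_def lo_def hi_def mem_box_cart abs_le_iff algebra_simps)
          (smt (verit))+
      then show "b \<in> (\<Union>i. Q i)"
        by blast
    qed
    have Q: "emeasure lborel (Q i) = ennreal (K * (unit_ball_vol ?s * (d i / 2) powr ?s))" for i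
    proof -
      have le: "lo i $ j \<le> hi i $ j" for j
        using L d[of i] by (simp add: lo_def hi_def)
      have "measure lborel (Q i) = (\<Prod>j\<in>UNIV. hi i $ j - lo i $ j)"
        unfolding Q_def using le by (intro content_cbox_cart) (simp add: interval_ne_empty_cart)
      also have "\<dots> = (\<Prod>j\<in>UNIV. if j \<in> J then 2 * (L * d i) else 1)"
        by (intro prod.cong) (auto simp: lo_def hi_def)
      also have "\<dots> = (2 * (L * d i)) ^ card J"
        by (simp add: prod.If_cases)
      also have "2 * (L * d i) = 4 * L * (d i / 2)"
        by simp
      also have "(4 * L * (d i / 2)) ^ card J = (4 * L) ^ card J * (d i / 2) ^ card J"
        by (rule power_mult_distrib)
      also have "\<dots> = K * (unit_ball_vol ?s * (d i / 2) powr ?s)"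
        unfolding K_def powr_card_eq[OF divide_nonneg_nonneg[OF d zero_le_numeral] card_J]
        using ubv by (simp del: unit_ball_vol_pos)
      finally show ?thesis
        unfolding Q_def
        by (metis emeasure_eq_ennreal_measure emeasure_lborel_cbox_finite infinity_ennreal_def less_irrefl)
    qed
    have "ennreal \<beta> \<le> emeasure lborel (\<Union>i. Q i)"
      unfolding em[symmetric] by (intro emeasure_mono cover) (auto simp: Q_def)
    also have "\<dots> \<le> (\<Sum>i. emeasure lborel (Q i))"
      by (intro emeasure_subadditive_countably) (auto simp: Q_def)
    also have "\<dots> = (\<Sum>i. ennreal K * ennreal (unit_ball_vol ?s * (d i / 2) powr ?s))"
      unfolding Q using K by (simp add: ennreal_mult')
    also have "\<dots> = ennreal K * (\<Sum>i. ennreal (unit_ball_vol ?s * (d i / 2) powr ?s))"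
      by simp
    finally have "ennreal (1 / K) * ennreal \<beta> \<le>
      ennreal (1 / K) * (ennreal K * (\<Sum>i. ennreal (unit_ball_vol ?s * (d i / 2) powr ?s)))"
      by (rule mult_left_mono) simp
    also have "\<dots> = (\<Sum>i. ennreal (unit_ball_vol ?s * (d i / 2) powr ?s))"
      using K by (simp add: mult.assoc[symmetric] ennreal_mult[symmetric])
    finally show "ennreal (\<beta> / K) \<le> (\<Sum>i. ennreal (unit_ball_vol ?s * (diameter (U i) / 2) powr ?s))"
      using K \<beta> by (simp add: d_def ennreal_mult[symmetric])
  qed
  also have "\<dots> \<le> hausdorff ?s (f ` E)"
    unfolding hausdorff_def by (intro SUP_upper) auto
  finally show ?thesis
    using \<beta> K by (metis divide_pos_pos ennreal_less_zero_iff less_le_trans)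
qed

section \<open>Measurability of the outer normal\<close>

text \<open>For unit vectors the difference \<open>e\<close> satisfies
  \<open>e \<bullet> \<nu> = - (e \<bullet> \<nu>')\<close>, and this is positive. A short step from
  \<open>x\<close> along \<open>e\<close> would thus end outside \<open>S\<close> by the first
  normal and inside by the second.\<close>

lemma is_outer_normal_unique:
  assumes "is_outer_normal S x \<nu>" "is_outer_normal S x \<nu>'"
  shows "\<nu> = \<nu>'"
proof (rule ccontr)
  assume ne: "\<nu> \<noteq> \<nu>'"
  define e where "e = \<nu> - \<nu>'"
  have n: "norm \<nu> = 1" "norm \<nu>' = 1"
    using assms by (auto simp: is_outer_normal_def)
  then have sq: "\<nu> \<bullet> \<nu> = 1" "\<nu>' \<bullet> \<nu>' = 1"
    by (simp_all add: norm_eq_sqrt_inner)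
  define g where "g = e \<bullet> \<nu>"
  have e: "e \<noteq> 0"
    using ne by (simp add: e_def)
  have g': "e \<bullet> \<nu>' = - g"
    by (simp add: g_def e_def inner_diff_left inner_diff_right sq inner_commute[of \<nu>' \<nu>])
  have "e \<bullet> e = 2 * g"
    using g' by (simp add: g_def e_def inner_diff_right)
  then have g: "g > 0"
    using e by (metis inner_gt_zero_iff zero_less_mult_pos zero_less_numeral)
  define \<epsilon> where "\<epsilon> = g / (2 * norm e)"
  have \<epsilon>: "\<epsilon> > 0" "\<epsilon> * norm e < g"
    using g e by (auto simp: \<epsilon>_def)
  obtain \<delta> where \<delta>: "\<delta> > 0" "\<And>y. dist y x < \<delta> \<Longrightarrow> (y - x) \<bullet> \<nu> > \<epsilon> * norm (y - x) \<Longrightarrow> y \<notin> S"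
    using assms(1) \<epsilon>(1) unfolding is_outer_normal_def by meson
  obtain \<delta>' where \<delta>': "\<delta>' > 0" "\<And>y. dist y x < \<delta>' \<Longrightarrow> (y - x) \<bullet> \<nu>' < - \<epsilon> * norm (y - x) \<Longrightarrow> y \<in> S"
    using assms(2) \<epsilon>(1) unfolding is_outer_normal_def by meson
  define t where "t = min \<delta> \<delta>' / (2 * norm e)"
  have t: "t > 0" "t * norm e < \<delta>" "t * norm e < \<delta>'"
    using \<delta> \<delta>' e by (auto simp: t_def)
  let ?y = "x + t *\<^sub>R e"
  have less: "t * (\<epsilon> * norm e) < t * g"
    using t(1) \<epsilon>(2) by simp
  have "?y \<notin> S"
    using \<delta>(2)[of ?y] t less by (simp add: dist_norm mult.left_commute flip: g_def)
  moreover have "?y \<in> S"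
    using \<delta>'(2)[of ?y] t less g' by (simp add: dist_norm mult.left_commute)
  ultimately show False
    by blast
qed

text \<open>Expresses preimages under \<open>outer_normal\<close> by an existential statement, which
  is accessible to closed sets and projections.\<close>

lemma outer_normal_iff:
  "(\<exists>\<nu>\<in>C. is_outer_normal S x \<nu>) \<longleftrightarrow> (\<exists>\<nu>. is_outer_normal S x \<nu>) \<and> outer_normal S x \<in> C"
proof (cases "\<exists>\<nu>. is_outer_normal S x \<nu>")
  case True
  then obtain \<nu> where \<nu>: "is_outer_normal S x \<nu>"
    by blast
  then have ex1: "\<exists>!\<nu>. is_outer_normal S x \<nu>"
    by (rule ex1I) (rule is_outer_normal_unique[OF _ \<nu>])
  have "outer_normal S x = \<nu>"
    unfolding outer_normal_def if_P[OF ex1] by (rule the1_equality[OF ex1 \<nu>])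
  then show ?thesis
    using \<nu> is_outer_normal_unique[OF \<nu>] by metis
qed blast

lemma outer_normal_eq_0: "\<not> (\<exists>\<nu>. is_outer_normal S x \<nu>) \<Longrightarrow> outer_normal S x = 0"
  unfolding outer_normal_def by auto

lemma norm_outer_normal: "norm (outer_normal S x) \<le> 1"
proof (cases "\<exists>\<nu>. is_outer_normal S x \<nu>")
  case True
  moreover have "\<nu> \<in> sphere 0 1" if "is_outer_normal S x \<nu>" for \<nu>
    using that by (simp add: is_outer_normal_def)
  ultimately have "outer_normal S x \<in> sphere 0 1"
    using outer_normal_iff[of "sphere 0 1" S x] by blast
  then show ?thesis by simp
qed (simp add: outer_normal_eq_0)

text \<open>The condition of \<open>is_outer_normal\<close> at one scale. Taking pairs rather than
  fibres allows projection along the compact sphere of candidates for the normal.\<close>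

definition approx_normal :: "'a::euclidean_space set \<Rightarrow> real \<Rightarrow> real \<Rightarrow> ('a \<times> 'a) set" where
  "approx_normal S \<epsilon> \<delta> = {(\<nu>, x). \<forall>y. dist y x < \<delta> \<longrightarrow>
     ((y - x) \<bullet> \<nu> > \<epsilon> * norm (y - x) \<longrightarrow> y \<notin> S) \<and> ((y - x) \<bullet> \<nu> < - \<epsilon> * norm (y - x) \<longrightarrow> y \<in> S)}"

text \<open>A single point \<open>y\<close> violates the condition on an open set of pairs, because
  all inequalities are strict; the complement is the union of these sets, whatever \<open>S\<close>
  is.\<close>

lemma closed_approx_normal: "closed (approx_normal S \<epsilon> \<delta>)"
proof -
  have "- approx_normal S \<epsilon> \<delta> =
    (\<Union>y\<in>S. {z. dist y (snd z) < \<delta>} \<inter> {z. \<epsilon> * norm (y - snd z) < (y - snd z) \<bullet> fst z}) \<union>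
    (\<Union>y\<in>- S. {z. dist y (snd z) < \<delta>} \<inter> {z. (y - snd z) \<bullet> fst z < - \<epsilon> * norm (y - snd z)})"
    unfolding approx_normal_def by fastforce
  also have "open \<dots>"
    by (intro open_Un open_UN open_Int ballI open_Collect_less continuous_intros)
  finally show ?thesis
    by (simp add: closed_def)
qed

text \<open>The approximate normals may change with the tolerance; compactness of the sphere
  supplies a limit. For the limit a tolerance \<epsilon> is split into halves, one for the
  approximate normal and one for its distance to the limit.\<close>

lemma outer_normal_limit:
  assumes C: "closed C"
    and approx: "\<And>m::nat. \<exists>j::nat. \<exists>\<nu>\<in>C \<inter> sphere 0 1. (\<nu>, x) \<in> approx_normal S (1 / Suc m) (1 / Suc j)"
  shows "\<exists>\<nu>\<in>C. is_outer_normal S x \<nu>"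
proof -
  obtain j \<nu> where \<nu>: "\<And>m. \<nu> m \<in> C \<inter> sphere 0 1"
    "\<And>m. (\<nu> m, x) \<in> approx_normal S (1 / Suc m) (1 / Suc (j m))"
    using approx by metis
  have "compact (C \<inter> sphere 0 1)"
    by (intro closed_Int_compact C compact_sphere)
  then obtain \<nu>0 r where \<nu>0: "\<nu>0 \<in> C \<inter> sphere 0 1" and r: "strict_mono r"
    and lim: "(\<nu> \<circ> r) \<longlonglongrightarrow> \<nu>0"
    using \<nu>(1) unfolding compact_def by metis
  have "is_outer_normal S x \<nu>0"
    unfolding is_outer_normal_def
  proof (intro conjI allI impI)
    show "norm \<nu>0 = 1"
      using \<nu>0 by simp
    fix \<epsilon> :: real assume \<epsilon>: "\<epsilon> > 0"
    have "eventually (\<lambda>m. dist ((\<nu> \<circ> r) m) \<nu>0 < \<epsilon> / 2) sequentially"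
      by (rule tendstoD[OF lim half_gt_zero[OF \<epsilon>]])
    moreover have "eventually (\<lambda>m. 1 / real (Suc m) < \<epsilon> / 2) sequentially"
      using \<epsilon> by (intro order_tendstoD(2)[OF LIMSEQ_Suc[OF lim_1_over_n]]) auto
    ultimately have "eventually (\<lambda>m. dist ((\<nu> \<circ> r) m) \<nu>0 < \<epsilon> / 2 \<and> 1 / real (Suc m) < \<epsilon> / 2) sequentially"
      by (rule eventually_conj)
    then obtain m where m: "dist (\<nu> (r m)) \<nu>0 < \<epsilon> / 2" "1 / real (Suc m) < \<epsilon> / 2"
      unfolding eventually_sequentially by auto
    have rm: "1 / real (Suc (r m)) \<le> 1 / real (Suc m)"
      using seq_suble[OF r, of m] by (intro divide_left_mono) auto
    have close: "\<bar>(y - x) \<bullet> \<nu> (r m) - (y - x) \<bullet> \<nu>0\<bar> \<le> \<epsilon> / 2 * norm (y - x)" for y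
    proof -
      have "\<bar>(y - x) \<bullet> (\<nu> (r m) - \<nu>0)\<bar> \<le> norm (y - x) * norm (\<nu> (r m) - \<nu>0)"
        by (rule Cauchy_Schwarz_ineq2)
      also have "\<dots> \<le> norm (y - x) * (\<epsilon> / 2)"
        using m(1) by (intro mult_left_mono) (auto simp: dist_norm)
      finally show ?thesis
        by (simp add: inner_diff_right mult.commute)
    qed
    have small: "1 / real (Suc (r m)) * norm (y - x) \<le> \<epsilon> / 2 * norm (y - x)" for y
      using rm m(2) by (intro mult_right_mono) auto
    have R: "dist y x < 1 / real (Suc (j (r m))) \<Longrightarrow>
      ((y - x) \<bullet> \<nu> (r m) > 1 / real (Suc (r m)) * norm (y - x) \<longrightarrow> y \<notin> S) \<and>
      ((y - x) \<bullet> \<nu> (r m) < - (1 / real (Suc (r m)) * norm (y - x)) \<longrightarrow> y \<in> S)" for y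
      using \<nu>(2)[of "r m"] unfolding approx_normal_def by auto
    show "\<exists>\<delta>>0. \<forall>y. dist y x < \<delta> \<longrightarrow>
      (\<epsilon> * norm (y - x) < (y - x) \<bullet> \<nu>0 \<longrightarrow> y \<notin> S) \<and> ((y - x) \<bullet> \<nu>0 < - \<epsilon> * norm (y - x) \<longrightarrow> y \<in> S)"
    proof (intro exI[of _ "1 / real (Suc (j (r m)))"] conjI allI impI)
      fix y assume y: "dist y x < 1 / real (Suc (j (r m)))"
      define h where "h = \<epsilon> / 2 * norm (y - x)"
      define g where "g = 1 / real (Suc (r m)) * norm (y - x)"
      have "\<epsilon> * norm (y - x) = h + h" "\<bar>(y - x) \<bullet> \<nu> (r m) - (y - x) \<bullet> \<nu>0\<bar> \<le> h" "g \<le> h"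
        using close[of y] small[of y] by (simp_all add: h_def g_def)
      then have *: "\<epsilon> * norm (y - x) < (y - x) \<bullet> \<nu>0 \<Longrightarrow> g < (y - x) \<bullet> \<nu> (r m)"
        "(y - x) \<bullet> \<nu>0 < - (\<epsilon> * norm (y - x)) \<Longrightarrow> (y - x) \<bullet> \<nu> (r m) < - g"
        by linarith+
      show "\<epsilon> * norm (y - x) < (y - x) \<bullet> \<nu>0 \<Longrightarrow> y \<notin> S"
        using R[OF y] *(1) unfolding g_def by blast
      show "(y - x) \<bullet> \<nu>0 < - \<epsilon> * norm (y - x) \<Longrightarrow> y \<in> S"
        using R[OF y] *(2) unfolding g_def minus_mult_left[symmetric] by blast
    qed simp
  qed
  then show ?thesis
    using \<nu>0 by blast
qed

text \<open>\<open>outer_normal_limit\<close> moves the quantifier over \<nu> inside the countable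
  ones. The set becomes a countable intersection of countable unions of closed sets, since a closed
  set projects to a closed set along a compact factor.\<close>

lemma outer_normal_set_borel:
  fixes S :: "'a::euclidean_space set"
  assumes C: "closed C"
  shows "{x. \<exists>\<nu>\<in>C. is_outer_normal S x \<nu>} \<in> sets borel"
proof -
  have "{x. \<exists>\<nu>\<in>C. is_outer_normal S x \<nu>} =
    (\<Inter>m::nat. \<Union>j::nat. {x. \<exists>\<nu>. \<nu> \<in> C \<inter> sphere 0 1 \<and> (\<nu>, x) \<in> approx_normal S (1 / Suc m) (1 / Suc j)})"
    (is "?L = ?R")
  proof (intro equalityI subsetI)
    fix x assume "x \<in> ?L"
    then obtain \<nu> where \<nu>: "\<nu> \<in> C" "is_outer_normal S x \<nu>"
      by auto
    have "\<exists>j::nat. (\<nu>, x) \<in> approx_normal S (1 / Suc m) (1 / Suc j)" for m :: nat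
    proof -
      have "1 / real (Suc m) > 0"
        by simp
      then obtain \<delta> where \<delta>: "\<delta> > 0" "\<forall>y. dist y x < \<delta> \<longrightarrow>
        ((y - x) \<bullet> \<nu> > 1 / real (Suc m) * norm (y - x) \<longrightarrow> y \<notin> S) \<and>
        ((y - x) \<bullet> \<nu> < - (1 / real (Suc m)) * norm (y - x) \<longrightarrow> y \<in> S)"
        using \<nu>(2) unfolding is_outer_normal_def by blast
      obtain j :: nat where "1 / real (Suc j) < \<delta>"
        using \<delta>(1) nat_approx_posE by blast
      then show ?thesis
        using \<delta>(2) unfolding approx_normal_def
        by (intro exI[of _ j]) (auto dest: less_trans)
    qed
    moreover have "\<nu> \<in> sphere 0 1"
      using \<nu> by (simp add: is_outer_normal_def)
    ultimately show "x \<in> ?R"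
      using \<nu>(1) by blast
  next
    fix x assume "x \<in> ?R"
    then show "x \<in> ?L"
      using outer_normal_limit[OF C, of x S] by blast
  qed
  moreover have "closed {x. \<exists>\<nu>. \<nu> \<in> C \<inter> sphere 0 1 \<and> (\<nu>, x) \<in> approx_normal S \<epsilon> \<delta>}" for \<epsilon> \<delta>
    by (rule closed_compact_projection[OF _ closed_approx_normal])
      (intro closed_Int_compact C compact_sphere)
  ultimately show ?thesis
    by (auto intro!: sets.countable_INT sets.countable_UN)
qed

lemma borel_measurable_outer_normal [measurable]:
  "outer_normal (S :: 'a::euclidean_space set) \<in> borel_measurable borel"
proof (rule borel_measurableI)
  fix U :: "'a set" assume U: "open U"
  let ?D = "{x. \<exists>\<nu>. is_outer_normal S x \<nu>}"
  let ?N = "{x. \<exists>\<nu>\<in>- U. is_outer_normal S x \<nu>}"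
  have D: "?D \<in> sets borel"
    using outer_normal_set_borel[of UNIV S] by simp
  have N: "?N \<in> sets borel"
    using outer_normal_set_borel[of "- U" S] U by (simp add: closed_Compl)
  have "outer_normal S -` U = (?D - ?N) \<union> (if 0 \<in> U then - ?D else {})"
  proof (rule set_eqI)
    fix x
    show "x \<in> outer_normal S -` U \<longleftrightarrow> x \<in> (?D - ?N) \<union> (if 0 \<in> U then - ?D else {})"
      using outer_normal_iff[of "- U" S x] outer_normal_eq_0[of S x]
      by (cases "\<exists>\<nu>. is_outer_normal S x \<nu>") auto
  qed
  also have "\<dots> \<in> sets borel"
    using D N by auto
  finally show "outer_normal S -` U \<inter> space borel \<in> sets borel"
    by simp
qed

section \<open>Mapped polynomials on a cell\<close>

lemma has_derivative_grad:
  assumes "p differentiable (at x)"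
  shows "(p has_derivative (\<lambda>h. grad p x \<bullet> h)) (at x)"
proof -
  have D: "(p has_derivative frechet_derivative p (at x)) (at x)"
    using assms frechet_derivative_works by blast
  then have lin: "linear (frechet_derivative p (at x))"
    using has_derivative_linear by blast
  have "frechet_derivative p (at x) h = grad p x \<bullet> h" for h
  proof -
    have "frechet_derivative p (at x) h = frechet_derivative p (at x) (\<Sum>i\<in>UNIV. h $ i *\<^sub>R axis i 1)"
      using basis_expansion[of h] by (simp add: scalar_mult_eq_scaleR)
    also have "\<dots> = grad p x \<bullet> h"
      by (simp add: linear_sum[OF lin] linear_scale[OF lin] grad_def inner_vec_def mult.commute)
    finally show ?thesis .
  qed
  then have "frechet_derivative p (at x) = (\<lambda>h. grad p x \<bullet> h)"
    by blast
  then show ?thesis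
    using D by simp
qed

lemma grad_unique:
  assumes "(p has_derivative (\<lambda>h. g \<bullet> h)) (at x)"
  shows "grad p x = g"
  using frechet_derivative_at[OF assms, symmetric] by (simp add: grad_def inner_axis vec_eq_iff)

lemma grad_linear:
  assumes "p differentiable (at x)" "q differentiable (at x)"
  shows "grad (\<lambda>x. a * p x + b * q x) x = a *\<^sub>R grad p x + b *\<^sub>R grad q x"
proof (rule grad_unique)
  show "((\<lambda>x. a * p x + b * q x) has_derivative (\<lambda>h. (a *\<^sub>R grad p x + b *\<^sub>R grad q x) \<bullet> h)) (at x)"
    by (rule derivative_eq_intros has_derivative_grad assms refl)+ (simp add: inner_add_left)
qed

lemma jacobian_component:
  assumes "v differentiable (at x)"
  shows "jacobian v (at x) $ i $ j = grad (\<lambda>y. v y $ i) x $ j"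
proof -
  have D: "(v has_derivative frechet_derivative v (at x)) (at x)"
    using assms frechet_derivative_works by blast
  have "((\<lambda>y. v y $ i) has_derivative (\<lambda>h. frechet_derivative v (at x) h $ i)) (at x)"
    by (rule bounded_linear.has_derivative[OF bounded_linear_vec_nth D])
  from frechet_derivative_at[OF this, symmetric] show ?thesis
    by (simp add: jacobian_def matrix_def grad_def)
qed

lemma vec_differentiable:
  fixes v :: "'a::real_normed_vector \<Rightarrow> real^'m"
  assumes "\<And>i. (\<lambda>y. v y $ i) differentiable (at x)"
  shows "v differentiable (at x)"
  by (subst differentiable_componentwise_within) (use assms in \<open>auto simp: Basis_vec_def inner_axis\<close>)

definition C1 :: "(real^'n \<Rightarrow> real) \<Rightarrow> bool" where
  "C1 p \<longleftrightarrow> (\<forall>x. p differentiable (at x)) \<and> continuous_on UNIV (grad p)"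

lemma C1I:
  assumes "continuous_on UNIV G" "\<And>x. (p has_derivative (\<lambda>h. G x \<bullet> h)) (at x)"
  shows "C1 p"
proof -
  have "grad p = G"
    using grad_unique[OF assms(2)] by blast
  then show ?thesis
    using assms unfolding C1_def differentiable_def by blast
qed

lemma C1_has_derivative: "C1 p \<Longrightarrow> (p has_derivative (\<lambda>h. grad p x \<bullet> h)) (at x)"
  by (simp add: C1_def has_derivative_grad)

lemma C1_continuous: "C1 p \<Longrightarrow> continuous_on S p"
  by (meson C1_has_derivative continuous_at_imp_continuous_on has_derivative_continuous)

lemma C1_const: "C1 (\<lambda>x. c)"
  by (rule C1I[of "\<lambda>x. 0"]) auto

lemma C1_component: "C1 (\<lambda>x. x $ i)"
proof (rule C1I[of "\<lambda>x. axis i 1"])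
  show "((\<lambda>x. x $ i) has_derivative (\<lambda>h. axis i 1 \<bullet> h)) (at x)" for x :: "real^'a"
    using bounded_linear_imp_has_derivative[OF bounded_linear_vec_nth[of i]] by (simp add: inner_axis')
qed auto

lemma C1_add: "C1 p \<Longrightarrow> C1 q \<Longrightarrow> C1 (\<lambda>x. p x + q x)"
proof (rule C1I[of "\<lambda>x. grad p x + grad q x"])
  assume "C1 p" "C1 q"
  then show "continuous_on UNIV (\<lambda>x. grad p x + grad q x)"
    by (auto simp: C1_def intro!: continuous_intros)
  show "((\<lambda>x. p x + q x) has_derivative (\<lambda>h. (grad p x + grad q x) \<bullet> h)) (at x)" for x
    unfolding inner_add_left using \<open>C1 p\<close> \<open>C1 q\<close>
    by (intro has_derivative_add C1_has_derivative)
qed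

lemma C1_mult: "C1 p \<Longrightarrow> C1 q \<Longrightarrow> C1 (\<lambda>x. p x * q x)"
proof (rule C1I[of "\<lambda>x. p x *\<^sub>R grad q x + q x *\<^sub>R grad p x"])
  assume pq: "C1 p" "C1 q"
  then show "continuous_on UNIV (\<lambda>x. p x *\<^sub>R grad q x + q x *\<^sub>R grad p x)"
    using C1_continuous by (auto simp: C1_def intro!: continuous_intros)
  show "((\<lambda>x. p x * q x) has_derivative (\<lambda>h. (p x *\<^sub>R grad q x + q x *\<^sub>R grad p x) \<bullet> h)) (at x)" for x
    using has_derivative_mult[OF C1_has_derivative[OF pq(1), of x] C1_has_derivative[OF pq(2), of x]]
    by (simp add: inner_add_left mult.commute)
qed

lemma C1_sum: "(\<And>i. i \<in> A \<Longrightarrow> C1 (f i)) \<Longrightarrow> C1 (\<lambda>x. \<Sum>i\<in>A. f i x)"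
  by (induction A rule: infinite_finite_induct) (auto intro: C1_const C1_add)

lemma C1_prod: "(\<And>i. i \<in> A \<Longrightarrow> C1 (f i)) \<Longrightarrow> C1 (\<lambda>x. \<Prod>i\<in>A. f i x)"
  by (induction A rule: infinite_finite_induct) (auto intro: C1_const C1_mult)

lemma C1_power: "C1 f \<Longrightarrow> C1 (\<lambda>x. f x ^ m)"
  by (induction m) (auto intro: C1_const C1_mult)

lemma
  fixes p :: "real^'n \<Rightarrow> real"
  shows C1_Q_poly: "p \<in> Q_poly r \<Longrightarrow> C1 p"
    and C1_P_poly: "p \<in> P_poly r \<Longrightarrow> C1 p"
proof -
  have "C1 (\<lambda>x::real^'n. \<Sum>a\<in>A. c a * (\<Prod>i\<in>UNIV. (x $ i) ^ a i))" for A and c :: "('n \<Rightarrow> nat) \<Rightarrow> real"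
    by (intro C1_sum C1_mult C1_const C1_prod C1_power C1_component)
  then show "p \<in> Q_poly r \<Longrightarrow> C1 p" "p \<in> P_poly r \<Longrightarrow> C1 p"
    unfolding Q_poly_def P_poly_def by (auto simp flip: fun_eq_iff)
qed

section \<open>Continuity up to the boundary and traces\<close>

text \<open>Values on the frontier of \<open>K\<close> are ignored: discontinuous pressures are set
  to 0 there, and classical derivatives of finite element functions need not exist.\<close>

definition cont_closure :: "'a::metric_space set \<Rightarrow> ('a \<Rightarrow> 'b::topological_space) \<Rightarrow> bool" where
  "cont_closure K f \<longleftrightarrow> (\<exists>g. continuous_on (closure K) g \<and> (\<forall>x\<in>K. f x = g x))"

lemma cont_closureI: "continuous_on (closure K) g \<Longrightarrow> (\<And>x. x \<in> K \<Longrightarrow> f x = g x) \<Longrightarrow> cont_closure K f"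
  by (auto simp: cont_closure_def)

lemma cont_closure_subset:
  "continuous_on T f \<Longrightarrow> closure K \<subseteq> T \<Longrightarrow> cont_closure K f"
  by (auto intro: cont_closureI continuous_on_subset)

lemma cont_closure_compose: "continuous_on UNIV F \<Longrightarrow> cont_closure K f \<Longrightarrow> cont_closure K (\<lambda>x. F (f x))"
  unfolding cont_closure_def by (metis (no_types, lifting) continuous_on_compose2 top_greatest)

lemma cont_closure_vec:
  fixes f :: "'a::metric_space \<Rightarrow> 'b::real_normed_vector^'n"
  assumes "\<And>i. cont_closure K (\<lambda>x. f x $ i)"
  shows "cont_closure K f"
proof -
  obtain g where "\<And>i. continuous_on (closure K) (g i) \<and> (\<forall>x\<in>K. f x $ i = g i x)"
    using assms unfolding cont_closure_def by metis
  then show ?thesis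
    by (intro cont_closureI[of K "\<lambda>x. \<chi> i. g i x"] continuous_on_vec_lambda) (auto simp: vec_eq_iff)
qed

lemma cont_closure_cong: "(\<And>x. x \<in> K \<Longrightarrow> f x = g x) \<Longrightarrow> cont_closure K f \<Longrightarrow> cont_closure K g"
  unfolding cont_closure_def by metis

lemma open_closure_islimpt:
  fixes K :: "'a::euclidean_space set"
  assumes "open K" "x \<in> closure K"
  shows "at x within K \<noteq> bot"
proof -
  have "x islimpt K"
  proof (cases "x \<in> K")
    case True
    then show ?thesis
      using assms(1) interior_limit_point interior_open by metis
  next
    case False
    then show ?thesis
      using assms(2) by (simp add: closure_def)
  qed
  then show ?thesis
    using trivial_limit_within by blast
qed

text \<open>An open set accumulates at every point of its closure, so the limit that defines
  \<open>tr\<close> is unique and can be read off from any continuous extension.\<close>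

lemma tr_eqI:
  fixes K :: "'a::euclidean_space set"
  assumes K: "open K" and x: "x \<in> closure K" and g: "continuous_on (closure K) g"
    and eq: "\<And>y. y \<in> K \<Longrightarrow> f y = g y"
  shows "tr K f x = g x"
proof -
  have "(g \<longlongrightarrow> g x) (at x within K)"
    using g x closure_subset unfolding continuous_on_def by (meson tendsto_within_subset)
  then have "(f \<longlongrightarrow> g x) (at x within K)"
    by (rule Lim_transform_eventually) (auto simp: eventually_at_filter eq)
  then show ?thesis
    unfolding tr_def using tendsto_Lim open_closure_islimpt[OF K x] by blast
qed

lemma tr_continuous:
  fixes K :: "'a::euclidean_space set"
  assumes "open K" "cont_closure K f"
  shows "continuous_on (closure K) (tr K f)"
proof -
  obtain g where "continuous_on (closure K) g" "\<forall>x\<in>K. f x = g x"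
    using assms(2) by (auto simp: cont_closure_def)
  then show ?thesis
    using tr_eqI[OF assms(1), of _ g f] continuous_on_cong[of "closure K" _ "tr K f" g] by simp
qed

lemma tr_compose2:
  fixes K :: "'a::euclidean_space set"
  assumes K: "open K" and x: "x \<in> closure K" and f: "cont_closure K f" and g: "cont_closure K g"
    and F: "continuous_on UNIV (\<lambda>z. F (fst z) (snd z))"
    and h: "\<And>y. y \<in> K \<Longrightarrow> h y = F (f y) (g y)"
  shows "tr K h x = F (tr K f x) (tr K g x)"
proof -
  obtain f' g' where f': "continuous_on (closure K) f'" "\<forall>x\<in>K. f x = f' x"
    and g': "continuous_on (closure K) g'" "\<forall>x\<in>K. g x = g' x"
    using f g unfolding cont_closure_def by metis
  have "tr K h x = F (f' x) (g' x)"
  proof (rule tr_eqI[OF K x])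
    have "continuous_on (closure K) (\<lambda>x. (\<lambda>z. F (fst z) (snd z)) (f' x, g' x))"
      by (rule continuous_on_compose2[OF F]) (auto intro!: continuous_on_Pair f' g')
    then show "continuous_on (closure K) (\<lambda>x. F (f' x) (g' x))"
      by simp
  qed (use f' g' h in auto)
  then show ?thesis
    using tr_eqI[OF K x f'(1), of f] tr_eqI[OF K x g'(1), of g] f' g' by simp
qed

lemma tr_linear:
  fixes K :: "'a::euclidean_space set" and f g :: "'a \<Rightarrow> 'b::real_normed_vector"
  assumes K: "open K" and x: "x \<in> closure K" and f: "cont_closure K f" and g: "cont_closure K g"
    and h: "\<And>y. y \<in> K \<Longrightarrow> h y = a *\<^sub>R f y + b *\<^sub>R g y"
  shows "tr K h x = a *\<^sub>R tr K f x + b *\<^sub>R tr K g x"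
proof -
  have "continuous_on UNIV (\<lambda>z::'b \<times> 'b. a *\<^sub>R fst z + b *\<^sub>R snd z)"
    by (intro continuous_intros)
  from tr_compose2[OF K x f g this] h show ?thesis
    by simp
qed

lemma tr_zero:
  fixes K :: "'a::euclidean_space set" and f :: "'a \<Rightarrow> 'b::real_normed_vector"
  assumes "open K" "x \<in> closure K" "\<And>y. y \<in> K \<Longrightarrow> f y = 0"
  shows "tr K f x = 0"
  by (rule tr_eqI[OF assms(1,2)]) (auto simp: assms(3))

lemma continuous_on_det:
  fixes A :: "'a::topological_space \<Rightarrow> real^'n^'n"
  assumes "\<And>i j. continuous_on S (\<lambda>x. A x $ i $ j)"
  shows "continuous_on S (\<lambda>x. det (A x))"
  unfolding det_def by (intro continuous_intros assms)

section \<open>Cell maps and functions pulled back to the unit cube\<close>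

locale cell =
  fixes \<Phi> :: "real^'n \<Rightarrow> real^'n"
  assumes cell_map: "cell_map \<Phi>"
begin

definition K where "K = \<Phi> ` box 0 1"
definition \<Psi> where "\<Psi> = inv_into (cbox 0 1) \<Phi>"
definition J where "J x = jacobian \<Phi> (at x)"

lemma C1_component_map: "C1 (\<lambda>x. \<Phi> x $ i)"
  using cell_map C1_Q_poly by (auto simp: cell_map_def)

lemma has_derivative_map: "(\<Phi> has_derivative (\<lambda>h. J x *v h)) (at x)"
  unfolding J_def using vec_differentiable[of \<Phi> x] C1_component_map
  by (auto simp: C1_def simp flip: jacobian_works)

lemma J_component: "J x $ i $ j = grad (\<lambda>y. \<Phi> y $ i) x $ j"
  unfolding J_def using vec_differentiable[of \<Phi> x] C1_component_map
  by (intro jacobian_component) (auto simp: C1_def)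

lemma continuous_J: "continuous_on S (\<lambda>x. J x $ i $ j)"
  unfolding J_component using C1_component_map[of i]
  by (auto simp: C1_def intro!: continuous_intros elim: continuous_on_subset)

lemma continuous_map: "continuous_on S \<Phi>"
  using has_derivative_map has_derivative_continuous continuous_at_imp_continuous_on by blast

lemma inj_map: "inj_on \<Phi> (cbox 0 1)"
  and det_J: "x \<in> cbox 0 1 \<Longrightarrow> det (J x) \<noteq> 0"
  using cell_map by (auto simp: cell_map_def J_def)

lemma box_cbox: "box 0 1 \<subseteq> (cbox 0 1 :: (real^'n) set)" "box 0 1 \<noteq> ({} :: (real^'n) set)"
  by (auto simp: box_subset_cbox interval_ne_empty_cart)

lemma \<Psi>_map: "x \<in> cbox 0 1 \<Longrightarrow> \<Psi> (\<Phi> x) = x"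
  unfolding \<Psi>_def using inj_map by (rule inv_into_f_f)

lemma open_K: "open K"
  unfolding K_def
  using continuous_map open_box inj_on_subset[OF inj_map box_cbox(1)] by (intro invariance_of_domain_gen) auto

lemma K_nonempty: "K \<noteq> {}"
  using box_cbox(2) by (simp add: K_def)

lemma compact_image: "compact (\<Phi> ` cbox 0 1)"
  by (intro compact_continuous_image continuous_map compact_cbox)

lemma closure_K: "closure K = \<Phi> ` cbox 0 1"
proof
  have "K \<subseteq> \<Phi> ` cbox 0 1"
    unfolding K_def using box_cbox by blast
  then show "closure K \<subseteq> \<Phi> ` cbox 0 1"
    by (intro closure_minimal compact_imp_closed compact_image)
  have "closure (box 0 1) = (cbox 0 1 :: (real^'n) set)"
    by (rule closure_box) (rule box_cbox)
  then show "\<Phi> ` cbox 0 1 \<subseteq> closure K"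
    using image_closure_subset[OF continuous_map closed_closure, of "box 0 1" K] closure_subset[of K]
    by (simp add: K_def)
qed

lemma compact_closure_K: "compact (closure K)"
  using compact_image by (simp add: closure_K)

lemma continuous_\<Psi>: "continuous_on (closure K) \<Psi>"
  unfolding closure_K by (intro continuous_on_inv continuous_map compact_cbox) (simp add: \<Psi>_map)

lemma \<Psi>_closure: "\<Psi> ` closure K \<subseteq> cbox 0 1"
  by (auto simp: closure_K \<Psi>_map)

text \<open>The image of the frontier of the cube covers this set, and differentiable maps preserve
  null sets.\<close>

lemma frontier_negligible: "negligible (closure K - K)"
proof -
  have "closure K - K \<subseteq> \<Phi> ` (cbox 0 1 - box 0 1)"
    unfolding closure_K by (auto simp: K_def)
  moreover have "negligible (\<Phi> ` (cbox 0 1 - box 0 1))"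
    using has_derivative_map
    by (intro negligible_differentiable_image_negligible negligible_frontier_interval)
      (auto simp: differentiable_on_def differentiable_def intro: has_derivative_at_withinI)
  ultimately show ?thesis
    using negligible_subset by blast
qed

context
  fixes q p :: "real^'n \<Rightarrow> real"
  assumes p: "C1 p" and q: "\<And>x. x \<in> box 0 1 \<Longrightarrow> q (\<Phi> x) = p x"
begin

lemma mapped_cont_closure: "cont_closure K q"
proof (rule cont_closureI)
  show "continuous_on (closure K) (p \<circ> \<Psi>)"
    using continuous_on_compose[OF continuous_\<Psi> C1_continuous[OF p]] .
  show "q x = (p \<circ> \<Psi>) x" if "x \<in> K" for x
    using that q \<Psi>_map box_cbox(1) unfolding K_def by auto
qed

text \<open>On \<open>K\<close> the function is \<open>p\<close> composed with the inverse of the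
  cell map, which is differentiable because \<open>J x\<close> is invertible.\<close>

lemma mapped_differentiable:
  assumes y: "y \<in> K"
  shows "q differentiable (at y)"
proof -
  obtain x where x: "x \<in> box 0 1" "y = \<Phi> x"
    using y by (auto simp: K_def)
  have xc: "x \<in> cbox 0 1"
    using x box_cbox by blast
  have "invertible (J x)"
    using det_J[OF xc] by (simp add: invertible_det_nz)
  then obtain A where "J x ** A = mat 1"
    by (auto simp: invertible_def)
  then have inv: "(\<lambda>h. J x *v h) \<circ> (\<lambda>h. A *v h) = id"
    by (auto simp: fun_eq_iff matrix_vector_mul_assoc)
  have "(\<Psi> has_derivative (\<lambda>h. A *v h)) (at (\<Phi> x))"
    by (rule has_derivative_inverse_strong[OF open_box x(1) continuous_map _ has_derivative_map inv])
      (use box_cbox(1) \<Psi>_map in blast)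
  moreover have "(p has_derivative (\<lambda>h. grad p x \<bullet> h)) (at (\<Psi> (\<Phi> x)))"
    using C1_has_derivative[OF p] \<Psi>_map[OF xc] by simp
  ultimately have "((\<lambda>z. p (\<Psi> z)) has_derivative (\<lambda>h. grad p x \<bullet> (A *v h))) (at (\<Phi> x))"
    by (rule has_derivative_compose)
  then have "(q has_derivative (\<lambda>h. grad p x \<bullet> (A *v h))) (at (\<Phi> x))"
    by (rule has_derivative_transform_within_open[OF _ open_K])
      (use x y q \<Psi>_map box_cbox(1) in \<open>auto simp: K_def subset_iff\<close>)
  then show ?thesis
    unfolding x(2) differentiable_def by blast
qed

lemma mapped_grad:
  assumes x: "x \<in> box 0 1"
  shows "transpose (J x) *v grad q (\<Phi> x) = grad p x"
proof -
  have "\<Phi> x \<in> K"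
    using x by (simp add: K_def)
  then have "((\<lambda>z. q (\<Phi> z)) has_derivative (\<lambda>h. grad q (\<Phi> x) \<bullet> (J x *v h))) (at x)"
    using has_derivative_compose[OF has_derivative_map has_derivative_grad[OF mapped_differentiable]] by blast
  then have "(p has_derivative (\<lambda>h. grad q (\<Phi> x) \<bullet> (J x *v h))) (at x)"
    by (rule has_derivative_transform_within_open[OF _ open_box x]) (rule q)
  then have "(p has_derivative (\<lambda>h. (transpose (J x) *v grad q (\<Phi> x)) \<bullet> h)) (at x)"
    by (simp add: transpose_matrix_vector dot_lmul_matrix)
  then show ?thesis
    using grad_unique by metis
qed

text \<open>Cramer's rule expresses the gradient on the cell by functions that are continuous up to the
  boundary.\<close>

lemma mapped_grad_cont_closure: "cont_closure K (grad q)"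
proof -
  define H where "H x = (\<chi> k. det (\<chi> i j. if j = k then grad p x $ i else transpose (J x) $ i $ j) / det (transpose (J x)))" for x
  have H: "grad q (\<Phi> x) = H x" if "x \<in> box 0 1" for x
    using mapped_grad[OF that] cramer[of "transpose (J x)" "grad q (\<Phi> x)" "grad p x"] det_J[of x] that box_cbox(1)
    by (auto simp: H_def det_transpose)
  have "continuous_on (cbox 0 1) (\<lambda>x. if j = k then grad p x $ i else transpose (J x) $ i $ j)" for i j k
  proof (cases "j = k")
    case True
    have "continuous_on (cbox 0 1) (grad p)"
      using p by (auto simp: C1_def elim: continuous_on_subset)
    then show ?thesis
      using True by (auto intro!: continuous_intros)
  qed (simp add: transpose_def continuous_J)
  then have "continuous_on (cbox 0 1) (\<lambda>x. det (\<chi> i j. if j = k then grad p x $ i else transpose (J x) $ i $ j))" for k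
    by (intro continuous_on_det) simp
  moreover have "continuous_on (cbox 0 1) (\<lambda>x. det (transpose (J x)))"
    by (intro continuous_on_det) (simp add: transpose_def continuous_J)
  ultimately have "continuous_on (cbox 0 1) H"
    unfolding H_def using det_J
    by (intro continuous_on_vec_lambda continuous_on_divide) (auto simp: det_transpose)
  then have "continuous_on (closure K) (\<lambda>y. H (\<Psi> y))"
    by (rule continuous_on_compose2[OF _ continuous_\<Psi> \<Psi>_closure])
  then show ?thesis
    by (rule cont_closureI) (use H \<Psi>_map box_cbox(1) in \<open>auto simp: K_def subset_iff\<close>)
qed

end

lemma map_lipschitz: "\<exists>L. L-lipschitz_on (cbox 0 1) \<Phi>"
proof -
  obtain B where B: "\<And>x i j. x \<in> cbox 0 1 \<Longrightarrow> \<bar>J x $ i $ j\<bar> \<le> B"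
  proof -
    have "\<exists>B. \<forall>x\<in>cbox 0 1. \<bar>J x $ i $ j\<bar> \<le> B" for i j
    proof -
      have "bounded ((\<lambda>x. J x $ i $ j) ` cbox 0 1)"
        by (intro compact_imp_bounded compact_continuous_image continuous_J compact_cbox)
      then show ?thesis
        by (auto simp: bounded_iff)
    qed
    then obtain b where b: "\<And>i j x. x \<in> cbox 0 1 \<Longrightarrow> \<bar>J x $ i $ j\<bar> \<le> b i j"
      by metis
    have "\<bar>J x $ i $ j\<bar> \<le> Max (range (\<lambda>(i, j). b i j))" if "x \<in> cbox 0 1" for x i j
      using b[OF that, of i j] by (rule order_trans) (rule Max_ge, auto)
    then show ?thesis
      using that by blast
  qed
  have "onorm (\<lambda>h. J x *v h) \<le> real CARD('n) * real CARD('n) * B" if "x \<in> cbox 0 1" for x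
    by (rule onorm_le_matrix_component) (rule B[OF that])
  moreover have "B \<ge> 0"
    using B[of 0 undefined undefined] by (auto simp: mem_box_cart)
  ultimately have "(real CARD('n) * real CARD('n) * B)-lipschitz_on (cbox 0 1) \<Phi>"
    using has_derivative_map
    by (intro bounded_derivative_imp_lipschitz[where f'="\<lambda>x h. J x *v h"]) (auto intro: has_derivative_at_withinI)
  then show ?thesis
    by blast
qed

text \<open>With \<open>c\<close> a lower bound for \<open>J x0\<close>, the map differs from this
  linear one near \<open>x0\<close> by a map of Lipschitz constant \<open>c / 2\<close>; hence
  \<open>L = 2 / c\<close>. The ball may leave the unit cube, as the polynomial map is defined
  everywhere.\<close>

lemma local_inverse_lipschitz:
  assumes x0: "x0 \<in> cbox 0 1"
  obtains \<delta> L where "\<delta> > 0" "L > 0"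
    "\<And>x y. x \<in> ball x0 \<delta> \<Longrightarrow> y \<in> ball x0 \<delta> \<Longrightarrow> norm (x - y) \<le> L * norm (\<Phi> x - \<Phi> y)"
proof -
  have "invertible (J x0)"
    using det_J[OF x0] by (simp add: invertible_det_nz)
  then have "inj ((*v) (J x0))"
    by (metis inj_matrix_vector_mult)
  then obtain c where c: "c > 0" "\<And>h. c * norm h \<le> norm (J x0 *v h)"
    using linear_inj_bounded_below_pos[of "(*v) (J x0)"] matrix_vector_mul_linear by blast
  have "continuous_on UNIV (\<lambda>x. \<Sum>i\<in>UNIV. \<Sum>j\<in>UNIV. \<bar>(J x - J x0) $ i $ j\<bar>)" (is "continuous_on UNIV ?e")
    by (auto intro!: continuous_intros continuous_J)
  then have "isCont ?e x0"
    by (simp add: continuous_on_eq_continuous_at)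
  then obtain \<delta> where \<delta>: "\<delta> > 0" "\<And>x. dist x x0 < \<delta> \<Longrightarrow> dist (?e x) (?e x0) < c / 2"
    using c(1) unfolding continuous_at_eps_delta by (meson half_gt_zero)
  have e: "?e x < c / 2" if "x \<in> ball x0 \<delta>" for x
    using \<delta>(2)[of x] that by (simp add: dist_commute dist_real_def sum_nonneg)
  have bound: "norm ((\<Phi> x - J x0 *v x) - (\<Phi> y - J x0 *v y)) \<le> c / 2 * norm (x - y)"
    if "x \<in> ball x0 \<delta>" "y \<in> ball x0 \<delta>" for x y
  proof (rule differentiable_bound[OF convex_ball _ _ that])
    fix z assume z: "z \<in> ball x0 \<delta>"
    have "((\<lambda>z. \<Phi> z - J x0 *v z) has_derivative (\<lambda>h. J z *v h - J x0 *v h)) (at z)"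
      by (intro has_derivative_diff has_derivative_map matrix_vector_mul_bounded_linear[THEN bounded_linear_imp_has_derivative])
    then show "((\<lambda>z. \<Phi> z - J x0 *v z) has_derivative (\<lambda>h. (J z - J x0) *v h)) (at z within ball x0 \<delta>)"
      by (simp add: matrix_vector_mult_diff_rdistrib has_derivative_at_withinI)
    show "onorm (\<lambda>h. (J z - J x0) *v h) \<le> c / 2"
      using onorm_le_matrix_component_sum[of "J z - J x0"] e[OF z] by linarith
  qed
  have "norm (x - y) \<le> 2 / c * norm (\<Phi> x - \<Phi> y)" if "x \<in> ball x0 \<delta>" "y \<in> ball x0 \<delta>" for x y
  proof -
    have "c * norm (x - y) \<le> norm (J x0 *v (x - y))"
      by (rule c(2))
    also have "J x0 *v (x - y) = (\<Phi> x - \<Phi> y) - ((\<Phi> x - J x0 *v x) - (\<Phi> y - J x0 *v y))"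
      by (simp add: matrix_vector_mult_diff_distrib)
    also have "norm \<dots> \<le> norm (\<Phi> x - \<Phi> y) + c / 2 * norm (x - y)"
      using bound[OF that] norm_triangle_ineq4 order_trans add_left_mono by (smt (verit))
    finally show ?thesis
      using c(1) by (simp add: field_simps)
  qed
  then show ?thesis
    using that[OF \<delta>(1), of "2 / c"] c(1) by simp
qed

end

section \<open>Square integrable functions\<close>

lemma L2_on_iff:
  "L2_on \<mu> S f \<longleftrightarrow> (\<lambda>x. indicator S x *\<^sub>R f x) \<in> borel_measurable \<mu> \<and>
    integrable \<mu> (\<lambda>x. (norm (indicator S x *\<^sub>R f x))\<^sup>2)"
proof -
  have "(norm (indicator S x *\<^sub>R f x))\<^sup>2 = indicator S x *\<^sub>R (norm (f x))\<^sup>2" for x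
    by (simp add: indicator_def)
  then show ?thesis
    by (simp add: L2_on_def set_borel_measurable_def set_integrable_def)
qed

lemma L2_on_lincomb:
  assumes "L2_on \<mu> S f" "L2_on \<mu> S g"
  shows "L2_on \<mu> S (\<lambda>x. a *\<^sub>R f x + b *\<^sub>R g x)"
proof -
  let ?f = "\<lambda>x. indicator S x *\<^sub>R f x" and ?g = "\<lambda>x. indicator S x *\<^sub>R g x"
  have m: "?f \<in> borel_measurable \<mu>" "?g \<in> borel_measurable \<mu>"
    and i: "integrable \<mu> (\<lambda>x. (norm (?f x))\<^sup>2)" "integrable \<mu> (\<lambda>x. (norm (?g x))\<^sup>2)"
    using assms by (auto simp: L2_on_iff)
  have eq: "indicator S x *\<^sub>R (a *\<^sub>R f x + b *\<^sub>R g x) = a *\<^sub>R ?f x + b *\<^sub>R ?g x" for x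
    by (simp add: scaleR_add_right mult.commute)
  have "integrable \<mu> (\<lambda>x. (norm (a *\<^sub>R ?f x + b *\<^sub>R ?g x))\<^sup>2)"
  proof (rule Bochner_Integration.integrable_bound)
    show "integrable \<mu> (\<lambda>x. 2 * a\<^sup>2 * (norm (?f x))\<^sup>2 + 2 * b\<^sup>2 * (norm (?g x))\<^sup>2)"
      using i by (intro Bochner_Integration.integrable_add Bochner_Integration.integrable_mult_right)
    have "norm ((norm (a *\<^sub>R ?f x + b *\<^sub>R ?g x))\<^sup>2) \<le> norm (2 * a\<^sup>2 * (norm (?f x))\<^sup>2 + 2 * b\<^sup>2 * (norm (?g x))\<^sup>2)" for x
    proof -
      let ?x = "a *\<^sub>R ?f x" and ?y = "b *\<^sub>R ?g x"
      have "(norm (?x + ?y))\<^sup>2 \<le> (norm ?x + norm ?y)\<^sup>2"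
        by (intro power_mono norm_triangle_ineq norm_ge_zero)
      also have "\<dots> \<le> 2 * (norm ?x)\<^sup>2 + 2 * (norm ?y)\<^sup>2"
        using sum_squares_bound[of "norm ?x" "norm ?y"] by (simp add: power2_sum)
      also have "\<dots> = 2 * a\<^sup>2 * (norm (?f x))\<^sup>2 + 2 * b\<^sup>2 * (norm (?g x))\<^sup>2"
        by (simp only: norm_scaleR power_mult_distrib power2_abs mult.assoc)
      finally show ?thesis
        by simp
    qed
    then show "AE x in \<mu>. norm ((norm (a *\<^sub>R ?f x + b *\<^sub>R ?g x))\<^sup>2) \<le> norm (2 * a\<^sup>2 * (norm (?f x))\<^sup>2 + 2 * b\<^sup>2 * (norm (?g x))\<^sup>2)"
      by simp
  qed (use m in measurable)
  moreover have "(\<lambda>x. a *\<^sub>R ?f x + b *\<^sub>R ?g x) \<in> borel_measurable \<mu>"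
    using m by measurable
  ultimately show ?thesis
    unfolding L2_on_iff eq by (rule conjI[rotated])
qed

lemma L2_on_zero: "L2_on \<mu> S (\<lambda>x. 0)"
  by (simp add: L2_on_iff)

lemma L2_on_integrable_inner:
  assumes "L2_on \<mu> S f" "L2_on \<mu> S g"
  shows "set_integrable \<mu> S (\<lambda>x. f x \<bullet> g x)"
proof -
  let ?f = "\<lambda>x. indicator S x *\<^sub>R f x" and ?g = "\<lambda>x. indicator S x *\<^sub>R g x"
  have m: "?f \<in> borel_measurable \<mu>" "?g \<in> borel_measurable \<mu>"
    and i: "integrable \<mu> (\<lambda>x. (norm (?f x))\<^sup>2)" "integrable \<mu> (\<lambda>x. (norm (?g x))\<^sup>2)"
    using assms by (auto simp: L2_on_iff)
  have eq: "(\<lambda>x. indicator S x *\<^sub>R (f x \<bullet> g x)) = (\<lambda>x. ?f x \<bullet> ?g x)"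
    by (auto simp: indicator_def fun_eq_iff)
  have "integrable \<mu> (\<lambda>x. ?f x \<bullet> ?g x)"
  proof (rule Bochner_Integration.integrable_bound[OF Bochner_Integration.integrable_add[OF i]])
    have "norm (?f x \<bullet> ?g x) \<le> norm ((norm (?f x))\<^sup>2 + (norm (?g x))\<^sup>2)" for x
    proof -
      have "\<bar>?f x \<bullet> ?g x\<bar> \<le> norm (?f x) * norm (?g x)"
        by (rule Cauchy_Schwarz_ineq2)
      also have "\<dots> \<le> (norm (?f x))\<^sup>2 + (norm (?g x))\<^sup>2"
        using sum_squares_bound[of "norm (?f x)" "norm (?g x)"]
          mult_nonneg_nonneg[OF norm_ge_zero[of "?f x"] norm_ge_zero[of "?g x"]] by linarith
      finally show ?thesis
        by simp
    qed
    then show "AE x in \<mu>. norm (?f x \<bullet> ?g x) \<le> norm ((norm (?f x))\<^sup>2 + (norm (?g x))\<^sup>2)"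
      by simp
  qed (use m in measurable)
  then show ?thesis
    unfolding set_integrable_def eq .
qed

lemma L2_on_subset:
  assumes "L2_on \<mu> S f" "T \<subseteq> S" "T \<in> sets \<mu>"
  shows "L2_on \<mu> T f"
  using set_integrable_subset[of \<mu> S _ T] set_borel_measurable_subset[of \<mu> S f T] assms
  by (auto simp: L2_on_def)

lemma L2_on_dominated:
  assumes f: "L2_on \<mu> S f" and m: "(\<lambda>x. indicator S x *\<^sub>R g x) \<in> borel_measurable \<mu>"
    and le: "\<And>x. x \<in> S \<Longrightarrow> norm (g x) \<le> B * norm (f x)"
  shows "L2_on \<mu> S g"
proof -
  let ?f = "\<lambda>x. indicator S x *\<^sub>R f x" and ?g = "\<lambda>x. indicator S x *\<^sub>R g x"
  have i: "integrable \<mu> (\<lambda>x. B\<^sup>2 * (norm (?f x))\<^sup>2)"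
    using f by (intro Bochner_Integration.integrable_mult_right) (auto simp: L2_on_iff)
  have "norm ((norm (?g x))\<^sup>2) \<le> norm (B\<^sup>2 * (norm (?f x))\<^sup>2)" for x
  proof (cases "x \<in> S")
    case True
    have "(norm (g x))\<^sup>2 \<le> (B * norm (f x))\<^sup>2"
      using le[OF True] by (intro power_mono) auto
    then show ?thesis
      using True by (simp add: power_mult_distrib)
  qed simp
  moreover have "(\<lambda>x. (norm (?g x))\<^sup>2) \<in> borel_measurable \<mu>"
    using m by (intro borel_measurable_power) (rule measurable_compose[OF _ borel_measurable_norm])
  ultimately have "integrable \<mu> (\<lambda>x. (norm (?g x))\<^sup>2)"
    by (intro Bochner_Integration.integrable_bound[OF i] AE_I2)
  then show ?thesis
    using m by (simp add: L2_on_iff)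
qed

lemma L2_on_bounded:
  assumes S: "S \<in> sets \<mu>" "emeasure \<mu> S < \<infinity>" and m: "(\<lambda>x. indicator S x *\<^sub>R g x) \<in> borel_measurable \<mu>"
    and B: "bounded (g ` S)"
  shows "L2_on \<mu> S g"
proof -
  obtain b where b: "\<And>x. x \<in> S \<Longrightarrow> norm (g x) \<le> b"
    using B by (auto simp: bounded_iff)
  have "L2_on \<mu> S (\<lambda>x. 1 :: real)"
  proof -
    have "(norm (indicator S x *\<^sub>R (1::real)))\<^sup>2 = indicat_real S x" for x
      by (simp add: indicator_def)
    then show ?thesis
      unfolding L2_on_iff using S by (simp add: integrable_real_indicator borel_measurable_indicator)
  qed
  then show ?thesis
    using m by (rule L2_on_dominated[where B=b]) (use b in auto)
qed

text \<open>Common form of the volume and the surface inner product.\<close>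

definition l2_ip :: "'a measure \<Rightarrow> 'a set \<Rightarrow> ('a \<Rightarrow> 'b::euclidean_space) \<Rightarrow> ('a \<Rightarrow> 'b) \<Rightarrow> real" where
  "l2_ip \<mu> S f g = (LINT x:S|\<mu>. f x \<bullet> g x)"

lemma ip_l2_ip: "ip = l2_ip lebesgue"
  and surface_ip_l2_ip: "surface_ip = l2_ip surface_measure"
  by (auto simp: ip_def surface_ip_def l2_ip_def fun_eq_iff)

lemma l2_ip_commute: "l2_ip \<mu> S f g = l2_ip \<mu> S g f"
  by (simp add: l2_ip_def inner_commute)

lemma l2_ip_cong:
  assumes "\<And>x. x \<in> S \<Longrightarrow> f x \<bullet> g x = f' x \<bullet> g' x"
  shows "l2_ip \<mu> S f g = l2_ip \<mu> S f' g'"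
proof -
  have eq: "indicator S x *\<^sub>R (f x \<bullet> g x) = indicator S x *\<^sub>R (f' x \<bullet> g' x)" for x
    using assms by (cases "x \<in> S") auto
  show ?thesis
    by (simp only: l2_ip_def set_lebesgue_integral_def eq)
qed

lemma l2_ip_lincomb_left:
  assumes "L2_on \<mu> S f" "L2_on \<mu> S g" "L2_on \<mu> S h"
  shows "l2_ip \<mu> S (\<lambda>x. a *\<^sub>R f x + b *\<^sub>R g x) h = a * l2_ip \<mu> S f h + b * l2_ip \<mu> S g h"
proof -
  have "set_integrable \<mu> S (\<lambda>x. a * (f x \<bullet> h x))" "set_integrable \<mu> S (\<lambda>x. b * (g x \<bullet> h x))"
    by (intro set_integrable_mult_right L2_on_integrable_inner assms)+
  from set_integral_add(2)[OF this] show ?thesis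
    by (simp add: l2_ip_def inner_add_left)
qed

lemma l2_ip_lincomb_right:
  assumes "L2_on \<mu> S f" "L2_on \<mu> S g" "L2_on \<mu> S h"
  shows "l2_ip \<mu> S h (\<lambda>x. a *\<^sub>R f x + b *\<^sub>R g x) = a * l2_ip \<mu> S h f + b * l2_ip \<mu> S h g"
  using l2_ip_lincomb_left[OF assms] by (simp add: l2_ip_commute[of \<mu> S h])

lemma l2_ip_nonneg: "l2_ip \<mu> S f f \<ge> 0"
  unfolding l2_ip_def set_lebesgue_integral_def by (intro Bochner_Integration.integral_nonneg) simp

text \<open>Expands the nonnegative square norm of \<open>\<theta> *\<^sub>R f - g\<close>.\<close>

lemma l2_ip_young:
  assumes "L2_on \<mu> S f" "L2_on \<mu> S g" "\<theta> > 0"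
  shows "2 * l2_ip \<mu> S f g \<le> \<theta> * l2_ip \<mu> S f f + 1 / \<theta> * l2_ip \<mu> S g g"
proof -
  let ?h = "\<lambda>x. \<theta> *\<^sub>R f x + (-1) *\<^sub>R g x"
  have h: "L2_on \<mu> S ?h"
    by (rule L2_on_lincomb[OF assms(1,2)])
  have "0 \<le> l2_ip \<mu> S ?h ?h"
    by (rule l2_ip_nonneg)
  also have "l2_ip \<mu> S ?h ?h = \<theta> * l2_ip \<mu> S f ?h + (-1) * l2_ip \<mu> S g ?h"
    by (rule l2_ip_lincomb_left[OF assms(1,2) h])
  also have "l2_ip \<mu> S f ?h = \<theta> * l2_ip \<mu> S f f + (-1) * l2_ip \<mu> S f g"
    by (rule l2_ip_lincomb_right[OF assms(1,2,1)])
  also have "l2_ip \<mu> S g ?h = \<theta> * l2_ip \<mu> S g f + (-1) * l2_ip \<mu> S g g"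
    by (rule l2_ip_lincomb_right[OF assms(1,2,2)])
  also have "l2_ip \<mu> S g f = l2_ip \<mu> S f g"
    by (rule l2_ip_commute)
  finally have "\<theta> * (2 * l2_ip \<mu> S f g) \<le> \<theta> * (\<theta> * l2_ip \<mu> S f f + 1 / \<theta> * l2_ip \<mu> S g g)"
    using assms(3) by (simp add: algebra_simps)
  then show ?thesis
    using assms(3) by simp
qed

lemma l2_ip_zero_left: "(\<And>x. x \<in> S \<Longrightarrow> f x = 0) \<Longrightarrow> l2_ip \<mu> S f g = 0"
  using l2_ip_cong[of S f g "\<lambda>x. 0" g \<mu>] by (simp add: l2_ip_def)

text \<open>The set where \<open>f\<close> is nonzero is open by continuity and null by the
  integral, hence empty.\<close>

lemma l2_ip_self_zero:
  fixes f :: "'a::euclidean_space \<Rightarrow> 'b::euclidean_space"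
  assumes K: "open K" and f: "continuous_on K f" "L2_on lebesgue K f" and 0: "l2_ip lebesgue K f f = 0"
    and x: "x \<in> K"
  shows "f x = 0"
proof (rule ccontr)
  assume ne: "f x \<noteq> 0"
  have "AE x in lebesgue. indicator K x *\<^sub>R (f x \<bullet> f x) = 0"
    using 0 L2_on_integrable_inner[OF f(2,2)] unfolding l2_ip_def set_lebesgue_integral_def set_integrable_def
    by (subst (asm) integral_nonneg_eq_0_iff_AE) auto
  then have AE: "AE x in lebesgue. x \<notin> K \<inter> f -` (- {0})"
    by eventually_elim (auto simp: indicator_def split: if_splits)
  have op: "open (K \<inter> f -` (- {0}))"
    using f(1) K by (intro continuous_open_preimage) auto
  then have "K \<inter> f -` (- {0}) \<in> null_sets lebesgue"
    using AE by (subst AE_iff_null_sets) auto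
  then have "negligible (K \<inter> f -` (- {0}))"
    by (simp add: negligible_iff_null_sets)
  then show False
    using open_not_negligible[OF op] x ne by blast
qed

text \<open>Boundedness instead of square integrability makes the class stable under products with
  the normal; finite area then gives membership in L2.\<close>

definition bmeas :: "'a::euclidean_space set \<Rightarrow> ('a \<Rightarrow> 'b::euclidean_space) \<Rightarrow> bool" where
  "bmeas F f \<longleftrightarrow> (\<lambda>x. indicator F x *\<^sub>R f x) \<in> borel_measurable borel \<and> bounded (f ` F)"

lemma bmeas_continuous:
  assumes "compact F" "continuous_on F f"
  shows "bmeas F f"
  unfolding bmeas_def
  using assms by (auto intro!: borel_measurable_continuous_on_indicator compact_imp_bounded
      compact_continuous_image borel_compact)

lemma bmeas_measurable:
  assumes "F \<in> sets borel" "f \<in> borel_measurable borel" "\<And>x. x \<in> F \<Longrightarrow> norm (f x) \<le> B"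
  shows "bmeas F f"
  unfolding bmeas_def using assms by (auto simp: bounded_iff intro!: borel_measurable_scaleR borel_measurable_indicator)

lemma bmeas_compose2:
  assumes F: "F \<in> sets borel" and f: "bmeas F f" and g: "bmeas F g"
    and H: "continuous_on UNIV (\<lambda>z. H (fst z) (snd z))"
  shows "bmeas F (\<lambda>x. H (f x) (g x))"
  unfolding bmeas_def
proof
  let ?f = "\<lambda>x. indicator F x *\<^sub>R f x" and ?g = "\<lambda>x. indicator F x *\<^sub>R g x"
  have "(\<lambda>x. H (?f x) (?g x)) \<in> borel_measurable borel"
    using f g by (intro borel_measurable_continuous_Pair[OF _ _ H]) (auto simp: bmeas_def)
  then have "(\<lambda>x. indicator F x *\<^sub>R H (?f x) (?g x)) \<in> borel_measurable borel"
    using F by (intro borel_measurable_scaleR borel_measurable_indicator)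
  moreover have "(\<lambda>x. indicator F x *\<^sub>R H (?f x) (?g x)) = (\<lambda>x. indicator F x *\<^sub>R H (f x) (g x))"
    by (auto simp: indicator_def)
  ultimately show "(\<lambda>x. indicator F x *\<^sub>R H (f x) (g x)) \<in> borel_measurable borel"
    by simp
  have "compact (closure (f ` F) \<times> closure (g ` F))"
    using f g by (intro compact_Times) (auto simp: bmeas_def)
  then have "bounded ((\<lambda>z. H (fst z) (snd z)) ` (closure (f ` F) \<times> closure (g ` F)))"
    by (intro compact_imp_bounded compact_continuous_image continuous_on_subset[OF H]) auto
  then show "bounded ((\<lambda>x. H (f x) (g x)) ` F)"
    by (rule bounded_subset) (use closure_subset[of "f ` F"] closure_subset[of "g ` F"] in force)
qed

lemma bmeas_L2_on:
  assumes "F \<in> sets borel" "surface_area F < \<infinity>" "bmeas F f"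
  shows "L2_on surface_measure F f"
  using assms emeasure_surface_measure_le[of F]
  by (intro L2_on_bounded) (auto simp: bmeas_def intro: le_less_trans)

lemma cont_closure_L2_on:
  fixes f :: "'a::euclidean_space \<Rightarrow> 'b::euclidean_space"
  assumes K: "open K" "bounded K" and f: "cont_closure K f"
  shows "L2_on lebesgue K f"
proof (rule L2_on_bounded)
  obtain g where g: "continuous_on (closure K) g" "\<And>x. x \<in> K \<Longrightarrow> f x = g x"
    using f by (auto simp: cont_closure_def)
  have "continuous_on K f"
    using g closure_subset[of K] continuous_on_cong[of K K f g] continuous_on_subset by metis
  then have "(\<lambda>x. indicator K x *\<^sub>R f x) \<in> borel_measurable borel"
    using K by (intro borel_measurable_continuous_on_indicator) auto
  then show "(\<lambda>x. indicator K x *\<^sub>R f x) \<in> borel_measurable lebesgue"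
    by (simp add: measurable_completion)
  show "K \<in> sets lebesgue"
    using K by simp
  show "emeasure lebesgue K < \<infinity>"
    using emeasure_bounded_finite[OF K(2)] K by simp
  have "bounded (g ` closure K)"
    using g K by (intro compact_imp_bounded compact_continuous_image) auto
  then show "bounded (f ` K)"
    by (rule bounded_subset) (use g(2) closure_subset in force)
qed

section \<open>Forms built from operators into L2\<close>

text \<open>Linearity is pointwise and only on \<open>S\<close>, so traces and derivatives qualify,
  which are linear just on the face or cell in question.\<close>

definition l2_op :: "'a measure \<Rightarrow> 'a set \<Rightarrow> 'v::real_vector set \<Rightarrow> ('v \<Rightarrow> 'a \<Rightarrow> 'b::euclidean_space) \<Rightarrow> bool" where
  "l2_op \<mu> S V T \<longleftrightarrow> (\<forall>v\<in>V. L2_on \<mu> S (T v)) \<and>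
     (\<forall>v\<in>V. \<forall>w\<in>V. \<forall>a b. \<forall>x\<in>S. T (a *\<^sub>R v + b *\<^sub>R w) x = a *\<^sub>R T v x + b *\<^sub>R T w x)"

lemma l2_op_L2: "l2_op \<mu> S V T \<Longrightarrow> v \<in> V \<Longrightarrow> L2_on \<mu> S (T v)"
  by (simp add: l2_op_def)

lemma lin_on_l2_ip:
  assumes "l2_op \<mu> S V T" "L2_on \<mu> S f"
  shows "lin_on V (\<lambda>v. l2_ip \<mu> S (T v) f)" "lin_on V (\<lambda>v. l2_ip \<mu> S f (T v))"
proof -
  show "lin_on V (\<lambda>v. l2_ip \<mu> S (T v) f)"
  proof (rule lin_onI)
    fix v w a b assume vw: "v \<in> V" "w \<in> V"
    have "l2_ip \<mu> S (T (a *\<^sub>R v + b *\<^sub>R w)) f = l2_ip \<mu> S (\<lambda>x. a *\<^sub>R T v x + b *\<^sub>R T w x) f"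
      using assms(1) vw by (intro l2_ip_cong) (simp add: l2_op_def)
    also have "\<dots> = a * l2_ip \<mu> S (T v) f + b * l2_ip \<mu> S (T w) f"
      using assms vw by (intro l2_ip_lincomb_left) (auto simp: l2_op_def)
    finally show "l2_ip \<mu> S (T (a *\<^sub>R v + b *\<^sub>R w)) f = a *\<^sub>R l2_ip \<mu> S (T v) f + b *\<^sub>R l2_ip \<mu> S (T w) f"
      by simp
  qed
  then show "lin_on V (\<lambda>v. l2_ip \<mu> S f (T v))"
    by (simp add: l2_ip_commute[of \<mu> S f])
qed

lemma bilin_on_l2_ip:
  assumes "l2_op \<mu> S V T" "l2_op \<mu> S W U"
  shows "bilin_on V W (\<lambda>v w. l2_ip \<mu> S (T v) (U w))"
  unfolding bilin_on_def
  by (intro conjI ballI lin_on_l2_ip(1)[OF assms(1)] lin_on_l2_ip(2)[OF assms(2)]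
      l2_op_L2[OF assms(1)] l2_op_L2[OF assms(2)])

lemma bilin_on_plus: "bilin_on V W f \<Longrightarrow> bilin_on V W g \<Longrightarrow> bilin_on V W (\<lambda>v w. f v w + g v w)"
  and bilin_on_minus: "bilin_on V W f \<Longrightarrow> bilin_on V W g \<Longrightarrow> bilin_on V W (\<lambda>v w. f v w - g v w)"
  and bilin_on_mult: "bilin_on V W f \<Longrightarrow> bilin_on V W (\<lambda>v w. c * f v w)"
  and bilin_on_setsum: "(\<And>i. i \<in> A \<Longrightarrow> bilin_on V W (h i)) \<Longrightarrow> bilin_on V W (\<lambda>v w. \<Sum>i\<in>A. h i v w)"
  by (auto simp: bilin_on_def intro!: lin_on_plus lin_on_minus lin_on_mult lin_on_setsum)

lemma bilin_on_cong:
  assumes "subspace V" "subspace W" "\<And>v w. v \<in> V \<Longrightarrow> w \<in> W \<Longrightarrow> f v w = g v w" "bilin_on V W g"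
  shows "bilin_on V W f"
  using assms unfolding bilin_on_def lin_on_def
  by (simp add: subspace_add subspace_scale)

lemma psd_form_sum:
  assumes "\<And>i. i \<in> A \<Longrightarrow> psd_form V (h i)" "\<And>i. i \<in> A \<Longrightarrow> c i \<ge> 0"
  shows "psd_form V (\<lambda>v w. \<Sum>i\<in>A. c i * h i v w)"
  using assms unfolding psd_form_def
  by (auto intro!: bilin_on_setsum bilin_on_mult sum.cong sum_nonneg mult_nonneg_nonneg)

lemma psd_form_l2_ip: "l2_op \<mu> S V T \<Longrightarrow> psd_form V (\<lambda>v w. l2_ip \<mu> S (T v) (T w))"
  unfolding psd_form_def using bilin_on_l2_ip l2_ip_commute l2_ip_nonneg by blast

text \<open>Here \<open>T\<close> is the flux and \<open>U\<close> the trace or jump. Domination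
  gives \<open>N v v \<le> C * E v v\<close>, and the inequality of Young with weight
  \<open>\<theta> * h F\<close> splits each mixed term into a part absorbed by \<open>E\<close> and
  one absorbed by the penalty.\<close>

lemma nitsche_form_psd:
  fixes E :: "'v::real_vector \<Rightarrow> 'v \<Rightarrow> real" and T U :: "'f \<Rightarrow> 'v \<Rightarrow> 'a \<Rightarrow> 'b::euclidean_space"
  assumes V: "fin_dim V" and E: "psd_form V E"
    and T: "\<And>F. F \<in> Fs \<Longrightarrow> l2_op \<mu> (S F) V (T F)" and U: "\<And>F. F \<in> Fs \<Longrightarrow> l2_op \<mu> (S F) V (U F)"
    and h: "\<And>F. F \<in> Fs \<Longrightarrow> h F > 0"
    and ker: "\<And>v F x. v \<in> V \<Longrightarrow> E v v = 0 \<Longrightarrow> F \<in> Fs \<Longrightarrow> x \<in> S F \<Longrightarrow> T F v x = 0"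
  shows "\<exists>\<gamma>0. \<forall>\<gamma>>\<gamma>0. psd_form V (\<lambda>v w. E v w
      - (\<Sum>F\<in>Fs. l2_ip \<mu> (S F) (T F v) (U F w) + l2_ip \<mu> (S F) (U F v) (T F w))
      + (\<Sum>F\<in>Fs. \<gamma> / h F * l2_ip \<mu> (S F) (U F v) (U F w)))"
proof -
  \<comment> \<open>The weights \<open>h F\<close> are dual to the factors \<open>1 / h F\<close> of
    the penalty.\<close>
  define N where "N v w = (\<Sum>F\<in>Fs. h F * l2_ip \<mu> (S F) (T F v) (T F w))" for v w
  have N: "psd_form V N"
    unfolding N_def using T h by (intro psd_form_sum psd_form_l2_ip) (auto intro: less_imp_le)
  have "N v v = 0" if "v \<in> V" "E v v = 0" for v
    unfolding N_def using ker[OF that] by (intro sum.neutral) (auto intro!: l2_ip_zero_left)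
  then obtain C where C: "C \<ge> 0" "\<And>v. v \<in> V \<Longrightarrow> N v v \<le> C * E v v"
    using psd_form_dominated[OF E N V] by blast
  have "psd_form V (\<lambda>v w. E v w
      - (\<Sum>F\<in>Fs. l2_ip \<mu> (S F) (T F v) (U F w) + l2_ip \<mu> (S F) (U F v) (T F w))
      + (\<Sum>F\<in>Fs. \<gamma> / h F * l2_ip \<mu> (S F) (U F v) (U F w)))" if \<gamma>: "\<gamma> > C + 1" for \<gamma>
    unfolding psd_form_def
  proof (intro conjI ballI)
    show "bilin_on V V (\<lambda>v w. E v w
      - (\<Sum>F\<in>Fs. l2_ip \<mu> (S F) (T F v) (U F w) + l2_ip \<mu> (S F) (U F v) (T F w))
      + (\<Sum>F\<in>Fs. \<gamma> / h F * l2_ip \<mu> (S F) (U F v) (U F w)))"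
      using T U psd_formD(1)[OF E]
      by (intro bilin_on_plus bilin_on_minus bilin_on_setsum bilin_on_mult bilin_on_l2_ip)
  next
    fix v w assume "v \<in> V" "w \<in> V"
    then show "E v w - (\<Sum>F\<in>Fs. l2_ip \<mu> (S F) (T F v) (U F w) + l2_ip \<mu> (S F) (U F v) (T F w))
      + (\<Sum>F\<in>Fs. \<gamma> / h F * l2_ip \<mu> (S F) (U F v) (U F w)) =
      E w v - (\<Sum>F\<in>Fs. l2_ip \<mu> (S F) (T F w) (U F v) + l2_ip \<mu> (S F) (U F w) (T F v))
      + (\<Sum>F\<in>Fs. \<gamma> / h F * l2_ip \<mu> (S F) (U F w) (U F v))"
      using psd_formD(2)[OF E, of v w]
      by (simp add: l2_ip_commute[of \<mu> _ "T _ w"] l2_ip_commute[of \<mu> _ "U _ w"] add.commute)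
  next
    fix v assume v: "v \<in> V"
    \<comment> \<open>Chosen so that \<open>\<theta> * N v v \<le> E v v\<close> while
      \<open>1 / \<theta>\<close> stays below \<gamma>; the summand 1 keeps \<theta> defined for
      \<open>C = 0\<close>.\<close>
    define \<theta> where "\<theta> = 1 / (C + 1)"
    have \<theta>: "\<theta> > 0" "\<theta> * C \<le> 1" "1 / \<theta> = C + 1"
      using C(1) by (auto simp: \<theta>_def field_simps)
    have "(\<Sum>F\<in>Fs. l2_ip \<mu> (S F) (T F v) (U F v) + l2_ip \<mu> (S F) (U F v) (T F v)) \<le>
      (\<Sum>F\<in>Fs. \<theta> * (h F * l2_ip \<mu> (S F) (T F v) (T F v)) + \<gamma> / h F * l2_ip \<mu> (S F) (U F v) (U F v))"
    proof (rule sum_mono)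
      fix F assume F: "F \<in> Fs"
      have "2 * l2_ip \<mu> (S F) (T F v) (U F v) \<le> (\<theta> * h F) * l2_ip \<mu> (S F) (T F v) (T F v)
        + 1 / (\<theta> * h F) * l2_ip \<mu> (S F) (U F v) (U F v)"
        using T[OF F] U[OF F] v \<theta>(1) h[OF F] by (intro l2_ip_young) (auto simp: l2_op_def)
      moreover have "1 / (\<theta> * h F) = (C + 1) / h F"
        using \<theta>(3) by (simp flip: divide_divide_eq_left)
      moreover have "(C + 1) / h F * l2_ip \<mu> (S F) (U F v) (U F v) \<le> \<gamma> / h F * l2_ip \<mu> (S F) (U F v) (U F v)"
        using \<gamma> h[OF F] by (intro mult_right_mono l2_ip_nonneg divide_right_mono) auto
      moreover have "l2_ip \<mu> (S F) (U F v) (T F v) = l2_ip \<mu> (S F) (T F v) (U F v)"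
        by (rule l2_ip_commute)
      ultimately show "l2_ip \<mu> (S F) (T F v) (U F v) + l2_ip \<mu> (S F) (U F v) (T F v) \<le>
        \<theta> * (h F * l2_ip \<mu> (S F) (T F v) (T F v)) + \<gamma> / h F * l2_ip \<mu> (S F) (U F v) (U F v)"
        by (simp add: mult.assoc)
    qed
    also have "\<dots> = \<theta> * N v v + (\<Sum>F\<in>Fs. \<gamma> / h F * l2_ip \<mu> (S F) (U F v) (U F v))"
      unfolding N_def sum.distrib sum_distrib_left ..
    also have "\<theta> * N v v \<le> \<theta> * (C * E v v)"
      using C(2)[OF v] \<theta>(1) by (intro mult_left_mono) auto
    also have "\<theta> * (C * E v v) \<le> 1 * E v v"
      unfolding mult.assoc[symmetric] using \<theta>(2) psd_formD(3)[OF E v] by (intro mult_right_mono)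
    finally show "0 \<le> E v v - (\<Sum>F\<in>Fs. l2_ip \<mu> (S F) (T F v) (U F v) + l2_ip \<mu> (S F) (U F v) (T F v))
      + (\<Sum>F\<in>Fs. \<gamma> / h F * l2_ip \<mu> (S F) (U F v) (U F v))"
      by simp
  qed
  then show ?thesis
    by blast
qed

section \<open>Piecewise polynomial functions\<close>

lemma finite_exponents: "finite {a :: 'n::finite \<Rightarrow> nat. \<forall>i. a i \<le> r}"
  using finite_set_of_finite_funs[of "UNIV :: 'n set" "{..r}" 0] by simp

lemma Q_poly_lincomb: "p \<in> Q_poly r \<Longrightarrow> q \<in> Q_poly r \<Longrightarrow> (\<lambda>x. a * p x + b * q x) \<in> Q_poly r"
  unfolding Q_poly_def
proof clarify
  fix c d :: "('a \<Rightarrow> nat) \<Rightarrow> real"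
  assume "\<forall>x. p x = (\<Sum>a | \<forall>i. a i \<le> r. c a * (\<Prod>i\<in>UNIV. x $ i ^ a i))"
    "\<forall>x. q x = (\<Sum>a | \<forall>i. a i \<le> r. d a * (\<Prod>i\<in>UNIV. x $ i ^ a i))"
  then show "\<exists>c. \<forall>x. a * p x + b * q x = (\<Sum>a | \<forall>i. a i \<le> r. c a * (\<Prod>i\<in>UNIV. x $ i ^ a i))"
    by (intro exI[of _ "\<lambda>e. a * c e + b * d e"])
      (simp add: sum_distrib_left sum.distrib[symmetric] algebra_simps)
qed

lemma Q_poly_zero: "(\<lambda>x. 0) \<in> Q_poly r"
  unfolding Q_poly_def by (auto intro!: exI[of _ "\<lambda>_. 0"])

lemma P_poly_lincomb: "p \<in> P_poly r \<Longrightarrow> q \<in> P_poly r \<Longrightarrow> (\<lambda>x. a * p x + b * q x) \<in> P_poly r"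
  unfolding P_poly_def
proof clarify
  fix c d :: "('a \<Rightarrow> nat) \<Rightarrow> real"
  assume "\<forall>x. p x = (\<Sum>a | sum a UNIV \<le> r. c a * (\<Prod>i\<in>UNIV. x $ i ^ a i))"
    "\<forall>x. q x = (\<Sum>a | sum a UNIV \<le> r. d a * (\<Prod>i\<in>UNIV. x $ i ^ a i))"
  then show "\<exists>c. \<forall>x. a * p x + b * q x = (\<Sum>a | sum a UNIV \<le> r. c a * (\<Prod>i\<in>UNIV. x $ i ^ a i))"
    by (intro exI[of _ "\<lambda>e. a * c e + b * d e"])
      (simp add: sum_distrib_left sum.distrib[symmetric] algebra_simps)
qed

lemma P_poly_zero: "(\<lambda>x. 0) \<in> P_poly r"
  unfolding P_poly_def by (auto intro!: exI[of _ "\<lambda>_. 0"])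

lemma P_poly_subset_Q_poly: "P_poly r \<subseteq> Q_poly r"
proof
  fix p :: "real^'n \<Rightarrow> real" assume "p \<in> P_poly r"
  then obtain c where c: "\<And>x. p x = (\<Sum>a | sum a UNIV \<le> r. c a * (\<Prod>i\<in>UNIV. x $ i ^ a i))"
    by (auto simp: P_poly_def)
  have le: "a i \<le> r" if "sum a (UNIV :: 'n set) \<le> r" for a :: "'n \<Rightarrow> nat" and i
    using member_le_sum[of i UNIV a] that by simp
  have "p x = (\<Sum>a | \<forall>i. a i \<le> r. (if sum a UNIV \<le> r then c a else 0) * (\<Prod>i\<in>UNIV. x $ i ^ a i))" for x
    unfolding c by (rule sum.mono_neutral_cong_left) (use le finite_exponents[of r] in auto)
  then show "p \<in> Q_poly r"
    unfolding Q_poly_def by (intro CollectI exI[of _ "\<lambda>a. if sum a UNIV \<le> r then c a else 0"]) simp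
qed

text \<open>\<open>co\<close> are the coordinates of the values. The map that takes a function to the polynomials
  representing it on the cells is injective with finite dimensional range.\<close>

lemma mapped_polys_fin_dim:
  fixes S :: "(real^'n \<Rightarrow> 'b::real_vector) set" and co :: "'i::finite \<Rightarrow> 'b \<Rightarrow> real"
    and \<Phi> :: "'c \<Rightarrow> real^'n \<Rightarrow> real^'n"
  assumes S: "subspace S" and co: "\<And>i. linear (co i)" and Cs: "finite Cs"
    and poly: "\<And>v c i. v \<in> S \<Longrightarrow> c \<in> Cs \<Longrightarrow> \<exists>p\<in>Q_poly r. \<forall>x\<in>box 0 1. co i (v (\<Phi> c x)) = p x"
    and inj: "\<And>v w. v \<in> S \<Longrightarrow> w \<in> S \<Longrightarrow>
      (\<And>c i x. c \<in> Cs \<Longrightarrow> x \<in> box 0 1 \<Longrightarrow> co i (v (\<Phi> c x)) = co i (w (\<Phi> c x))) \<Longrightarrow> v = w"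
  shows "fin_dim S"
proof -
  \<comment> \<open>Set to zero off the cells and the cube, which makes \<open>T\<close> linear on
    all functions and sensitive only to values in open cells.\<close>
  define T where "T v = (\<lambda>(c, i, x). if c \<in> Cs \<and> x \<in> box 0 1 then co i (v (\<Phi> c x)) else 0)"
    for v :: "real^'n \<Rightarrow> 'b"
  define A where "A = {a :: 'n \<Rightarrow> nat. \<forall>i. a i \<le> r}"
  \<comment> \<open>The monomial with exponents \<open>a\<close>, placed on one cell and in one
    coordinate.\<close>
  define g where "g = (\<lambda>(c, i, a). (\<lambda>(c', i' :: 'i, x :: real^'n).
    if c' = c \<and> i' = i \<and> x \<in> box 0 1 then \<Prod>j\<in>UNIV. x $ j ^ a j else (0::real)) :: 'c \<times> 'i \<times> (real^'n) \<Rightarrow> real)"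
  let ?I = "Cs \<times> (UNIV :: 'i set) \<times> A"
  have A: "finite A"
    unfolding A_def by (rule finite_exponents)
  have linT: "linear T"
    by (rule linearI) (auto simp: T_def fun_eq_iff linear_add[OF co] linear_scale[OF co])
  have "inj_on T S"
  proof (rule inj_onI)
    fix v w assume vw: "v \<in> S" "w \<in> S" "T v = T w"
    show "v = w"
    proof (rule inj[OF vw(1,2)])
      fix c i x assume "c \<in> Cs" "x \<in> box (0 :: real^'n) 1"
      then show "co i (v (\<Phi> c x)) = co i (w (\<Phi> c x))"
        using fun_cong[OF vw(3), of "(c, i, x)"] by (simp add: T_def)
    qed
  qed
  moreover have "T ` S \<subseteq> span (g ` ?I)"
  proof clarify
    fix v assume v: "v \<in> S"
    have "\<exists>d. \<forall>x\<in>box 0 1. co i (v (\<Phi> c x)) = (\<Sum>a\<in>A. d a * (\<Prod>j\<in>UNIV. x $ j ^ a j))" if "c \<in> Cs" for c i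
      using poly[OF v that, of i] unfolding Q_poly_def A_def by auto
    then obtain d where d: "\<And>c i x. c \<in> Cs \<Longrightarrow> x \<in> box 0 1 \<Longrightarrow>
      co i (v (\<Phi> c x)) = (\<Sum>a\<in>A. d c i a * (\<Prod>j\<in>UNIV. x $ j ^ a j))"
      by metis
    have "T v = (\<Sum>(c, i, a)\<in>?I. d c i a *\<^sub>R g (c, i, a))"
    proof (rule ext, clarify)
      fix c i x
      have "(\<Sum>(c', i', a)\<in>?I. d c' i' a *\<^sub>R g (c', i', a)) (c, i, x) =
        (\<Sum>c'\<in>Cs. \<Sum>i'\<in>UNIV. \<Sum>a\<in>A. d c' i' a * g (c', i', a) (c, i, x))"
        unfolding sum_fun_apply sum.cartesian_product by (intro sum.cong) auto
      also have "\<dots> = (\<Sum>c'\<in>Cs. if c' = c then \<Sum>i'\<in>UNIV. if i' = i then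
        \<Sum>a\<in>A. d c i a * (if x \<in> box 0 1 then \<Prod>j\<in>UNIV. x $ j ^ a j else 0) else 0 else 0)"
      proof (intro sum.cong refl)
        fix c'
        show "(\<Sum>i'\<in>UNIV. \<Sum>a\<in>A. d c' i' a * g (c', i', a) (c, i, x)) =
          (if c' = c then \<Sum>i'\<in>UNIV. if i' = i then
            \<Sum>a\<in>A. d c i a * (if x \<in> box 0 1 then \<Prod>j\<in>UNIV. x $ j ^ a j else 0) else 0 else 0)"
        proof (cases "c' = c")
          case True
          then show ?thesis
            unfolding if_P[OF True] by (intro sum.cong refl) (auto simp: g_def)
        qed (simp add: g_def)
      qed
      also have "\<dots> = (if c \<in> Cs then
          \<Sum>a\<in>A. d c i a * (if x \<in> box 0 1 then \<Prod>j\<in>UNIV. x $ j ^ a j else 0) else 0)"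
        using Cs by simp
      also have "\<dots> = T v (c, i, x)"
        using d[of c x i] by (simp add: T_def)
      finally show "T v (c, i, x) = (\<Sum>(c, i, a)\<in>?I. d c i a *\<^sub>R g (c, i, a)) (c, i, x)" ..
    qed
    also have "\<dots> \<in> span (g ` ?I)"
      by (intro span_sum) (auto intro!: span_scale intro: span_base)
    finally show "T v \<in> span (g ` ?I)" .
  qed
  ultimately show ?thesis
    using A Cs linT by (intro fin_dim_inj_image[OF S linT, of "g ` ?I"]) auto
qed

section \<open>Sobolev functions and integration over cells\<close>

lemma test_function_L2:
  assumes "\<phi> \<in> test_functions \<Omega>" "open \<Omega>" "bounded \<Omega>"
  shows "L2_on lebesgue \<Omega> \<phi>" "L2_on lebesgue \<Omega> (\<lambda>x. frechet_derivative \<phi> (at x) (axis i 1))"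
proof -
  have C: "C_k m \<phi>" for m
    using assms(1) by (simp add: test_functions_def)
  have "continuous_on UNIV \<phi>" "continuous_on UNIV (\<lambda>x. frechet_derivative \<phi> (at x) (axis i 1))"
    using C[of 0] C[of 1] by auto
  then show "L2_on lebesgue \<Omega> \<phi>" "L2_on lebesgue \<Omega> (\<lambda>x. frechet_derivative \<phi> (at x) (axis i 1))"
    using assms by (auto intro!: cont_closure_L2_on cont_closure_subset)
qed

lemma H1_lincomb:
  fixes \<Omega> :: "(real^'n) set"
  assumes \<Omega>: "open \<Omega>" "bounded \<Omega>" and v: "H1 \<Omega> v" and w: "H1 \<Omega> w"
  shows "H1 \<Omega> (\<lambda>x. a * v x + b * w x)"
proof -
  obtain v' w' where v': "L2_on lebesgue \<Omega> v'" "L2_on lebesgue \<Omega> w'"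
    and eq: "\<And>\<phi> i. \<phi> \<in> test_functions \<Omega> \<Longrightarrow>
      ip \<Omega> v (\<lambda>x. frechet_derivative \<phi> (at x) (axis i 1)) = - ip \<Omega> (\<lambda>x. v' x $ i) \<phi>"
      "\<And>\<phi> i. \<phi> \<in> test_functions \<Omega> \<Longrightarrow>
      ip \<Omega> w (\<lambda>x. frechet_derivative \<phi> (at x) (axis i 1)) = - ip \<Omega> (\<lambda>x. w' x $ i) \<phi>"
    using v w unfolding H1_def by metis
  have vw: "L2_on lebesgue \<Omega> v" "L2_on lebesgue \<Omega> w"
    using v w by (auto simp: H1_def)
  have comp: "L2_on lebesgue \<Omega> (\<lambda>x. f x $ i)" if f: "L2_on lebesgue \<Omega> f" for f :: "real^'n \<Rightarrow> real^'n" and i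
  proof (rule L2_on_dominated[OF f, where B=1])
    have m: "(\<lambda>x. indicat_real \<Omega> x *\<^sub>R f x) \<in> borel_measurable lebesgue"
      using f by (simp add: L2_on_iff)
    have "(\<lambda>x. (indicat_real \<Omega> x *\<^sub>R f x) \<bullet> axis i 1) \<in> borel_measurable lebesgue"
      by (rule borel_measurable_inner[OF m]) simp
    then show "(\<lambda>x. indicat_real \<Omega> x *\<^sub>R f x $ i) \<in> borel_measurable lebesgue"
      by (simp add: inner_axis)
  qed (simp add: component_le_norm_cart)
  show ?thesis
    unfolding H1_def
  proof (intro conjI exI[of _ "\<lambda>x. a *\<^sub>R v' x + b *\<^sub>R w' x"] ballI allI)
    show "L2_on lebesgue \<Omega> (\<lambda>x. a * v x + b * w x)"
      using L2_on_lincomb[OF vw, of a b] by simp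
    show "L2_on lebesgue \<Omega> (\<lambda>x. a *\<^sub>R v' x + b *\<^sub>R w' x)"
      by (rule L2_on_lincomb[OF v'])
    fix \<phi> i assume \<phi>: "\<phi> \<in> test_functions \<Omega>"
    note L = test_function_L2[OF \<phi> \<Omega>]
    have "ip \<Omega> (\<lambda>x. a *\<^sub>R v x + b *\<^sub>R w x) (\<lambda>x. frechet_derivative \<phi> (at x) (axis i 1)) =
      a * ip \<Omega> v (\<lambda>x. frechet_derivative \<phi> (at x) (axis i 1)) + b * ip \<Omega> w (\<lambda>x. frechet_derivative \<phi> (at x) (axis i 1))"
      unfolding ip_l2_ip by (rule l2_ip_lincomb_left[OF vw L(2)])
    moreover have "ip \<Omega> (\<lambda>x. a *\<^sub>R (v' x $ i) + b *\<^sub>R (w' x $ i)) \<phi> =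
      a * ip \<Omega> (\<lambda>x. v' x $ i) \<phi> + b * ip \<Omega> (\<lambda>x. w' x $ i) \<phi>"
      unfolding ip_l2_ip by (rule l2_ip_lincomb_left[OF comp[OF v'(1)] comp[OF v'(2)] L(1)])
    ultimately show "ip \<Omega> (\<lambda>x. a * v x + b * w x) (\<lambda>x. frechet_derivative \<phi> (at x) (axis i 1)) =
      - ip \<Omega> (\<lambda>x. (a *\<^sub>R v' x + b *\<^sub>R w' x) $ i) \<phi>"
      by (simp add: eq[OF \<phi>])
  qed
qed

lemma H1_zero: "H1 \<Omega> (\<lambda>x. 0)"
  unfolding H1_def
  by (auto simp: L2_on_zero ip_def set_lebesgue_integral_def intro!: exI[of _ "\<lambda>x. 0"])

lemma subspaceI_lincomb:
  assumes "0 \<in> S" "\<And>x y a b. x \<in> S \<Longrightarrow> y \<in> S \<Longrightarrow> a *\<^sub>R x + b *\<^sub>R y \<in> S"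
  shows "subspace S"
proof (rule subspaceI)
  show "x + y \<in> S" if "x \<in> S" "y \<in> S" for x y
    using assms(2)[OF that, of 1 1] by simp
  show "c *\<^sub>R x \<in> S" if "x \<in> S" for c x
    using assms(2)[OF that that, of c 0] by simp
qed fact

text \<open>Integrability is known on the cells only. On \<Omega> the integrand agrees almost
  everywhere with the sum \<open>s\<close>, which makes it Lebesgue measurable there by
  completeness.\<close>

lemma set_integral_cells:
  fixes f :: "'a::euclidean_space \<Rightarrow> real"
  assumes Cs: "finite Cs" "pairwise disjnt Cs" "\<And>K. K \<in> Cs \<Longrightarrow> open K \<and> K \<subseteq> \<Omega>"
    and null: "negligible (\<Omega> - \<Union>Cs)"
    and f: "\<And>K. K \<in> Cs \<Longrightarrow> set_integrable lebesgue K f"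
  shows "(LINT x:\<Omega>|lebesgue. f x) = (\<Sum>K\<in>Cs. LINT x:K|lebesgue. f x)"
proof -
  define s where "s x = (\<Sum>K\<in>Cs. indicat_real K x *\<^sub>R f x)" for x
  have int: "integrable lebesgue (\<lambda>x. indicat_real K x *\<^sub>R f x)" if "K \<in> Cs" for K
    using f[OF that] by (simp add: set_integrable_def)
  have s_eq: "indicat_real \<Omega> x *\<^sub>R f x = s x" if "x \<notin> \<Omega> - \<Union>Cs" for x
  proof (cases "x \<in> \<Union>Cs")
    case True
    then obtain K where K: "K \<in> Cs" "x \<in> K"
      by auto
    have "s x = (\<Sum>K'\<in>Cs. if K' = K then f x else 0)"
      unfolding s_def
    proof (intro sum.cong refl)
      fix K' assume "K' \<in> Cs"
      then have "x \<notin> K'" if "K' \<noteq> K"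
        using Cs(2) K that by (auto simp: pairwise_def disjnt_def)
      then show "indicat_real K' x *\<^sub>R f x = (if K' = K then f x else 0)"
        using K by auto
    qed
    moreover have "x \<in> \<Omega>"
      using K Cs(3) by blast
    ultimately show ?thesis
      using K Cs(1) by auto
  next
    case False
    then show ?thesis
      using that by (auto simp: s_def)
  qed
  have meas: "s \<in> borel_measurable lebesgue"
    unfolding s_def using int by (intro borel_measurable_sum) auto
  have AE: "AE x in lebesgue. s x = indicat_real \<Omega> x *\<^sub>R f x"
  proof (rule AE_I'[of "\<Omega> - \<Union>Cs"])
    show "\<Omega> - \<Union>Cs \<in> null_sets lebesgue"
      using null by (simp add: negligible_iff_null_sets)
    show "{x \<in> space lebesgue. s x \<noteq> indicat_real \<Omega> x *\<^sub>R f x} \<subseteq> \<Omega> - \<Union>Cs"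
      using s_eq by (metis (mono_tags, lifting) mem_Collect_eq subsetI)
  qed
  have "(\<lambda>x. indicat_real \<Omega> x *\<^sub>R f x) \<in> borel_measurable lebesgue"
    by (rule borel_measurable_AE[OF meas AE])
  then have "(LINT x:\<Omega>|lebesgue. f x) = (LINT x|lebesgue. s x)"
    unfolding set_lebesgue_integral_def using meas AE by (intro integral_cong_AE) (auto elim: eventually_mono)
  also have "\<dots> = (\<Sum>K\<in>Cs. LINT x:K|lebesgue. f x)"
    unfolding s_def set_lebesgue_integral_def by (intro Bochner_Integration.integral_sum int)
  finally show ?thesis .
qed

section \<open>Finite element spaces on a mesh\<close>

definition smooth_on :: "(real^'n) set \<Rightarrow> (real^'n \<Rightarrow> real) \<Rightarrow> bool" where
  "smooth_on K q \<longleftrightarrow> cont_closure K q \<and> (\<forall>y\<in>K. q differentiable (at y)) \<and> cont_closure K (grad q)"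

text \<open>One notion for a function, its Jacobian, strain, divergence or gradient: continuity up
  to the boundary yields both square integrability on the cell and traces on its faces.\<close>

definition cell_op :: "(real^'n) set \<Rightarrow> 'v::real_vector set \<Rightarrow> ('v \<Rightarrow> real^'n \<Rightarrow> 'b::euclidean_space) \<Rightarrow> bool" where
  "cell_op K V T \<longleftrightarrow> (\<forall>v\<in>V. cont_closure K (T v)) \<and>
     (\<forall>v\<in>V. \<forall>w\<in>V. \<forall>a b. \<forall>x\<in>K. T (a *\<^sub>R v + b *\<^sub>R w) x = a *\<^sub>R T v x + b *\<^sub>R T w x)"

lemma cell_op_cont: "cell_op K V T \<Longrightarrow> v \<in> V \<Longrightarrow> cont_closure K (T v)"
  by (simp add: cell_op_def)

lemma cell_op_compose:
  assumes "cell_op K V T" "linear H"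
  shows "cell_op K V (\<lambda>v x. H (T v x))"
proof -
  have "continuous_on UNIV H"
    using assms(2) by (simp add: linear_continuous_on linear_conv_bounded_linear)
  then show ?thesis
    using assms unfolding cell_op_def by (auto simp: linear_add linear_scale intro: cont_closure_compose)
qed

text \<open>The counterpart on a face. Bounded measurable values allow jumps, averages and products
  with the normal, which is merely measurable.\<close>

definition face_op :: "(real^'n) set \<Rightarrow> 'v::real_vector set \<Rightarrow> ('v \<Rightarrow> real^'n \<Rightarrow> 'b::euclidean_space) \<Rightarrow> bool" where
  "face_op F V T \<longleftrightarrow> (\<forall>v\<in>V. bmeas F (T v)) \<and>
     (\<forall>v\<in>V. \<forall>w\<in>V. \<forall>a b. \<forall>x\<in>F. T (a *\<^sub>R v + b *\<^sub>R w) x = a *\<^sub>R T v x + b *\<^sub>R T w x)"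

lemma face_op_combine:
  fixes T U :: "'v::real_vector \<Rightarrow> real^'n \<Rightarrow> 'b::euclidean_space"
  assumes F: "F \<in> sets borel" and T: "face_op F V T" "face_op F V U"
  shows "face_op F V (\<lambda>v x. c *\<^sub>R T v x + d *\<^sub>R U v x)"
  unfolding face_op_def
proof (intro conjI ballI allI)
  fix v assume v: "v \<in> V"
  have "continuous_on UNIV (\<lambda>z::'b \<times> 'b. c *\<^sub>R fst z + d *\<^sub>R snd z)"
    by (intro continuous_intros)
  from bmeas_compose2[OF F _ _ this, of "T v" "U v"] T v
  show "bmeas F (\<lambda>x. c *\<^sub>R T v x + d *\<^sub>R U v x)"
    by (auto simp: face_op_def)
qed (use T in \<open>auto simp: face_op_def algebra_simps\<close>)

lemma face_op_multiplier:
  assumes F: "F \<in> sets borel" and T: "face_op F V T" and n: "bmeas F n"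
    and H: "continuous_on UNIV (\<lambda>z. H (fst z) (snd z))" "\<And>y. linear (\<lambda>x. H x y)"
  shows "face_op F V (\<lambda>v x. H (T v x) (n x))"
  unfolding face_op_def
proof (intro conjI ballI allI)
  show "bmeas F (\<lambda>x. H (T v x) (n x))" if "v \<in> V" for v
    using that T by (intro bmeas_compose2[OF F _ n H(1)]) (simp add: face_op_def)
qed (use T in \<open>simp add: face_op_def linear_add[OF H(2)] linear_scale[OF H(2)]\<close>)

lemma transpose_lincomb:
  "transpose (a *\<^sub>R A + b *\<^sub>R B) = a *\<^sub>R transpose A + b *\<^sub>R (transpose B :: real^'n^'m)"
  by (simp add: transpose_def vec_eq_iff)

lemma linearI_lincomb: "(\<And>x y a b. f (a *\<^sub>R x + b *\<^sub>R y) = a *\<^sub>R f x + b *\<^sub>R f y) \<Longrightarrow> linear f"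
  by (rule linearI) (metis scaleR_one, metis add.right_neutral scaleR_zero_left)

lemma linear_sym_part: "linear (\<lambda>A :: real^'n^'n. (1 / 2) *\<^sub>R (A + transpose A))"
  by (rule linearI_lincomb) (simp add: transpose_lincomb scaleR_add_right algebra_simps)

lemma linear_trace: "linear (trace :: real^'n^'n \<Rightarrow> real)"
  by (rule linearI) (simp_all add: trace_def sum.distrib sum_distrib_left)

lemma linear_tensor_app: "linear (tensor_app C)"
  by (rule linearI)
    (simp_all add: tensor_app_def vec_eq_iff sum.distrib sum_distrib_left algebra_simps)

lemma tensor_app_inner:
  fixes C :: "'n::finite \<Rightarrow> 'n \<Rightarrow> 'n \<Rightarrow> 'n \<Rightarrow> real"
  shows "tensor_app C \<xi> \<bullet> \<zeta> = (\<Sum>i\<in>UNIV. \<Sum>j\<in>UNIV. \<Sum>k\<in>UNIV. \<Sum>l\<in>UNIV. \<zeta> $ i $ j * C i j k l * \<xi> $ k $ l)"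
  by (simp add: tensor_app_def inner_vec_def sum_distrib_left sum_distrib_right mult_ac)

lemma sum_swap_pairs:
  fixes g :: "'a \<Rightarrow> 'b \<Rightarrow> 'c \<Rightarrow> 'd \<Rightarrow> 'e::comm_monoid_add"
  shows "(\<Sum>i\<in>A. \<Sum>j\<in>B. \<Sum>k\<in>C. \<Sum>l\<in>D. g i j k l) = (\<Sum>k\<in>C. \<Sum>l\<in>D. \<Sum>i\<in>A. \<Sum>j\<in>B. g i j k l)"
proof -
  have move: "(\<Sum>j\<in>X. \<Sum>k\<in>C. \<Sum>l\<in>D. h j k l) = (\<Sum>k\<in>C. \<Sum>l\<in>D. \<Sum>j\<in>X. h j k l)"
    for X :: "'x set" and h :: "'x \<Rightarrow> 'c \<Rightarrow> 'd \<Rightarrow> 'e"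
    by (subst sum.swap) (intro sum.cong refl sum.swap)
  show ?thesis
    unfolding move ..
qed

lemma tensor_app_symmetric:
  fixes C :: "'n::finite \<Rightarrow> 'n \<Rightarrow> 'n \<Rightarrow> 'n \<Rightarrow> real"
  assumes "\<And>i j k l. C i j k l = C k l i j"
  shows "tensor_app C \<xi> \<bullet> \<zeta> = tensor_app C \<zeta> \<bullet> \<xi>"
proof -
  have "tensor_app C \<xi> \<bullet> \<zeta> = (\<Sum>k\<in>UNIV. \<Sum>l\<in>UNIV. \<Sum>i\<in>UNIV. \<Sum>j\<in>UNIV. \<zeta> $ i $ j * C i j k l * \<xi> $ k $ l)"
    unfolding tensor_app_inner by (rule sum_swap_pairs)
  also have "\<dots> = (\<Sum>k\<in>UNIV. \<Sum>l\<in>UNIV. \<Sum>i\<in>UNIV. \<Sum>j\<in>UNIV. \<xi> $ k $ l * C k l i j * \<zeta> $ i $ j)"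
    using assms by (intro sum.cong refl) (simp add: mult_ac)
  finally show ?thesis
    unfolding tensor_app_inner .
qed

lemma linear_matrix: "linear (\<lambda>x. A *v (x :: real^'n))" for A :: "real^'n^'m"
  by (rule matrix_vector_mul_linear)

section \<open>Finite element spaces on a fixed mesh\<close>

locale biot_mesh =
  fixes P :: "'n::finite biot" and M :: "'n mesh"
  assumes card: "CARD('n) \<ge> 2" and problem: "biot_problem P" and mesh: "mesh_of P M"
begin

lemma domain: "open (Omega P)" "bounded (Omega P)"
  using problem by (auto simp: biot_problem_def lipschitz_domain_def)

lemma coefficients: "rho P > 0" "c0 P > 0" "elasticity_tensor (Cten P)" "permeability (Kmat P)"
  using problem by (auto simp: biot_problem_def)

lemma finite_cells: "finite (cells M)"
  using mesh by (simp add: mesh_of_def)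

lemma cell:
  assumes "K \<in> cells M"
  shows "cell (refmap M K)" "cell.K (refmap M K) = K" "K = refmap M K ` box 0 1" "K \<subseteq> Omega P"
proof -
  have *: "cell_map (refmap M K)" "K = refmap M K ` box 0 1" "K \<subseteq> Omega P"
    using assms mesh by (auto simp: mesh_of_def)
  show c: "cell (refmap M K)"
    by (rule cell.intro[OF *(1)])
  show "cell.K (refmap M K) = K"
    using cell.K_def[OF c] *(2) by simp
  show "K = refmap M K ` box 0 1" "K \<subseteq> Omega P"
    using * by auto
qed

lemma cell_topology:
  assumes "K \<in> cells M"
  shows "open K" "compact (closure K)" "bounded K" "K \<noteq> {}" "negligible (closure K - K)"
    "closure K = refmap M K ` cbox 0 1" "closure K \<subseteq> closure (Omega P)"
proof -
  note c = cell[OF assms]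
  show "open K"
    using cell.open_K[OF c(1)] unfolding c(2) .
  show "K \<noteq> {}"
    using cell.K_nonempty[OF c(1)] unfolding c(2) .
  show "negligible (closure K - K)"
    using cell.frontier_negligible[OF c(1)] unfolding c(2) .
  show "closure K = refmap M K ` cbox 0 1"
    using cell.closure_K[OF c(1)] unfolding c(2) .
  show compact: "compact (closure K)"
    using cell.compact_closure_K[OF c(1)] unfolding c(2) .
  show "bounded K"
    by (rule bounded_subset[OF compact_imp_bounded[OF compact] closure_subset])
  show "closure K \<subseteq> closure (Omega P)"
    by (rule closure_mono[OF c(4)])
qed

lemma closure_domain: "closure (Omega P) = (\<Union>K\<in>cells M. closure K)"
  using mesh by (simp add: mesh_of_def)

lemma cells_negligible: "negligible (Omega P - \<Union>(cells M))"
proof -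
  have "Omega P \<subseteq> (\<Union>K\<in>cells M. closure K)"
    unfolding closure_domain[symmetric] by (rule closure_subset)
  then have "Omega P - \<Union>(cells M) \<subseteq> (\<Union>K\<in>cells M. closure K - K)"
    by blast
  moreover have "negligible (\<Union>K\<in>cells M. closure K - K)"
    using finite_cells by (intro negligible_Union) (auto intro: cell_topology(5))
  ultimately show ?thesis
    by (rule negligible_subset[rotated])
qed

lemma ip_domain:
  assumes "\<And>K. K \<in> cells M \<Longrightarrow> L2_on lebesgue K f" "\<And>K. K \<in> cells M \<Longrightarrow> L2_on lebesgue K g"
  shows "ip (Omega P) f g = (\<Sum>K\<in>cells M. ip K f g)"
  unfolding ip_def
proof (rule set_integral_cells[OF finite_cells _ _ cells_negligible])
  show "pairwise disjnt (cells M)"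
    using mesh by (simp add: mesh_of_def)
  show "open K \<and> K \<subseteq> Omega P" if "K \<in> cells M" for K
    using cell(4)[OF that] cell_topology(1)[OF that] by blast
  show "set_integrable lebesgue K (\<lambda>x. f x \<bullet> g x)" if "K \<in> cells M" for K
    by (rule L2_on_integrable_inner[OF assms[OF that]])
qed

lemma mapped_smooth:
  assumes K: "K \<in> cells M" and p: "C1 p" and q: "\<And>x. x \<in> box 0 1 \<Longrightarrow> q (refmap M K x) = p x"
  shows "smooth_on K q"
proof -
  note c = cell[OF K]
  show ?thesis
    using cell.mapped_cont_closure[OF c(1) p q] cell.mapped_differentiable[OF c(1) p q]
      cell.mapped_grad_cont_closure[OF c(1) p q]
    by (simp add: c(2) smooth_on_def)
qed

lemma V_smooth:
  assumes "v \<in> Vh P M r" "K \<in> cells M"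
  shows "smooth_on K (\<lambda>x. v x $ i)"
proof -
  obtain p where "p \<in> Q_poly r" "\<forall>x\<in>box 0 1. v (refmap M K x) $ i = p x"
    using assms unfolding Vh_def by blast
  then show ?thesis
    by (intro mapped_smooth[OF assms(2) C1_Q_poly]) auto
qed

lemma W_smooth:
  assumes "q \<in> Qh P M r ch" "K \<in> cells M"
  shows "smooth_on K q"
proof -
  obtain p where "C1 p" "\<forall>x\<in>box 0 1. q (refmap M K x) = p x"
    using assms C1_Q_poly C1_P_poly by (cases ch) fastforce+
  then show ?thesis
    by (intro mapped_smooth[OF assms(2)]) auto
qed

lemma cell_op_l2:
  assumes "K \<in> cells M" "cell_op K V T"
  shows "l2_op lebesgue K V T"
  using assms cell_topology[OF assms(1)] unfolding l2_op_def cell_op_def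
  by (auto intro: cont_closure_L2_on)

lemma V_op_id: "K \<in> cells M \<Longrightarrow> cell_op K (Vh P M r) (\<lambda>v. v)"
  unfolding cell_op_def using V_smooth by (auto intro!: cont_closure_vec simp: smooth_on_def)

lemma V_differentiable: "v \<in> Vh P M r \<Longrightarrow> K \<in> cells M \<Longrightarrow> x \<in> K \<Longrightarrow> v differentiable (at x)"
  using V_smooth by (intro vec_differentiable) (auto simp: smooth_on_def)

lemma V_subspace: "subspace (Vh P M r)"
proof (rule subspaceI_lincomb)
  show "0 \<in> Vh P M r"
    unfolding Vh_def by (auto simp: zero_fun_def H1_zero intro!: bexI[OF _ Q_poly_zero])
  fix v w a b assume v: "v \<in> Vh P M r" and w: "w \<in> Vh P M r"
  show "a *\<^sub>R v + b *\<^sub>R w \<in> Vh P M r"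
    unfolding Vh_def
  proof (intro CollectI conjI ballI allI impI)
    fix i
    show "H1 (Omega P) (\<lambda>x. (a *\<^sub>R v + b *\<^sub>R w) x $ i)"
      using H1_lincomb[OF domain, of "\<lambda>x. v x $ i" "\<lambda>x. w x $ i" a b] v w by (simp add: Vh_def)
    fix K assume "K \<in> cells M"
    then obtain p q where "p \<in> Q_poly r" "\<forall>x\<in>box 0 1. v (refmap M K x) $ i = p x"
      "q \<in> Q_poly r" "\<forall>x\<in>box 0 1. w (refmap M K x) $ i = q x"
      using v w unfolding Vh_def by blast
    then show "\<exists>q\<in>Q_poly r. \<forall>x\<in>box 0 1. (a *\<^sub>R v + b *\<^sub>R w) (refmap M K x) $ i = q x"
      using Q_poly_lincomb[of p r q a b] by (intro bexI[of _ "\<lambda>x. a * p x + b * q x"]) auto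
  next
    show "continuous_on (closure (Omega P)) (a *\<^sub>R v + b *\<^sub>R w)"
      using v w unfolding Vh_def by (auto simp: plus_fun_def scaleR_fun_def intro!: continuous_intros)
  qed (use v w in \<open>auto simp: Vh_def\<close>)
qed

lemma W_subspace: "subspace (Qh P M r ch)"
proof (cases ch)
  case Continuous
  show ?thesis
    unfolding Continuous
  proof (rule subspaceI_lincomb)
    show "0 \<in> Qh P M r Continuous"
      by (auto simp: zero_fun_def intro!: bexI[OF _ Q_poly_zero])
    fix v w a b assume v: "v \<in> Qh P M r Continuous" and w: "w \<in> Qh P M r Continuous"
    have "\<exists>q\<in>Q_poly (r - 1). \<forall>x\<in>box 0 1. (a *\<^sub>R v + b *\<^sub>R w) (refmap M K x) = q x" if "K \<in> cells M" for K
    proof -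
      obtain p q where "p \<in> Q_poly (r - 1)" "\<forall>x\<in>box 0 1. v (refmap M K x) = p x"
        "q \<in> Q_poly (r - 1)" "\<forall>x\<in>box 0 1. w (refmap M K x) = q x"
        using v w \<open>K \<in> cells M\<close> by (auto simp del: split_paired_Ex) blast
      then show ?thesis
        using Q_poly_lincomb[of p "r - 1" q a b] by (intro bexI[of _ "\<lambda>x. a * p x + b * q x"]) auto
    qed
    moreover have "continuous_on (closure (Omega P)) (a *\<^sub>R v + b *\<^sub>R w)"
      using v w by (auto simp: plus_fun_def scaleR_fun_def intro!: continuous_intros)
    ultimately show "a *\<^sub>R v + b *\<^sub>R w \<in> Qh P M r Continuous"
      using v w by auto
  qed
next
  case Discontinuous
  show ?thesis
    unfolding Discontinuous
  proof (rule subspaceI_lincomb)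
    show "0 \<in> Qh P M r Discontinuous"
      by (auto simp: zero_fun_def L2_on_zero intro!: bexI[OF _ P_poly_zero])
    fix v w a b assume v: "v \<in> Qh P M r Discontinuous" and w: "w \<in> Qh P M r Discontinuous"
    have "\<exists>q\<in>P_poly (r - 1). \<forall>x\<in>box 0 1. (a *\<^sub>R v + b *\<^sub>R w) (refmap M K x) = q x" if "K \<in> cells M" for K
    proof -
      obtain p q where "p \<in> P_poly (r - 1)" "\<forall>x\<in>box 0 1. v (refmap M K x) = p x"
        "q \<in> P_poly (r - 1)" "\<forall>x\<in>box 0 1. w (refmap M K x) = q x"
        using v w \<open>K \<in> cells M\<close> by (auto simp del: split_paired_Ex) blast
      then show ?thesis
        using P_poly_lincomb[of p "r - 1" q a b] by (intro bexI[of _ "\<lambda>x. a * p x + b * q x"]) auto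
    qed
    moreover have "L2_on lebesgue (Omega P) (a *\<^sub>R v + b *\<^sub>R w)"
      using v w L2_on_lincomb[of lebesgue "Omega P" v w a b] by (simp add: plus_fun_def scaleR_fun_def)
    ultimately show "a *\<^sub>R v + b *\<^sub>R w \<in> Qh P M r Discontinuous"
      using v w by auto
  qed
qed

text \<open>Definiteness of the mass form and the dimension count see only the open cells.
  Continuity recovers the values on the closed domain, and both functions are 0 outside.\<close>

lemma V_eqI:
  assumes v: "v \<in> Vh P M r" and w: "w \<in> Vh P M r"
    and eq: "\<And>K x. K \<in> cells M \<Longrightarrow> x \<in> K \<Longrightarrow> v x = w x"
  shows "v = w"
proof
  fix x
  show "v x = w x"
  proof (cases "x \<in> closure (Omega P)")
    case True
    then obtain K where K: "K \<in> cells M" "x \<in> closure K"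
      using closure_domain by auto
    have "continuous_on (closure K) v" "continuous_on (closure K) w"
      using v w continuous_on_subset[OF _ cell_topology(7)[OF K(1)]] by (auto simp: Vh_def)
    then have "tr K v x = v x" "tr K v x = w x"
      using K eq cell_topology(1)[OF K(1)] by (auto intro!: tr_eqI)
    then show ?thesis
      by simp
  qed (use v w in \<open>auto simp: Vh_def\<close>)
qed

lemma W_eqI:
  assumes v: "v \<in> Qh P M r ch" and w: "w \<in> Qh P M r ch"
    and eq: "\<And>K x. K \<in> cells M \<Longrightarrow> x \<in> K \<Longrightarrow> v x = w x"
  shows "v = w"
proof
  fix x
  show "v x = w x"
  proof (cases ch)
    case Continuous
    show ?thesis
    proof (cases "x \<in> closure (Omega P)")
      case True
      then obtain K where K: "K \<in> cells M" "x \<in> closure K"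
        using closure_domain by auto
      have "continuous_on (closure K) v" "continuous_on (closure K) w"
        using v w continuous_on_subset[OF _ cell_topology(7)[OF K(1)]] Continuous by auto
      then have "tr K v x = v x" "tr K v x = w x"
        using K eq cell_topology(1)[OF K(1)] by (auto intro!: tr_eqI)
      then show ?thesis
        by simp
    qed (use v w Continuous in auto)
  next
    case Discontinuous
    show ?thesis
    proof (cases "x \<in> \<Union>(cells M)")
      case True
      then show ?thesis
        using eq by blast
    next
      case False
      then have "v x = 0" "w x = 0"
        using v w Discontinuous by auto
      then show ?thesis
        by simp
    qed
  qed
qed

lemma V_fin_dim: "fin_dim (Vh P M r)"
proof (rule mapped_polys_fin_dim[where co="\<lambda>i y. y $ i" and Cs="cells M" and \<Phi>="refmap M"])
  show "subspace (Vh P M r)" "finite (cells M)"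
    by (rule V_subspace finite_cells)+
  show "linear (\<lambda>y :: real^'n. y $ i)" for i
    by (rule linearI) auto
  show "\<exists>p\<in>Q_poly r. \<forall>x\<in>box 0 1. v (refmap M K x) $ i = p x" if "v \<in> Vh P M r" "K \<in> cells M" for v K i
    using that by (simp add: Vh_def)
  fix v w assume vw: "v \<in> Vh P M r" "w \<in> Vh P M r"
    and eq: "\<And>c i x. c \<in> cells M \<Longrightarrow> x \<in> box 0 1 \<Longrightarrow> v (refmap M c x) $ i = w (refmap M c x) $ i"
  show "v = w"
  proof (rule V_eqI[OF vw])
    fix K x assume K: "K \<in> cells M" "x \<in> K"
    then obtain y where y: "y \<in> box 0 1" "x = refmap M K y"
      using cell(3)[OF K(1)] by blast
    show "v x = w x"
      unfolding y(2) vec_eq_iff using eq[OF K(1) y(1)] by blast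
  qed
qed

lemma W_fin_dim: "fin_dim (Qh P M r ch)"
proof (rule mapped_polys_fin_dim[where co="\<lambda>(i::unit) y. y" and Cs="cells M" and \<Phi>="refmap M"])
  show "subspace (Qh P M r ch)" "finite (cells M)"
    by (rule W_subspace finite_cells)+
  show "linear (\<lambda>y :: real. y)"
    by (rule linearI) auto
  show "\<exists>p\<in>Q_poly (r - 1). \<forall>x\<in>box 0 1. v (refmap M K x) = p x" if "v \<in> Qh P M r ch" "K \<in> cells M" for v K
  proof (cases ch)
    case Continuous
    then show ?thesis
      using that by auto
  next
    case Discontinuous
    then have "\<exists>p\<in>P_poly (r - 1). \<forall>x\<in>box 0 1. v (refmap M K x) = p x"
      using that by auto
    then show ?thesis
      using P_poly_subset_Q_poly by blast
  qed
  fix v w assume vw: "v \<in> Qh P M r ch" "w \<in> Qh P M r ch"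
    and eq: "\<And>c (i::unit) x. c \<in> cells M \<Longrightarrow> x \<in> box 0 1 \<Longrightarrow> v (refmap M c x) = w (refmap M c x)"
  show "v = w"
  proof (rule W_eqI[OF vw])
    fix K x assume K: "K \<in> cells M" "x \<in> K"
    then obtain y where y: "y \<in> box 0 1" "x = refmap M K y"
      using cell(3)[OF K(1)] by blast
    show "v x = w x"
      unfolding y(2) using eq[OF K(1) y(1)] .
  qed
qed

lemma V_op_jacobian:
  assumes K: "K \<in> cells M"
  shows "cell_op K (Vh P M r) (\<lambda>v x. jacobian v (at x))"
  unfolding cell_op_def
proof (intro conjI ballI allI)
  fix v assume v: "v \<in> Vh P M r"
  show "cont_closure K (\<lambda>x. jacobian v (at x))"
  proof (intro cont_closure_vec)
    fix i j
    have "cont_closure K (\<lambda>x. grad (\<lambda>y. v y $ i) x $ j)"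
      using V_smooth[OF v K] by (intro cont_closure_compose[of "\<lambda>z. z $ j"] continuous_intros) (simp add: smooth_on_def)
    then show "cont_closure K (\<lambda>x. jacobian v (at x) $ i $ j)"
      by (rule cont_closure_cong[rotated]) (simp add: jacobian_component V_differentiable[OF v K])
  qed
  fix w a b x assume w: "w \<in> Vh P M r" and x: "x \<in> K"
  have "a *\<^sub>R v + b *\<^sub>R w \<in> Vh P M r"
    by (intro subspace_add subspace_scale V_subspace v w)
  then have d: "(a *\<^sub>R v + b *\<^sub>R w) differentiable (at x)"
    using V_differentiable K x by blast
  have "grad (\<lambda>y. (a *\<^sub>R v + b *\<^sub>R w) y $ i) x = a *\<^sub>R grad (\<lambda>y. v y $ i) x + b *\<^sub>R grad (\<lambda>y. w y $ i) x" for i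
    using grad_linear[of "\<lambda>y. v y $ i" x "\<lambda>y. w y $ i" a b] V_smooth[OF v K] V_smooth[OF w K] x
    by (simp add: smooth_on_def)
  then show "jacobian (a *\<^sub>R v + b *\<^sub>R w) (at x) = a *\<^sub>R jacobian v (at x) + b *\<^sub>R jacobian w (at x)"
    by (simp add: vec_eq_iff jacobian_component d V_differentiable[OF v K x] V_differentiable[OF w K x])
qed

lemma V_op_strain: "K \<in> cells M \<Longrightarrow> cell_op K (Vh P M r) strain"
  using cell_op_compose[OF V_op_jacobian linear_sym_part] unfolding strain_def .

lemma V_op_stress: "K \<in> cells M \<Longrightarrow> cell_op K (Vh P M r) (\<lambda>v x. tensor_app (Cten P) (strain v x))"
  by (rule cell_op_compose[OF V_op_strain linear_tensor_app])

lemma V_op_divergence: "K \<in> cells M \<Longrightarrow> cell_op K (Vh P M r) divergence"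
  using cell_op_compose[OF V_op_jacobian linear_trace] unfolding divergence_def .

lemma W_op_id: "K \<in> cells M \<Longrightarrow> cell_op K (Qh P M r ch) (\<lambda>q. q)"
  unfolding cell_op_def using W_smooth by (auto simp: smooth_on_def)

lemma W_op_grad:
  assumes K: "K \<in> cells M"
  shows "cell_op K (Qh P M r ch) grad"
  unfolding cell_op_def
proof (intro conjI ballI allI)
  fix v w a b x assume v: "v \<in> Qh P M r ch" and w: "w \<in> Qh P M r ch" and x: "x \<in> K"
  then show "grad (a *\<^sub>R v + b *\<^sub>R w) x = a *\<^sub>R grad v x + b *\<^sub>R grad w x"
    using grad_linear[of v x w a b] W_smooth[OF v K] W_smooth[OF w K]
    by (simp add: smooth_on_def plus_fun_def scaleR_fun_def)
qed (use W_smooth K in \<open>auto simp: smooth_on_def\<close>)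

lemma W_op_flux: "K \<in> cells M \<Longrightarrow> cell_op K (Qh P M r ch) (\<lambda>q x. Kmat P *v grad q x)"
  by (rule cell_op_compose[OF W_op_grad linear_matrix])

section \<open>Faces and their operators\<close>

lemma facet_eq:
  assumes "F \<in> facets M K"
  obtains i c where "F = refmap M K ` {x \<in> cbox 0 1. x $ i = c}" "c \<in> {0, 1}"
  using assms unfolding facets_def ref_facets_def by auto

lemma facet_topology:
  assumes K: "K \<in> cells M" and F: "F \<in> facets M K"
  shows "compact F" "F \<subseteq> closure K" "surface_area F < \<infinity>" "F \<in> sets borel"
proof -
  obtain i c where Fi: "F = refmap M K ` {x \<in> cbox 0 1. x $ i = c}"
    using facet_eq[OF F] .
  have "compact {x \<in> cbox 0 1. (x :: real^'n) $ i = c}"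
  proof -
    have "closed {x :: real^'n. x $ i = c}"
      by (intro closed_Collect_eq continuous_intros)
    then have "compact (cbox 0 1 \<inter> {x :: real^'n. x $ i = c})"
      by (intro compact_Int_closed compact_cbox)
    then show ?thesis
      by (simp add: Collect_conj_eq Int_commute)
  qed
  then show "compact F"
    unfolding Fi by (intro compact_continuous_image cell.continuous_map[OF cell(1)[OF K]])
  then show "F \<in> sets borel"
    by (rule borel_compact)
  show "F \<subseteq> closure K"
    unfolding Fi cell_topology(6)[OF K] by blast
  obtain L where L: "L-lipschitz_on (cbox 0 1) (refmap M K)"
    using cell.map_lipschitz[OF cell(1)[OF K]] by blast
  have "card (- {i} :: 'n set) = CARD('n) - 1"
    by (simp add: Compl_eq_Diff_UNIV)
  \<comment> \<open>Space dimension at least 2 gives the facet positive dimension, as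
    \<open>hausdorff_lipschitz_cube\<close> demands.\<close>
  moreover from this have "- {i} \<noteq> ({} :: 'n set)"
    using card by (metis card.empty diff_is_0_eq not_less_eq_eq numeral_2_eq_2 One_nat_def)
  ultimately show "surface_area F < \<infinity>"
    using hausdorff_lipschitz_cube[OF L, of "- {i}" "\<lambda>_. c"] card
    by (simp add: surface_area_def Fi of_nat_diff)
qed

lemma face_plus: "F \<in> faces P M \<Longrightarrow> Kplus M F \<in> cells M" "F \<in> faces P M \<Longrightarrow> F \<in> facets M (Kplus M F)"
  using mesh by (auto simp: mesh_of_def faces_def)

lemma face_minus:
  assumes "F \<in> faces P M" "F \<notin> boundary_faces P M"
  shows "Kminus M F \<in> cells M" "F \<in> facets M (Kminus M F)"
  using assms mesh by (auto simp: mesh_of_def faces_def)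

lemma faces_on_faces: "faces_on P M G \<subseteq> faces P M" "faces_on P M G \<subseteq> boundary_faces P M"
  by (auto simp: faces_on_def faces_def)

lemma face_topology:
  assumes "F \<in> faces P M"
  shows "compact F" "F \<subseteq> closure (Kplus M F)" "surface_area F < \<infinity>" "F \<in> sets borel"
    "F \<subseteq> closure (Omega P)"
  using facet_topology[OF face_plus[OF assms]] cell_topology(7)[OF face_plus(1)[OF assms]] by auto

text \<open>\<open>enn2real\<close> is 0 at 0 and at infinity, so the Hausdorff measure must be
  bounded on both sides: from above by the Lipschitz cell map, from below by a box inside
  \<open>K\<close>.\<close>

lemma volume_pos:
  assumes K: "K \<in> cells M"
  shows "volume K > 0"
proof -
  obtain L where L: "L-lipschitz_on (cbox 0 1) (refmap M K)"
    using cell.map_lipschitz[OF cell(1)[OF K]] by blast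
  have "hausdorff (real CARD('n)) K \<le> hausdorff (real CARD('n)) (refmap M K ` cbox 0 1)"
    using closure_subset[of K] cell_topology(6)[OF K] by (intro hausdorff_mono) auto
  also have "\<dots> < \<infinity>"
    using hausdorff_lipschitz_cube[OF L, of UNIV] by simp
  finally have fin: "hausdorff (real CARD('n)) K < \<infinity>" .
  obtain x where "x \<in> K"
    using cell_topology(4)[OF K] by blast
  then obtain a b where ab: "cbox a b \<subseteq> K" "\<forall>i\<in>Basis. a \<bullet> i < b \<bullet> i"
    using open_contains_cbox[OF cell_topology(1)[OF K]] by metis
  have "hausdorff (real CARD('n)) ((\<lambda>x. x) ` K) > 0"
  proof (rule hausdorff_pos[where L=1 and l=a and u=b and J=UNIV])
    show "a $ i < b $ i" for i
      using ab(2) by (auto simp: Basis_vec_def inner_axis)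
  qed (use ab in auto)
  then show ?thesis
    using fin by (simp add: volume_def enn2real_positive_iff)
qed

lemma h_face_pos: "F \<in> faces P M \<Longrightarrow> h_face P M F > 0"
  using volume_pos[OF face_plus(1)[of F]] volume_pos[OF face_minus(1)[of F]]
  by (auto simp: h_face_def intro!: add_pos_pos)

text \<open>A nonempty relatively open subset of a face has positive surface area.\<close>

lemma face_subset:
  assumes F: "F \<in> faces_on P M G" and G: "closed G"
  shows "F \<subseteq> G"
proof (rule ccontr)
  assume "\<not> F \<subseteq> G"
  then obtain y where y: "y \<in> F" "y \<notin> G"
    by blast
  have FF: "F \<in> faces P M" and null: "surface_area (F - G) = 0"
    using F faces_on_faces by (auto simp: faces_on_def)
  define K where "K = Kplus M F"
  have K: "K \<in> cells M" "F \<in> facets M K"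
    using face_plus[OF FF] by (auto simp: K_def)
  let ?\<Phi> = "refmap M K"
  note c = cell(1)[OF K(1)]
  obtain i d where Fi: "F = ?\<Phi> ` {x \<in> cbox 0 1. x $ i = d}"
    using facet_eq[OF K(2)] .
  obtain z where z: "z \<in> cbox 0 1" "z $ i = d" "y = ?\<Phi> z"
    using y(1) Fi by auto
  obtain \<delta> L where \<delta>: "\<delta> > 0" "L > 0"
    "\<And>x y. x \<in> ball z \<delta> \<Longrightarrow> y \<in> ball z \<delta> \<Longrightarrow> norm (x - y) \<le> L * norm (?\<Phi> x - ?\<Phi> y)"
    using cell.local_inverse_lipschitz[OF c z(1)] by metis
  have "open (?\<Phi> -` (- G))"
    using G cell.continuous_map[OF c, of UNIV] by (intro open_vimage) auto
  then obtain e where e: "e > 0" "ball z e \<subseteq> ?\<Phi> -` (- G)"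
    using y(2) z(3) open_contains_ball by (metis ComplI vimageI)
  define \<rho> where "\<rho> = min \<delta> e"
  \<comment> \<open>With every coordinate within \<open>h\<close> of \<open>z\<close> the l1
    distance is at most \<open>\<rho> / 2\<close>, hence the point lies in the ball.\<close>
  define h where "h = \<rho> / (2 * real CARD('n))"
  have \<rho>: "\<rho> > 0" and h: "h > 0"
    using \<delta> e by (auto simp: \<rho>_def h_def)
  define E where "E = {x \<in> cbox 0 1. x $ i = d} \<inter> ball z \<rho>"
  \<comment> \<open>In the fixed direction \<open>i\<close> the box is the whole unit interval, as
    \<open>hausdorff_pos\<close> permits. In the others it is the interval around \<open>z\<close>
    clipped to the cube, which stays nondegenerate even for \<open>z\<close> on an edge.\<close>
  define l where "l = (\<chi> j. if j = i then 0 else max 0 (z $ j - h))"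
  define u where "u = (\<chi> j. if j = i then 1 else min 1 (z $ j + h))"
  have z01: "0 \<le> z $ j" "z $ j \<le> 1" for j
    using z(1) by (auto simp: mem_box_cart)
  have card_i: "card (- {i} :: 'n set) = CARD('n) - 1"
    by (simp add: Compl_eq_Diff_UNIV)
  have "hausdorff (real (card (- {i}))) (?\<Phi> ` E) > 0"
  proof (rule hausdorff_pos[where L=L and l=l and u=u])
    show "norm (x - x') \<le> L * norm (?\<Phi> x - ?\<Phi> x')" if "x \<in> E" "x' \<in> E" for x x'
      using that by (intro \<delta>(3)) (auto simp: E_def \<rho>_def)
    show "L > 0" by fact
    show "- {i} \<noteq> {}"
      using card card_i by (metis card.empty diff_is_0_eq not_less_eq_eq numeral_2_eq_2 One_nat_def)
    show "l $ j < u $ j" for j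
      using z01[of j] h by (auto simp: l_def u_def)
    fix b assume b: "b \<in> cbox l u"
    define x where "x = (\<chi> j. if j = i then d else b $ j)"
    have bj: "0 \<le> b $ j \<and> b $ j \<le> 1 \<and> z $ j - h \<le> b $ j \<and> b $ j \<le> z $ j + h" if "j \<noteq> i" for j
      using b that by (auto simp: mem_box_cart l_def u_def dest!: spec[of _ j])
    have "d \<in> {0..1}"
      using z01[of i] z(2) by simp
    then have "x \<in> cbox 0 1"
      using bj by (auto simp: x_def mem_box_cart)
    moreover have "dist z x < \<rho>"
    proof -
      have "norm (z - x) \<le> (\<Sum>j\<in>UNIV. \<bar>(z - x) $ j\<bar>)"
        by (rule norm_le_l1_cart)
      also have "\<dots> \<le> (\<Sum>j\<in>(UNIV :: 'n set). h)"
        using bj z(2) h by (intro sum_mono) (auto simp: x_def abs_le_iff algebra_simps)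
      also have "\<dots> = \<rho> / 2"
        by (simp add: h_def)
      finally show ?thesis
        using \<rho> by (simp add: dist_norm)
    qed
    ultimately have "x \<in> E"
      by (simp add: E_def x_def)
    moreover have "\<forall>j\<in>- {i}. x $ j = b $ j"
      by (simp add: x_def)
    moreover have "0 \<le> b $ i \<and> b $ i \<le> 1"
      using b by (auto simp: mem_box_cart l_def u_def dest!: spec[of _ i])
    ultimately show "(\<exists>x\<in>E. \<forall>j\<in>- {i}. x $ j = b $ j) \<and> (\<forall>i\<in>- (- {i}). 0 \<le> b $ i \<and> b $ i \<le> 1)"
      by auto
  qed
  moreover have "?\<Phi> ` E \<subseteq> F - G"
    using e(2) by (auto simp: E_def Fi \<rho>_def)
  ultimately have "surface_area (F - G) > 0"
    using hausdorff_mono[of "?\<Phi> ` E" "F - G" "real CARD('n) - 1"] card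
    by (simp add: surface_area_def card_i of_nat_diff)
  then show False
    using null by simp
qed

lemma face_op_l2: "F \<in> faces P M \<Longrightarrow> face_op F V T \<Longrightarrow> l2_op surface_measure F V T"
  using face_topology(3,4) unfolding l2_op_def face_op_def by (auto intro: bmeas_L2_on)

lemma normal_bmeas: "F \<in> faces P M \<Longrightarrow> bmeas F (normal P M F)"
  unfolding normal_def
  using face_topology(4) borel_measurable_outer_normal norm_outer_normal by (rule bmeas_measurable)

lemma face_op_trace:
  assumes K: "K \<in> cells M" "F \<in> facets M K" and V: "subspace V" and T: "cell_op K V T"
  shows "face_op F V (\<lambda>v. tr K (T v))"
  unfolding face_op_def
proof (intro conjI ballI allI)
  fix v assume v: "v \<in> V"
  have "continuous_on F (tr K (T v))"
    using tr_continuous[OF cell_topology(1)[OF K(1)] cell_op_cont[OF T v]] facet_topology(2)[OF K]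
    by (rule continuous_on_subset)
  then show "bmeas F (tr K (T v))"
    by (rule bmeas_continuous[OF facet_topology(1)[OF K]])
  fix w a b x assume w: "w \<in> V" and x: "x \<in> F"
  show "tr K (T (a *\<^sub>R v + b *\<^sub>R w)) x = a *\<^sub>R tr K (T v) x + b *\<^sub>R tr K (T w) x"
    using T v w x facet_topology(2)[OF K] cell_topology(1)[OF K(1)]
    by (intro tr_linear cell_op_cont[OF T]) (auto simp: cell_op_def)
qed

lemma face_op_average:
  assumes F: "F \<in> faces P M" and V: "subspace V" and T: "\<And>K. K \<in> cells M \<Longrightarrow> cell_op K V T"
  shows "face_op F V (\<lambda>v. average P M F (T v))"
proof (cases "F \<in> boundary_faces P M")
  case True
  then show ?thesis
    using face_op_trace[OF face_plus[OF F] V T[OF face_plus(1)[OF F]]]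
    by (simp add: average_def[abs_def])
next
  case False
  then show ?thesis
    using face_op_combine[OF face_topology(4)[OF F] face_op_trace[OF face_plus[OF F] V T[OF face_plus(1)[OF F]]]
        face_op_trace[OF face_minus[OF F False] V T[OF face_minus(1)[OF F False]]], of "1/2" "1/2"]
    by (simp add: average_def[abs_def] scaleR_add_right)
qed

lemma face_op_jump:
  assumes F: "F \<in> faces P M" and V: "subspace V" and T: "\<And>K. K \<in> cells M \<Longrightarrow> cell_op K V T"
  shows "face_op F V (\<lambda>v. jump P M F (T v))"
proof (cases "F \<in> boundary_faces P M")
  case True
  then show ?thesis
    using face_op_trace[OF face_plus[OF F] V T[OF face_plus(1)[OF F]]]
    by (simp add: jump_def[abs_def])
next
  case False
  then show ?thesis
    using face_op_combine[OF face_topology(4)[OF F] face_op_trace[OF face_plus[OF F] V T[OF face_plus(1)[OF F]]]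
        face_op_trace[OF face_minus[OF F False] V T[OF face_minus(1)[OF F False]]], of 1 "-1"]
    by (simp add: jump_def[abs_def])
qed

lemma traction_op:
  assumes F: "F \<in> faces P M"
  shows "l2_op surface_measure F (Vh P M r) (traction P M F)"
proof (rule face_op_l2[OF F])
  have T: "face_op F (Vh P M r) (\<lambda>v. tr (Kplus M F) (strain v))"
    by (rule face_op_trace[OF face_plus[OF F] V_subspace V_op_strain[OF face_plus(1)[OF F]]])
  have "continuous_on UNIV (\<lambda>z::(real^'n^'n) \<times> (real^'n). tensor_app (Cten P) (fst z) *v snd z)"
    unfolding tensor_app_def matrix_vector_mult_def by (intro continuous_intros)
  moreover have "linear (\<lambda>A. tensor_app (Cten P) A *v y)" for y
    by (rule linearI) (simp_all add: linear_add[OF linear_tensor_app] linear_scale[OF linear_tensor_app]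
        matrix_vector_mult_add_rdistrib scaleR_matrix_vector_assoc)
  ultimately have "face_op F (Vh P M r) (\<lambda>v x. tensor_app (Cten P) (tr (Kplus M F) (strain v) x) *v normal P M F x)"
    by (rule face_op_multiplier[OF face_topology(4)[OF F] T normal_bmeas[OF F]])
  then show "face_op F (Vh P M r) (traction P M F)"
    unfolding traction_def .
qed

lemma face_op_inner_normal:
  fixes T :: "'v::real_vector \<Rightarrow> real^'n \<Rightarrow> real^'n"
  assumes F: "F \<in> faces P M" and T: "face_op F V T"
  shows "face_op F V (\<lambda>v x. T v x \<bullet> normal P M F x)"
proof (rule face_op_multiplier[OF face_topology(4)[OF F] T normal_bmeas[OF F]])
  show "continuous_on UNIV (\<lambda>z::(real^'n) \<times> (real^'n). fst z \<bullet> snd z)"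
    by (intro continuous_intros)
  show "linear (\<lambda>x. x \<bullet> y)" for y :: "real^'n"
    by (rule linearI) (simp_all add: inner_add_left)
qed

lemma flux_op:
  assumes F: "F \<in> faces P M"
  shows "l2_op surface_measure F (Qh P M r ch) (flux P M F)"
proof (rule face_op_l2[OF F])
  have "face_op F (Qh P M r ch) (\<lambda>v x. average P M F (\<lambda>y. Kmat P *v grad v y) x \<bullet> normal P M F x)"
    by (rule face_op_inner_normal[OF F face_op_average[OF F W_subspace W_op_flux]])
  then show "face_op F (Qh P M r ch) (flux P M F)"
    unfolding flux_def .
qed

lemma jump_op: "F \<in> faces P M \<Longrightarrow> l2_op surface_measure F (Qh P M r ch) (jump P M F)"
  by (intro face_op_l2 face_op_jump W_subspace W_op_id)

lemma pressure_trace_op: "F \<in> faces P M \<Longrightarrow> l2_op surface_measure F (Qh P M r ch) (tr (Kplus M F))"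
  by (intro face_op_l2 face_op_trace face_plus W_subspace W_op_id)

text \<open>Functions continuous on the closed domain enter the face integrals by their own values,
  without a trace from a cell.\<close>

lemma face_op_continuous:
  assumes F: "F \<in> faces P M" and cont: "\<And>v. v \<in> V \<Longrightarrow> continuous_on (closure (Omega P)) v"
  shows "face_op F V (\<lambda>v. v)"
  unfolding face_op_def
  using continuous_on_subset[OF cont face_topology(5)[OF F]] face_topology(1)[OF F]
  by (auto intro: bmeas_continuous)

lemma pressure_face_op: "F \<in> faces P M \<Longrightarrow> l2_op surface_measure F (Qh P M r Continuous) (\<lambda>q. q)"
  by (intro face_op_l2 face_op_continuous) auto

lemma displacement_face_op: "F \<in> faces P M \<Longrightarrow> l2_op surface_measure F (Vh P M r) (\<lambda>v. v)"
  by (intro face_op_l2 face_op_continuous) (auto simp: Vh_def)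

lemma normal_component_op:
  assumes F: "F \<in> faces P M"
  shows "l2_op surface_measure F (Vh P M r) (\<lambda>v x. v x \<bullet> normal P M F x)"
  by (intro face_op_l2[OF F] face_op_inner_normal[OF F] face_op_continuous[OF F]) (simp add: Vh_def)

end

section \<open>The bilinear forms\<close>

lemma psd_form_cong:
  assumes "subspace V" "\<And>v w. v \<in> V \<Longrightarrow> w \<in> V \<Longrightarrow> f v w = g v w" "psd_form V g"
  shows "psd_form V f"
  using assms bilin_on_cong[of V V f g] unfolding psd_form_def by simp

lemma linear_functional_lin_on: "linear_functional_on B l \<Longrightarrow> lin_on B l"
  by (simp add: linear_functional_on_def lin_on_def plus_fun_def scaleR_fun_def)

lemma transpose_strain: "transpose (strain u x) = strain u x"
  by (simp add: strain_def transpose_def vec_eq_iff add.commute)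

lemma tensor_app_coercive:
  fixes \<xi> :: "real^'n^'n"
  assumes "elasticity_tensor C"
  obtains k where "k > 0" "\<And>\<xi> :: real^'n^'n. transpose \<xi> = \<xi> \<Longrightarrow> tensor_app C \<xi> \<bullet> \<xi> \<ge> k * (norm \<xi>)\<^sup>2"
proof -
  have norm: "(norm \<xi>)\<^sup>2 = (\<Sum>j\<in>UNIV. \<Sum>k\<in>UNIV. \<bar>\<xi> $ j $ k\<bar>\<^sup>2)" for \<xi> :: "real^'n^'n"
    unfolding power2_norm_eq_inner inner_vec_def inner_real_def power2_abs by (simp only: power2_eq_square)
  show ?thesis
    using assms that unfolding elasticity_tensor_def tensor_app_inner norm by blast
qed

lemma permeability_coercive:
  assumes "permeability K"
  obtains k where "k > 0" "\<And>\<xi>. (K *v \<xi>) \<bullet> \<xi> \<ge> k * (norm \<xi>)\<^sup>2"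
proof -
  have norm: "(norm \<xi>)\<^sup>2 = (\<Sum>j\<in>UNIV. \<bar>\<xi> $ j\<bar>\<^sup>2)" for \<xi> :: "real^'a"
    unfolding power2_norm_eq_inner inner_vec_def inner_real_def power2_abs by (simp only: power2_eq_square)
  have inner: "(K *v \<xi>) \<bullet> \<xi> = (\<Sum>i\<in>UNIV. \<Sum>j\<in>UNIV. \<xi> $ i * K $ i $ j * \<xi> $ j)" for \<xi>
    by (simp add: matrix_vector_mult_def inner_vec_def sum_distrib_right sum_distrib_left mult_ac)
  show ?thesis
    using assms that unfolding permeability_def inner norm by blast
qed

lemma permeability_symmetric:
  assumes "permeability K"
  shows "(K *v x) \<bullet> y = (K *v y) \<bullet> x"
proof -
  have "(K *v x) \<bullet> y = (y v* K) \<bullet> x"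
    by (metis dot_lmul_matrix inner_commute)
  also have "y v* K = K *v y"
    using assms by (metis permeability_def transpose_matrix_vector)
  finally show ?thesis .
qed

context biot_mesh
begin

lemma cell_op_L2: "K \<in> cells M \<Longrightarrow> cell_op K V T \<Longrightarrow> v \<in> V \<Longrightarrow> L2_on lebesgue K (T v)"
  using cell_op_l2 l2_op_L2 by blast

lemma ip_domain_ops:
  assumes "\<And>K. K \<in> cells M \<Longrightarrow> cell_op K V T" "\<And>K. K \<in> cells M \<Longrightarrow> cell_op K W U" "v \<in> V" "w \<in> W"
  shows "ip (Omega P) (T v) (U w) = (\<Sum>K\<in>cells M. l2_ip lebesgue K (T v) (U w))"
  unfolding ip_l2_ip[symmetric] using assms by (intro ip_domain cell_op_L2)

lemma bilin_on_ip_domain: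
  assumes V: "subspace V" and W: "subspace W"
    and T: "\<And>K. K \<in> cells M \<Longrightarrow> cell_op K V T" and U: "\<And>K. K \<in> cells M \<Longrightarrow> cell_op K W U"
  shows "bilin_on V W (\<lambda>v w. ip (Omega P) (T v) (U w))"
  by (rule bilin_on_cong[OF V W ip_domain_ops[OF T U]])
    (intro bilin_on_setsum bilin_on_l2_ip cell_op_l2 T U | assumption)+

text \<open>Coercivity is asked only at values of \<open>T\<close>, because the elasticity tensor is
  coercive just on symmetric matrices. Zero energy makes \<open>T v\<close> vanish at every point of
  a cell, not merely almost everywhere, since \<open>T v\<close> is continuous there; its traces
  then vanish as well.\<close>

lemma energy_form:
  fixes T :: "'v::real_vector \<Rightarrow> real^'n \<Rightarrow> 'b::euclidean_space"
  assumes V: "subspace V" and T: "\<And>K. K \<in> cells M \<Longrightarrow> cell_op K V T"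
    and L: "linear L" "\<And>x y. L x \<bullet> y = L y \<bullet> x" and k: "k > 0"
    and coercive: "\<And>v x. L (T v x) \<bullet> T v x \<ge> k * (norm (T v x))\<^sup>2"
  shows "psd_form V (\<lambda>v w. \<Sum>K\<in>cells M. l2_ip lebesgue K (\<lambda>x. L (T v x)) (T w))"
    and "\<And>v K x. v \<in> V \<Longrightarrow> (\<Sum>K\<in>cells M. l2_ip lebesgue K (\<lambda>x. L (T v x)) (T v)) = 0 \<Longrightarrow>
      K \<in> cells M \<Longrightarrow> x \<in> K \<Longrightarrow> T v x = 0"
proof -
  have LT: "cell_op K V (\<lambda>v x. L (T v x))" if "K \<in> cells M" for K
    by (rule cell_op_compose[OF T[OF that] L(1)])
  have bound: "k * l2_ip lebesgue K (T v) (T v) \<le> l2_ip lebesgue K (\<lambda>x. L (T v x)) (T v)"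
    if K: "K \<in> cells M" and v: "v \<in> V" for K v
  proof -
    have "set_integrable lebesgue K (\<lambda>x. k * (T v x \<bullet> T v x))"
      using L2_on_integrable_inner[OF cell_op_L2[OF K T[OF K] v] cell_op_L2[OF K T[OF K] v]]
      by (rule set_integrable_mult_right)
    moreover have "set_integrable lebesgue K (\<lambda>x. L (T v x) \<bullet> T v x)"
      by (rule L2_on_integrable_inner[OF cell_op_L2[OF K LT[OF K] v] cell_op_L2[OF K T[OF K] v]])
    ultimately have "(LINT x:K|lebesgue. k * (T v x \<bullet> T v x)) \<le> (LINT x:K|lebesgue. L (T v x) \<bullet> T v x)"
      using coercive by (intro set_integral_mono) (auto simp: power2_norm_eq_inner)
    then show ?thesis
      by (simp add: l2_ip_def)
  qed
  then have nn: "l2_ip lebesgue K (\<lambda>x. L (T v x)) (T v) \<ge> 0" if "K \<in> cells M" "v \<in> V" for K v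
    using mult_nonneg_nonneg[OF less_imp_le[OF k] l2_ip_nonneg] that order_trans by blast
  have bil: "bilin_on V V (\<lambda>v w. \<Sum>K\<in>cells M. l2_ip lebesgue K (\<lambda>x. L (T v x)) (T w))"
    by (rule bilin_on_setsum) (rule bilin_on_l2_ip[OF cell_op_l2[OF _ LT] cell_op_l2[OF _ T]])
  have sym: "l2_ip lebesgue K (\<lambda>x. L (T v x)) (T w) = l2_ip lebesgue K (\<lambda>x. L (T w x)) (T v)" for K v w
    by (rule l2_ip_cong) (rule L(2))
  show "psd_form V (\<lambda>v w. \<Sum>K\<in>cells M. l2_ip lebesgue K (\<lambda>x. L (T v x)) (T w))"
    unfolding psd_form_def
  proof (intro conjI ballI sum_nonneg)
    show "(\<Sum>K\<in>cells M. l2_ip lebesgue K (\<lambda>x. L (T v x)) (T w)) =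
      (\<Sum>K\<in>cells M. l2_ip lebesgue K (\<lambda>x. L (T w x)) (T v))" for v w
      by (intro sum.cong refl sym)
  qed (use bil nn in auto)
  fix v K x
  assume v: "v \<in> V" and 0: "(\<Sum>K\<in>cells M. l2_ip lebesgue K (\<lambda>x. L (T v x)) (T v)) = 0"
    and K: "K \<in> cells M" and x: "x \<in> K"
  have "l2_ip lebesgue K (\<lambda>x. L (T v x)) (T v) = 0"
    using 0 K nn[OF _ v] finite_cells by (subst (asm) sum_nonneg_eq_0_iff) auto
  then have "k * l2_ip lebesgue K (T v) (T v) \<le> 0"
    using bound[OF K v] by simp
  then have z: "l2_ip lebesgue K (T v) (T v) = 0"
    using k l2_ip_nonneg[of lebesgue K "T v"] by (simp add: mult_le_0_iff order_antisym)
  obtain g where g: "continuous_on (closure K) g" "\<And>x. x \<in> K \<Longrightarrow> T v x = g x"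
    using cell_op_cont[OF T[OF K] v] by (auto simp: cont_closure_def)
  have "continuous_on K (T v)"
    using continuous_on_subset[OF g(1) closure_subset] g(2) continuous_on_cong[of K K "T v" g] by simp
  then show "T v x = 0"
    by (rule l2_ip_self_zero[OF cell_topology(1)[OF K] _ cell_op_L2[OF K T[OF K] v] z x])
qed

text \<open>The case of \<open>energy_form\<close> in which both the operator and \<open>L\<close>
  are the identity.\<close>

lemma mass_form:
  fixes V :: "(real^'n \<Rightarrow> 'b::euclidean_space) set"
  assumes V: "subspace V" and T: "\<And>K. K \<in> cells M \<Longrightarrow> cell_op K V (\<lambda>v. v)"
  shows "psd_form V (ip (Omega P))"
    and "\<And>v K x. v \<in> V \<Longrightarrow> ip (Omega P) v v = 0 \<Longrightarrow> K \<in> cells M \<Longrightarrow> x \<in> K \<Longrightarrow> v x = 0"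
proof -
  have eq: "ip (Omega P) v w = (\<Sum>K\<in>cells M. l2_ip lebesgue K (\<lambda>x. id (v x)) w)" if "v \<in> V" "w \<in> V" for v w
    using ip_domain_ops[OF T T that] by simp
  have sym: "id x \<bullet> y = id y \<bullet> x" for x y :: 'b
    by (simp add: inner_commute)
  have coercive: "1 * (norm (v x))\<^sup>2 \<le> id (v x) \<bullet> v x" for v :: "real^'n \<Rightarrow> 'b" and x
    by (simp add: power2_norm_eq_inner)
  have "psd_form V (\<lambda>v w. \<Sum>K\<in>cells M. l2_ip lebesgue K (\<lambda>x. id (v x)) w)"
    by (rule energy_form(1)[where T="\<lambda>v. v" and L=id and k=1])
      (rule V T linear_id sym zero_less_one coercive | assumption)+
  then show "psd_form V (ip (Omega P))"
    by (rule psd_form_cong[OF V eq, rotated 2])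
  fix v K x assume v: "v \<in> V" "ip (Omega P) v v = 0" and K: "K \<in> cells M" "x \<in> K"
  have "(\<Sum>K\<in>cells M. l2_ip lebesgue K (\<lambda>x. id (v x)) v) = 0"
    using v eq[OF v(1,1)] by simp
  then show "v x = 0"
    by (rule energy_form(2)[where V=V and T="\<lambda>v. v" and L=id and k=1, rotated 7])
      (rule V T linear_id sym zero_less_one coercive v K | assumption)+
qed

lemma V_mass: "psd_form (Vh P M r) (ip (Omega P))"
  by (rule mass_form(1)[OF V_subspace V_op_id])

lemma V_mass_definite: "v \<in> Vh P M r \<Longrightarrow> ip (Omega P) v v = 0 \<Longrightarrow> v = 0"
  using mass_form(2)[OF V_subspace V_op_id] V_eqI[OF _ subspace_0[OF V_subspace]] by (metis zero_fun_apply)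

lemma W_mass: "psd_form (Qh P M r ch) (ip (Omega P))"
  by (rule mass_form(1)[OF W_subspace W_op_id])

lemma W_mass_definite: "v \<in> Qh P M r ch \<Longrightarrow> ip (Omega P) v v = 0 \<Longrightarrow> v = 0"
  using mass_form(2)[OF W_subspace W_op_id] W_eqI[OF _ subspace_0[OF W_subspace]] by (metis zero_fun_apply)

text \<open>\<open>nitsche_form_psd\<close> with the traction as flux. Zero elastic energy means
  zero strain in the adjacent cell, thus a zero trace of the strain on the face.\<close>

lemma A_form_psd: "\<exists>\<gamma>0. \<forall>\<gamma>>\<gamma>0. psd_form (Vh P M r) (A_form P M \<gamma>)"
proof -
  let ?V = "Vh P M r" and ?Fs = "faces_on P M (GuD P)"
  let ?E = "\<lambda>v w. \<Sum>K\<in>cells M. l2_ip lebesgue K (\<lambda>x. tensor_app (Cten P) (strain v x)) (strain w)"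
  obtain k where k: "k > 0" "\<And>\<xi> :: real^'n^'n. transpose \<xi> = \<xi> \<Longrightarrow> tensor_app (Cten P) \<xi> \<bullet> \<xi> \<ge> k * (norm \<xi>)\<^sup>2"
    using tensor_app_coercive[OF coefficients(3)] by metis
  have sym: "tensor_app (Cten P) x \<bullet> y = tensor_app (Cten P) y \<bullet> x" for x y
    using coefficients(3) by (intro tensor_app_symmetric) (simp add: elasticity_tensor_def)
  note E = energy_form[OF V_subspace V_op_strain linear_tensor_app sym k(1) k(2)[OF transpose_strain]]
  have E0: "psd_form ?V ?E"
    by (rule E(1))
  have FF: "F \<in> faces P M" if "F \<in> ?Fs" for F
    using that faces_on_faces by blast
  have ker: "traction P M F v x = 0" if v: "v \<in> ?V" "?E v v = 0" and F: "F \<in> ?Fs" "x \<in> F" for v F x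
  proof -
    note K = face_plus(1)[OF FF[OF F(1)]]
    have "tr (Kplus M F) (strain v) x = 0"
      using face_topology(2)[OF FF[OF F(1)]] F(2)
      by (intro tr_zero[OF cell_topology(1)[OF K]] E(2)[OF _ v K]) auto
    then show ?thesis
      by (simp add: traction_def linear_0[OF linear_tensor_app])
  qed
  obtain \<gamma>0 where \<gamma>0: "\<And>\<gamma>. \<gamma> > \<gamma>0 \<Longrightarrow> psd_form ?V (\<lambda>v w. ?E v w
      - (\<Sum>F\<in>?Fs. l2_ip surface_measure F (traction P M F v) w + l2_ip surface_measure F v (traction P M F w))
      + (\<Sum>F\<in>?Fs. \<gamma> / h_face P M F * l2_ip surface_measure F v w))"
    using nitsche_form_psd[where Fs="?Fs" and \<mu>=surface_measure and S="\<lambda>F. F" and T="traction P M" and U="\<lambda>F v. v"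
        and h="h_face P M", OF V_fin_dim E0]
      traction_op displacement_face_op h_face_pos FF ker by blast
  have eq: "A_form P M \<gamma> v w = ?E v w
      - (\<Sum>F\<in>?Fs. l2_ip surface_measure F (traction P M F v) w + l2_ip surface_measure F v (traction P M F w))
      + (\<Sum>F\<in>?Fs. \<gamma> / h_face P M F * l2_ip surface_measure F v w)" if "v \<in> ?V" "w \<in> ?V" for \<gamma> v w
  proof -
    have "ip (Omega P) (\<lambda>x. tensor_app (Cten P) (strain v x)) (strain w) = ?E v w"
      by (rule ip_domain_ops[OF V_op_stress V_op_strain that])
    then show ?thesis
      unfolding A_form_def a_form_def surface_ip_l2_ip sum.distrib by simp
  qed
  show ?thesis
    by (intro exI[of _ \<gamma>0] allI impI) (rule psd_form_cong[OF V_subspace eq \<gamma>0])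
qed

text \<open>The two pressure spaces differ in the faces and in \<open>U\<close>: the function itself
  on Dirichlet faces, or the jump on all faces. On an interior face the average flux vanishes
  because the traces from both sides do.\<close>

lemma B_form_psd: "\<exists>\<gamma>0. \<forall>\<gamma>>\<gamma>0. psd_form (Qh P M r ch) (B_form P M ch \<gamma>)"
proof -
  let ?W = "Qh P M r ch"
  let ?E = "\<lambda>v w. \<Sum>K\<in>cells M. l2_ip lebesgue K (\<lambda>x. Kmat P *v grad v x) (grad w)"
  obtain k where k: "k > 0" "\<And>\<xi>. (Kmat P *v \<xi>) \<bullet> \<xi> \<ge> k * (norm \<xi>)\<^sup>2"
    using permeability_coercive[OF coefficients(4)] by metis
  note E = energy_form[OF W_subspace W_op_grad linear_matrix permeability_symmetric[OF coefficients(4)] k]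
  have E0: "psd_form ?W ?E"
    by (rule E(1))
  have ker: "flux P M F v x = 0" if v: "v \<in> ?W" "?E v v = 0" and F: "F \<in> faces P M" "x \<in> F" for v F x
  proof -
    have tr0: "tr K (\<lambda>y. Kmat P *v grad v y) x = 0" if K: "K \<in> cells M" "F \<in> facets M K" for K
      using facet_topology(2)[OF K] F(2) E(2)[OF _ v K(1)]
      by (intro tr_zero[OF cell_topology(1)[OF K(1)]]) auto
    have "average P M F (\<lambda>y. Kmat P *v grad v y) x = 0"
      using tr0[OF face_plus[OF F(1)]] tr0[OF face_minus[OF F(1)]] by (auto simp: average_def)
    then show ?thesis
      by (simp add: flux_def)
  qed
  show ?thesis
  proof (cases ch)
    case Continuous
    let ?Fs = "faces_on P M (GpD P)"
    have FF: "F \<in> faces P M" if "F \<in> ?Fs" for F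
      using that faces_on_faces by blast
    obtain \<gamma>0 where \<gamma>0: "\<And>\<gamma>. \<gamma> > \<gamma>0 \<Longrightarrow> psd_form ?W (\<lambda>v w. ?E v w
        - (\<Sum>F\<in>?Fs. l2_ip surface_measure F (flux P M F v) w + l2_ip surface_measure F v (flux P M F w))
        + (\<Sum>F\<in>?Fs. \<gamma> / h_face P M F * l2_ip surface_measure F v w))"
      using nitsche_form_psd[where Fs="?Fs" and \<mu>=surface_measure and S="\<lambda>F. F" and T="flux P M" and U="\<lambda>F v. v"
        and h="h_face P M", OF W_fin_dim E0]
        flux_op pressure_face_op h_face_pos FF ker Continuous by blast
    have eq: "B_form P M Continuous \<gamma> v w = ?E v w
        - (\<Sum>F\<in>?Fs. l2_ip surface_measure F (flux P M F v) w + l2_ip surface_measure F v (flux P M F w))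
        + (\<Sum>F\<in>?Fs. \<gamma> / h_face P M F * l2_ip surface_measure F v w)" if "v \<in> ?W" "w \<in> ?W" for \<gamma> v w
    proof -
      have "ip (Omega P) (\<lambda>x. Kmat P *v grad v x) (grad w) = ?E v w"
        by (rule ip_domain_ops[OF W_op_flux W_op_grad that])
      then show ?thesis
        unfolding B_form.simps b_form_def surface_ip_l2_ip sum.distrib by simp
    qed
    have "psd_form ?W (B_form P M Continuous \<gamma>)" if "\<gamma> > \<gamma>0" for \<gamma>
      by (rule psd_form_cong[OF W_subspace eq \<gamma>0[OF that]])
    then show ?thesis
      unfolding Continuous by blast
  next
    case Discontinuous
    let ?Fs = "faces P M"
    obtain \<gamma>0 where \<gamma>0: "\<And>\<gamma>. \<gamma> > \<gamma>0 \<Longrightarrow> psd_form ?W (\<lambda>v w. ?E v w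
        - (\<Sum>F\<in>?Fs. l2_ip surface_measure F (flux P M F v) (jump P M F w) + l2_ip surface_measure F (jump P M F v) (flux P M F w))
        + (\<Sum>F\<in>?Fs. \<gamma> / h_face P M F * l2_ip surface_measure F (jump P M F v) (jump P M F w)))"
      using nitsche_form_psd[where Fs="?Fs" and \<mu>=surface_measure and S="\<lambda>F. F" and T="flux P M" and U="jump P M"
        and h="h_face P M", OF W_fin_dim E0]
        flux_op jump_op h_face_pos ker by blast
    then show ?thesis
      unfolding Discontinuous B_form.simps surface_ip_l2_ip ip_l2_ip by (intro exI[of _ \<gamma>0]) blast
  qed
qed

lemma C_form_bilin: "bilin_on (Vh P M r) (Qh P M r ch) (C_form P M)"
proof -
  have FF: "F \<in> faces P M" if "F \<in> faces_on P M (GuD P)" for F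
    using that faces_on_faces by blast
  have 1: "bilin_on (Vh P M r) (Qh P M r ch) (\<lambda>v q. ip (Omega P) (divergence v) q)"
    by (rule bilin_on_ip_domain[OF V_subspace W_subspace V_op_divergence W_op_id])
  have 2: "bilin_on (Vh P M r) (Qh P M r ch) (\<lambda>v q. \<Sum>F\<in>faces_on P M (GuD P).
      l2_ip surface_measure F (\<lambda>x. v x \<bullet> normal P M F x) (tr (Kplus M F) q))"
    by (intro bilin_on_setsum bilin_on_l2_ip normal_component_op pressure_trace_op FF)
  show ?thesis
    unfolding C_form_def[abs_def] surface_ip_l2_ip
    by (rule bilin_on_plus[OF bilin_on_mult[OF 1] bilin_on_mult[OF 2]])
qed

text \<open>A face is on \<open>G\<close> by definition only up to a null set; for closed
  \<open>G\<close> this is a true inclusion by \<open>face_subset\<close>, so the data restrict to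
  the face.\<close>

lemma boundary_data_L2:
  assumes F: "F \<in> faces_on P M G" and G: "closed G" and f: "L2_on surface_measure G f"
  shows "L2_on surface_measure F f"
  using face_topology(4)[of F] F faces_on_faces
  by (intro L2_on_subset[OF f face_subset[OF F G]]) auto

lemma normal_component_L2:
  assumes F: "F \<in> faces P M" and f: "L2_on surface_measure F f"
  shows "L2_on surface_measure F (\<lambda>x. f x \<bullet> normal P M F x)"
proof (rule L2_on_dominated[OF f, where B=1])
  have m: "(\<lambda>x. indicator F x *\<^sub>R f x) \<in> borel_measurable surface_measure"
    using f by (simp add: L2_on_iff)
  have "(\<lambda>x. (indicator F x *\<^sub>R f x) \<bullet> normal P M F x) \<in> borel_measurable surface_measure"
    unfolding normal_def
    by (rule borel_measurable_inner[OF m]) (simp add: borel_measurable_outer_normal cong: measurable_cong_sets)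
  then show "(\<lambda>x. indicat_real F x *\<^sub>R (f x \<bullet> normal P M F x)) \<in> borel_measurable surface_measure"
    by simp
  fix x
  have "norm (f x \<bullet> normal P M F x) \<le> norm (f x) * norm (normal P M F x)"
    by (simp add: Cauchy_Schwarz_ineq2)
  also have "\<dots> \<le> norm (f x) * 1"
    unfolding normal_def by (intro mult_left_mono norm_outer_normal norm_ge_zero)
  finally show "norm (f x \<bullet> normal P M F x) \<le> 1 * norm (f x)"
    by simp
qed

lemma closed_dirichlet: "closed (GuD P)" "closed (GpD P)"
  using problem by (auto simp: biot_problem_def boundary_splitting_def)

lemma F_functional_lin_on:
  assumes "admissible_data_at P M r ch T D t"
  shows "lin_on (Vh P M r) (F_functional P M \<gamma> D t)"
proof -
  have D: "L2_on surface_measure (GuD P) (uD D t)" "lin_on (Vh P M r) (f_pair D t)" "lin_on (Vh P M r) (tN_pair D t)"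
    using assms by (auto simp: admissible_data_at_def L2_derivative_def linear_functional_lin_on)
  have FF: "F \<in> faces P M" "L2_on surface_measure F (uD D t)" if "F \<in> faces_on P M (GuD P)" for F
    using that faces_on_faces boundary_data_L2[OF that closed_dirichlet(1) D(1)] by blast+
  have "lin_on (Vh P M r) (a_form P M \<gamma> (uD D t))"
    unfolding a_form_def[abs_def] surface_ip_l2_ip
    by (intro lin_on_plus lin_on_uminus lin_on_setsum lin_on_mult lin_on_l2_ip(2)[OF traction_op]
        lin_on_l2_ip(2)[OF displacement_face_op] FF)
  then show ?thesis
    unfolding F_functional_def[abs_def] by (intro lin_on_plus lin_on_minus D)
qed

lemma G_functional_lin_on:
  assumes "admissible_data_at P M r ch T D t"
  shows "lin_on (Qh P M r ch) (G_functional P M ch \<gamma> D t)"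
proof -
  have D: "L2_on surface_measure (GuD P) (vD D t)" "L2_on surface_measure (GpD P) (pD D t)"
    "lin_on (Qh P M r ch) (g_pair D t)"
    using assms by (auto simp: admissible_data_at_def L2_derivative_def linear_functional_lin_on)
  have u: "F \<in> faces P M" "L2_on surface_measure F (\<lambda>x. vD D t x \<bullet> normal P M F x)" if "F \<in> faces_on P M (GuD P)" for F
    using that faces_on_faces boundary_data_L2[OF that closed_dirichlet(1) D(1)] normal_component_L2 by blast+
  have p: "F \<in> faces P M" "L2_on surface_measure F (pD D t)" if "F \<in> faces_on P M (GpD P)" for F
    using that faces_on_faces boundary_data_L2[OF that closed_dirichlet(2) D(2)] by blast+
  show ?thesis
  proof (cases ch)
    case Continuous
    have N: "lin_on (Qh P M r Continuous) (pN_pair D t (GpN P))"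
      using assms Continuous by (auto simp: admissible_data_at_def linear_functional_lin_on)
    have "lin_on (Qh P M r Continuous) (b_form P M \<gamma> (pD D t))"
      unfolding b_form_def[abs_def] surface_ip_l2_ip
      by (intro lin_on_plus lin_on_uminus lin_on_setsum lin_on_mult lin_on_l2_ip(2)[OF flux_op]
          lin_on_l2_ip(2)[OF pressure_face_op] p)
    moreover have "lin_on (Qh P M r Continuous) (\<lambda>\<psi>. \<Sum>F\<in>faces_on P M (GuD P).
        l2_ip surface_measure F (\<lambda>x. vD D t x \<bullet> normal P M F x) \<psi>)"
      by (intro lin_on_setsum lin_on_l2_ip(2)[OF pressure_face_op] u)
    ultimately show ?thesis
      using D(3) N unfolding Continuous G_functional.simps[abs_def] surface_ip_l2_ip
      by (intro lin_on_plus lin_on_minus lin_on_mult)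
  next
    case Discontinuous
    have "lin_on (Qh P M r Discontinuous) (\<lambda>\<psi>. pN_pair D t F (jump P M F \<psi>))" if "F \<in> faces_on P M (GpN P)" for F
      using assms Discontinuous that by (auto simp: admissible_data_at_def linear_functional_lin_on)
    then show ?thesis
      using D(3) unfolding Discontinuous G_functional.simps[abs_def] surface_ip_l2_ip
      by (intro lin_on_plus lin_on_minus lin_on_mult lin_on_setsum lin_on_l2_ip(2)[OF pressure_trace_op]
          lin_on_l2_ip(2)[OF flux_op] lin_on_l2_ip(2)[OF jump_op] u p)
  qed
qed

end

section \<open>Polynomials in time\<close>

definition time_polynomial :: "nat \<Rightarrow> real set \<Rightarrow> (nat \<Rightarrow> 'a \<Rightarrow> 'b::real_vector) \<Rightarrow> real \<Rightarrow> 'a \<Rightarrow> 'b" where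
  "time_polynomial k I c = (\<lambda>s. if s \<in> I then peval k c s else 0)"

lemma peval_apply: "peval k c s x = (\<Sum>j\<le>k. s ^ j *\<^sub>R c j x)"
  and pdiff_apply: "pdiff k c s x = (\<Sum>j\<le>k. (real j * s ^ (j - 1)) *\<^sub>R c j x)"
  by (simp_all add: peval_def pdiff_def sum_fun_apply)

lemma time_polynomial_in: "(\<And>j. c j \<in> B) \<Longrightarrow> time_polynomial k I c \<in> time_poly k I B"
  unfolding time_poly_def time_polynomial_def
  by (auto simp: peval_apply fun_eq_iff intro!: exI[of _ c])

lemma time_polyE:
  assumes "w \<in> time_poly k I B" "subspace B"
  obtains c where "\<And>j. c j \<in> B" "\<And>j. j > k \<Longrightarrow> c j = 0" "w = time_polynomial k I c"
proof -
  obtain c where c: "\<And>j. j \<le> k \<Longrightarrow> c j \<in> B" "\<And>s. s \<in> I \<Longrightarrow> w s = (\<lambda>x. \<Sum>j\<le>k. s ^ j *\<^sub>R c j x)"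
    "\<And>s. s \<notin> I \<Longrightarrow> w s = (\<lambda>x. 0)"
    using assms(1) unfolding time_poly_def by blast
  \<comment> \<open>Coefficients above \<open>k\<close> are replaced by 0, as
    \<open>biot_homogeneous\<close> expects.\<close>
  define d where "d j = (if j \<le> k then c j else 0)" for j
  have "w = time_polynomial k I d"
    using c(2,3) by (auto simp: fun_eq_iff time_polynomial_def peval_apply d_def)
  moreover have "d j \<in> B" for j
    using c(1) subspace_0[OF assms(2)] by (simp add: d_def)
  ultimately show ?thesis
    using that[of d] by (simp add: d_def)
qed

lemma time_polynomial_lincomb:
  "a *\<^sub>R time_polynomial k I c + b *\<^sub>R time_polynomial k I d = time_polynomial k I (\<lambda>j. a *\<^sub>R c j + b *\<^sub>R d j)"
  by (auto simp: fun_eq_iff time_polynomial_def peval_apply scaleR_sum_right sum.distrib algebra_simps)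

lemma time_polynomial_zero: "time_polynomial k I (\<lambda>j. 0) = 0"
  by (auto simp: fun_eq_iff time_polynomial_def peval_apply)

lemma time_poly_subspace:
  assumes "subspace B"
  shows "subspace (time_poly k I B)"
proof (rule subspaceI_lincomb)
  have "time_polynomial k I (\<lambda>j. 0) \<in> time_poly k I B"
    by (intro time_polynomial_in subspace_0 assms)
  then show "0 \<in> time_poly k I B"
    by (simp only: time_polynomial_zero)
  fix x y a b assume "x \<in> time_poly k I B" "y \<in> time_poly k I B"
  then obtain c d where "\<And>j. c j \<in> B" "x = time_polynomial k I c" "\<And>j. d j \<in> B" "y = time_polynomial k I d"
    using time_polyE[OF _ assms] by metis
  then show "a *\<^sub>R x + b *\<^sub>R y \<in> time_poly k I B"
    unfolding time_polynomial_lincomb by (auto simp: time_polynomial_lincomb intro!: time_polynomial_in subspace_add subspace_scale assms)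
qed

lemma time_poly_fin_dim:
  assumes "fin_dim B"
  shows "fin_dim (time_poly k I B)"
proof -
  obtain C where C: "finite C" "B \<subseteq> span C" and B: "subspace B"
    using assms unfolding fin_dim_def by blast
  define e where "e j f = (\<lambda>s x. if s \<in> I then s ^ j *\<^sub>R f x else 0)" for j and f :: "'a \<Rightarrow> 'b"
  have lin: "linear (e j)" for j
    by (rule linearI) (auto simp: e_def fun_eq_iff algebra_simps)
  have "time_poly k I B \<subseteq> span (\<Union>j\<le>k. e j ` C)"
  proof
    fix w assume "w \<in> time_poly k I B"
    then obtain c where c: "\<And>j. c j \<in> B" "w = time_polynomial k I c"
      using time_polyE[OF _ B] by metis
    have "w = (\<Sum>j\<le>k. e j (c j))"
      unfolding c(2) by (auto simp: fun_eq_iff time_polynomial_def peval_apply e_def sum_fun_apply)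
    also have "\<dots> \<in> span (\<Union>j\<le>k. e j ` C)"
    proof (rule span_sum)
      fix j assume j: "j \<in> {..k}"
      have "e j (c j) \<in> e j ` span C"
        using c(1) C(2) by blast
      also have "\<dots> = span (e j ` C)"
        by (rule linear_span_image[OF lin, symmetric])
      also have "\<dots> \<subseteq> span (\<Union>j\<le>k. e j ` C)"
        using j by (intro span_mono) blast
      finally show "e j (c j) \<in> span (\<Union>j\<le>k. e j ` C)" .
    qed
    finally show "w \<in> span (\<Union>j\<le>k. e j ` C)" .
  qed
  moreover have "finite (\<Union>j\<le>k. e j ` C)"
    using C(1) by simp
  ultimately show ?thesis
    unfolding fin_dim_def using time_poly_subspace[OF B] by blast
qed

lemma time_polynomial_has_vector_derivative:
  fixes c :: "nat \<Rightarrow> 'a \<Rightarrow> 'b::real_normed_vector"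
  assumes "s \<in> I"
  shows "((\<lambda>\<sigma>. time_polynomial k I c \<sigma> x) has_vector_derivative pdiff k c s x) (at s within I)"
proof -
  have "((\<lambda>\<sigma>. \<Sum>j\<le>k. \<sigma> ^ j *\<^sub>R c j x) has_vector_derivative pdiff k c s x) (at s within I)"
    unfolding pdiff_apply
  proof (rule has_vector_derivative_sum)
    fix j
    have "((\<lambda>\<sigma>::real. \<sigma> ^ j) has_vector_derivative (real j * s ^ (j - 1))) (at s within I)"
      by (rule has_real_derivative_iff_has_vector_derivative[THEN iffD1])
        (auto intro!: derivative_eq_intros)
    then show "((\<lambda>\<sigma>. \<sigma> ^ j *\<^sub>R c j x) has_vector_derivative (real j * s ^ (j - 1)) *\<^sub>R c j x) (at s within I)"
      by (rule bounded_linear.has_vector_derivative[OF bounded_linear_scaleR_left])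
  qed
  then show ?thesis
    by (rule has_vector_derivative_transform[OF assms, rotated]) (simp add: time_polynomial_def peval_apply)
qed

lemma dt_time_fun:
  fixes c :: "nat \<Rightarrow> 'a \<Rightarrow> 'b::real_normed_vector"
  assumes s: "s \<in> {a<..b}"
  shows "dt {a<..b} (time_polynomial k {a<..b} c) s = pdiff k c s"
proof
  fix x
  \<comment> \<open>At the right end point, which is a Radau node, the derivative is one-sided; the
    points to the left of \<open>s\<close> make it unique.\<close>
  have "s islimpt {a<..<s}"
    using s by (intro islimpt_greaterThanLessThan2) auto
  then have "s islimpt {a<..b}"
    by (rule islimpt_subset) (use s in auto)
  then have "at s within {a<..b} \<noteq> bot"
    by (simp add: trivial_limit_within)
  then show "dt {a<..b} (time_polynomial k {a<..b} c) s x = pdiff k c s x"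
    unfolding dt_def using time_polynomial_has_vector_derivative[OF s] by (rule vector_derivative_within)
qed

text \<open>The point \<open>a\<close> lies outside the half-open interval, where the function is
  set to 0; the limit sees only the polynomial.\<close>

lemma right_lim_time_fun:
  fixes c :: "nat \<Rightarrow> 'a \<Rightarrow> 'b::real_normed_vector"
  assumes ab: "a < b"
  shows "right_lim a (time_polynomial k {a<..b} c) = peval k c a"
proof
  fix x
  have "((\<lambda>\<sigma>. \<Sum>j\<le>k. \<sigma> ^ j *\<^sub>R c j x) \<longlongrightarrow> (\<Sum>j\<le>k. a ^ j *\<^sub>R c j x)) (at_right a)"
    by (intro tendsto_intros)
  moreover have "eventually (\<lambda>\<sigma>. (\<Sum>j\<le>k. \<sigma> ^ j *\<^sub>R c j x) = time_polynomial k {a<..b} c \<sigma> x) (at_right a)"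
    using eventually_at_right_less eventually_at_right_real[OF ab]
    by eventually_elim (simp add: time_polynomial_def peval_apply)
  ultimately have "((\<lambda>\<sigma>. time_polynomial k {a<..b} c \<sigma> x) \<longlongrightarrow> (\<Sum>j\<le>k. a ^ j *\<^sub>R c j x)) (at_right a)"
    by (rule Lim_transform_eventually)
  then show "right_lim a (time_polynomial k {a<..b} c) x = peval k c a x"
    unfolding right_lim_def peval_apply by (intro tendsto_Lim) auto
qed

lemma time_polynomial_eval: "s \<in> I \<Longrightarrow> time_polynomial k I c s = peval k c s"
  by (simp add: time_polynomial_def)

lemma peval_lincomb: "peval k (\<lambda>j. a *\<^sub>R c j + b *\<^sub>R d j) s = a *\<^sub>R peval k c s + b *\<^sub>R peval k d s"
  and pdiff_lincomb: "pdiff k (\<lambda>j. a *\<^sub>R c j + b *\<^sub>R d j) s = a *\<^sub>R pdiff k c s + b *\<^sub>R pdiff k d s"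
  by (simp_all add: peval_def pdiff_def scaleR_sum_right sum.distrib algebra_simps)

lemma time_poly_ops:
  fixes B :: "('a \<Rightarrow> 'b::real_normed_vector) set"
  assumes B: "subspace B" and ab: "a < b"
  shows "\<And>s. s \<in> {a<..b} \<Longrightarrow> lin_on (time_poly k {a<..b} B) (\<lambda>w. w s)"
    "\<And>s w. s \<in> {a<..b} \<Longrightarrow> w \<in> time_poly k {a<..b} B \<Longrightarrow> w s \<in> B"
    "\<And>s. s \<in> {a<..b} \<Longrightarrow> lin_on (time_poly k {a<..b} B) (\<lambda>w. dt {a<..b} w s)"
    "\<And>s w. s \<in> {a<..b} \<Longrightarrow> w \<in> time_poly k {a<..b} B \<Longrightarrow> dt {a<..b} w s \<in> B"
    "lin_on (time_poly k {a<..b} B) (right_lim a)"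
    "\<And>w. w \<in> time_poly k {a<..b} B \<Longrightarrow> right_lim a w \<in> B"
proof -
  show "lin_on (time_poly k {a<..b} B) (\<lambda>w. w s)" for s
    by (rule lin_onI) simp
  show "lin_on (time_poly k {a<..b} B) (\<lambda>w. dt {a<..b} w s)" if s: "s \<in> {a<..b}" for s
  proof (rule lin_onI)
    fix x y :: "real \<Rightarrow> 'a \<Rightarrow> 'b" and \<alpha> \<beta> :: real
    assume "x \<in> time_poly k {a<..b} B" "y \<in> time_poly k {a<..b} B"
    then obtain c d where "x = time_polynomial k {a<..b} c" "y = time_polynomial k {a<..b} d"
      using time_polyE[OF _ B] by metis
    then show "dt {a<..b} (\<alpha> *\<^sub>R x + \<beta> *\<^sub>R y) s = \<alpha> *\<^sub>R dt {a<..b} x s + \<beta> *\<^sub>R dt {a<..b} y s"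
      by (simp add: time_polynomial_lincomb dt_time_fun[OF s] pdiff_lincomb del: greaterThanAtMost_iff)
  qed
  show "lin_on (time_poly k {a<..b} B) (right_lim a)"
  proof (rule lin_onI)
    fix x y :: "real \<Rightarrow> 'a \<Rightarrow> 'b" and \<alpha> \<beta> :: real
    assume "x \<in> time_poly k {a<..b} B" "y \<in> time_poly k {a<..b} B"
    then obtain c d where "x = time_polynomial k {a<..b} c" "y = time_polynomial k {a<..b} d"
      using time_polyE[OF _ B] by metis
    then show "right_lim a (\<alpha> *\<^sub>R x + \<beta> *\<^sub>R y) = \<alpha> *\<^sub>R right_lim a x + \<beta> *\<^sub>R right_lim a y"
      by (simp add: time_polynomial_lincomb right_lim_time_fun[OF ab] peval_lincomb)
  qed
  fix w assume "w \<in> time_poly k {a<..b} B"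
  then obtain c where c: "\<And>j. c j \<in> B" "w = time_polynomial k {a<..b} c"
    using time_polyE[OF _ B] by metis
  show "right_lim a w \<in> B"
    unfolding c(2) right_lim_time_fun[OF ab] by (rule peval_in[OF B c(1)])
  fix s assume s: "s \<in> {a<..b}"
  show "w s \<in> B"
    unfolding c(2) time_polynomial_eval[OF s] by (rule peval_in[OF B c(1)])
  show "dt {a<..b} w s \<in> B"
    unfolding c(2) dt_time_fun[OF s] by (rule pdiff_in[OF B c(1)])
qed

section \<open>The time step as one linear system\<close>

definition lin_into :: "'a::real_vector set \<Rightarrow> 'b::real_vector set \<Rightarrow> ('a \<Rightarrow> 'b) \<Rightarrow> bool" where
  "lin_into X V g \<longleftrightarrow> lin_on X g \<and> (\<forall>x\<in>X. g x \<in> V)"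

lemma lin_into_compose: "lin_into P V g \<Longrightarrow> lin_into X P f \<Longrightarrow> lin_into X V (\<lambda>x. g (f x))"
  by (auto simp: lin_into_def lin_on_def)

lemma lin_on_compose_into: "lin_on V f \<Longrightarrow> lin_into X V g \<Longrightarrow> lin_on X (\<lambda>x. f (g x))"
  by (auto simp: lin_into_def lin_on_def)

lemma bilin_on_compose:
  "bilin_on V W f \<Longrightarrow> lin_into X V g \<Longrightarrow> lin_into Y W h \<Longrightarrow> bilin_on X Y (\<lambda>x y. f (g x) (h y))"
  by (auto simp: bilin_on_def lin_into_def lin_on_def)

lemma bilin_on_compose_swap:
  "bilin_on W V f \<Longrightarrow> lin_into X V g \<Longrightarrow> lin_into Y W h \<Longrightarrow> bilin_on X Y (\<lambda>x y. f (h y) (g x))"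
  by (auto simp: bilin_on_def lin_into_def lin_on_def)

text \<open>Joins the three equations into one on the product space, the shape that
  \<open>galerkin\<close> takes; test triples with two zero components separate them again.\<close>

lemma test_triples:
  fixes L1 R1 :: "'a::real_vector \<Rightarrow> real" and L2 R2 :: "'b::real_vector \<Rightarrow> real"
    and L3 R3 :: "'c::real_vector \<Rightarrow> real"
  assumes sub: "subspace P1" "subspace P2" "subspace P3"
    and lin: "lin_on P1 L1" "lin_on P1 R1" "lin_on P2 L2" "lin_on P2 R2" "lin_on P3 L3" "lin_on P3 R3"
  shows "(\<forall>Y\<in>P1 \<times> P2 \<times> P3. L1 (fst Y) + L2 (fst (snd Y)) + L3 (snd (snd Y)) =
      R1 (fst Y) + R2 (fst (snd Y)) + R3 (snd (snd Y))) \<longleftrightarrow>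
    (\<forall>x\<in>P1. \<forall>y\<in>P2. \<forall>z\<in>P3. L1 x = R1 x \<and> L2 y = R2 y \<and> L3 z = R3 z)" (is "?l \<longleftrightarrow> ?r")
proof
  have 0: "L1 0 = 0" "R1 0 = 0" "L2 0 = 0" "R2 0 = 0" "L3 0 = 0" "R3 0 = 0"
    using lin sub by (auto intro: lin_on_zero subspace_0)
  assume l: ?l
  show ?r
  proof (intro ballI conjI)
    fix x y z assume "x \<in> P1" "y \<in> P2" "z \<in> P3"
    then show "L1 x = R1 x" "L2 y = R2 y" "L3 z = R3 z"
      using l[rule_format, of "(x, 0, 0)"] l[rule_format, of "(0, y, 0)"] l[rule_format, of "(0, 0, z)"] sub
      by (auto simp: 0 subspace_0)
  qed
qed auto

text \<open>Space enters only through the abstract forms and functionals, time only through the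
  rule. Linearity of \<open>F\<close> and \<open>G\<close> at the nodes makes the right-hand side a
  functional on the product space.\<close>

theorem time_step_unique_solution:
  fixes V :: "('a \<Rightarrow> 'b::real_normed_vector) set" and W :: "('a \<Rightarrow> 'c::real_normed_vector) set"
  assumes forms: "biot_forms V W mV mW A C B \<rho> c" and fin: "fin_dim V" "fin_dim W"
    and radau: "radau_rule k a b s w" and nodes: "\<And>\<mu>. \<mu> \<in> {1..k+1} \<Longrightarrow> s \<mu> \<in> {a<..b}"
    and F: "\<And>\<mu>. \<mu> \<in> {1..k+1} \<Longrightarrow> lin_on V (F \<mu>)" and G: "\<And>\<mu>. \<mu> \<in> {1..k+1} \<Longrightarrow> lin_on W (G \<mu>)"
    and data: "u0 \<in> V" "v0 \<in> V" "p0 \<in> W"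
    and I: "I = {a<..b}"
  shows "\<exists>!(u, v, p). u \<in> time_poly k I V \<and> v \<in> time_poly k I V \<and> p \<in> time_poly k I W \<and>
    (\<forall>\<phi>\<in>time_poly k I V. \<forall>\<eta>\<in>time_poly k I V. \<forall>\<psi>\<in>time_poly k I W.
      (\<Sum>\<mu>=1..k+1. w \<mu> * (mV (dt I u (s \<mu>)) (\<phi> (s \<mu>)) - mV (v (s \<mu>)) (\<phi> (s \<mu>))))
        + mV (right_lim a u) (right_lim a \<phi>) = mV u0 (right_lim a \<phi>) \<and>
      (\<Sum>\<mu>=1..k+1. w \<mu> * (\<rho> * mV (dt I v (s \<mu>)) (\<eta> (s \<mu>)) + A (u (s \<mu>)) (\<eta> (s \<mu>)) + C (\<eta> (s \<mu>)) (p (s \<mu>))))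
        + \<rho> * mV (right_lim a v) (right_lim a \<eta>) =
        (\<Sum>\<mu>=1..k+1. w \<mu> * F \<mu> (\<eta> (s \<mu>))) + \<rho> * mV v0 (right_lim a \<eta>) \<and>
      (\<Sum>\<mu>=1..k+1. w \<mu> * (c * mW (dt I p (s \<mu>)) (\<psi> (s \<mu>)) - C (v (s \<mu>)) (\<psi> (s \<mu>)) + B (p (s \<mu>)) (\<psi> (s \<mu>))))
        + c * mW (right_lim a p) (right_lim a \<psi>) =
        (\<Sum>\<mu>=1..k+1. w \<mu> * G \<mu> (\<psi> (s \<mu>))) + c * mW p0 (right_lim a \<psi>))"
proof -
  interpret biot_forms V W mV mW A C B \<rho> c by fact
  interpret radau_rule k a b s w by fact
  define PV where "PV = time_poly k I V"
  define PW where "PW = time_poly k I W"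
  define S where "S = PV \<times> PV \<times> PW"
  have sub: "subspace PV" "subspace PW"
    unfolding PV_def PW_def by (intro time_poly_subspace V W)+
  have finS: "fin_dim S"
    unfolding S_def PV_def PW_def by (intro fin_dim_Times time_poly_fin_dim fin)
  note opsV = time_poly_ops[OF V interval, where k=k, folded I, folded PV_def]
  note opsW = time_poly_ops[OF W interval, where k=k, folded I, folded PW_def]
  have nodes: "\<mu> \<in> {1..k+1} \<Longrightarrow> s \<mu> \<in> I" for \<mu>
    using nodes I by simp
  have comp: "lin_into S PV fst" "lin_into S PV (\<lambda>X. fst (snd X))" "lin_into S PW (\<lambda>X. snd (snd X))"
    by (auto simp: lin_into_def lin_on_def S_def)
  have evV: "\<mu> \<in> {1..k+1} \<Longrightarrow> lin_into PV V (\<lambda>x. x (s \<mu>))" "\<mu> \<in> {1..k+1} \<Longrightarrow> lin_into PV V (\<lambda>x. dt I x (s \<mu>))"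
    "lin_into PV V (right_lim a)" for \<mu>
    using opsV nodes by (auto simp: lin_into_def)
  have evW: "\<mu> \<in> {1..k+1} \<Longrightarrow> lin_into PW W (\<lambda>x. x (s \<mu>))" "\<mu> \<in> {1..k+1} \<Longrightarrow> lin_into PW W (\<lambda>x. dt I x (s \<mu>))"
    "lin_into PW W (right_lim a)" for \<mu>
    using opsW nodes by (auto simp: lin_into_def)
  have bil: "bilin_on V V mV" "bilin_on W W mW" "bilin_on V V A" "bilin_on W W B"
    using mV mW A B by (auto simp: psd_form_def)
  define L1 where "L1 X \<phi> = (\<Sum>\<mu>=1..k+1. w \<mu> * (mV (dt I (fst X) (s \<mu>)) (\<phi> (s \<mu>)) - mV (fst (snd X) (s \<mu>)) (\<phi> (s \<mu>))))
    + mV (right_lim a (fst X)) (right_lim a \<phi>)" 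
    for X :: "(real \<Rightarrow> 'a \<Rightarrow> 'b) \<times> (real \<Rightarrow> 'a \<Rightarrow> 'b) \<times> (real \<Rightarrow> 'a \<Rightarrow> 'c)" and \<phi>
  define L2 where "L2 X \<eta> = (\<Sum>\<mu>=1..k+1. w \<mu> * (\<rho> * mV (dt I (fst (snd X)) (s \<mu>)) (\<eta> (s \<mu>)) + A (fst X (s \<mu>)) (\<eta> (s \<mu>))
    + C (\<eta> (s \<mu>)) (snd (snd X) (s \<mu>)))) + \<rho> * mV (right_lim a (fst (snd X))) (right_lim a \<eta>)" for X \<eta>
  define L3 where "L3 X \<psi> = (\<Sum>\<mu>=1..k+1. w \<mu> * (c * mW (dt I (snd (snd X)) (s \<mu>)) (\<psi> (s \<mu>)) - C (fst (snd X) (s \<mu>)) (\<psi> (s \<mu>))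
    + B (snd (snd X) (s \<mu>)) (\<psi> (s \<mu>)))) + c * mW (right_lim a (snd (snd X))) (right_lim a \<psi>)"
    for X :: "(real \<Rightarrow> 'a \<Rightarrow> 'b) \<times> (real \<Rightarrow> 'a \<Rightarrow> 'b) \<times> (real \<Rightarrow> 'a \<Rightarrow> 'c)" and \<psi>
  define R1 where "R1 \<phi> = mV u0 (right_lim a \<phi>)" for \<phi> :: "real \<Rightarrow> 'a \<Rightarrow> 'b"
  define R2 where "R2 \<eta> = (\<Sum>\<mu>=1..k+1. w \<mu> * F \<mu> (\<eta> (s \<mu>))) + \<rho> * mV v0 (right_lim a \<eta>)" for \<eta>
  define R3 where "R3 \<psi> = (\<Sum>\<mu>=1..k+1. w \<mu> * G \<mu> (\<psi> (s \<mu>))) + c * mW p0 (right_lim a \<psi>)" for \<psi>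
  have L1: "bilin_on S PV L1"
    unfolding L1_def[abs_def]
    by (intro bilin_on_plus bilin_on_setsum bilin_on_mult bilin_on_minus bilin_on_compose[OF bil(1)]
        evV lin_into_compose[OF evV(1) comp(2)] lin_into_compose[OF evV(2) comp(1)] lin_into_compose[OF evV(3) comp(1)])
  have L2: "bilin_on S PV L2"
    unfolding L2_def[abs_def]
    by (intro bilin_on_plus bilin_on_setsum bilin_on_mult bilin_on_compose[OF bil(1)] bilin_on_compose[OF bil(3)]
        bilin_on_compose_swap[OF C] evV
        lin_into_compose[OF evV(1) comp(1)] lin_into_compose[OF evV(2) comp(2)] lin_into_compose[OF evV(3) comp(2)]
        lin_into_compose[OF evW(1) comp(3)])
  have L3: "bilin_on S PW L3"
    unfolding L3_def[abs_def]
    by (intro bilin_on_plus bilin_on_minus bilin_on_setsum bilin_on_mult bilin_on_compose[OF bil(2)] bilin_on_compose[OF bil(4)]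
        bilin_on_compose[OF C] evW
        lin_into_compose[OF evW(1) comp(3)] lin_into_compose[OF evW(2) comp(3)] lin_into_compose[OF evW(3) comp(3)]
        lin_into_compose[OF evV(1) comp(2)])
  have R: "lin_on PV R1" "lin_on PV R2" "lin_on PW R3"
    unfolding R1_def[abs_def] R2_def[abs_def] R3_def[abs_def]
    by (intro lin_on_plus lin_on_setsum lin_on_mult lin_on_compose_into[OF F evV(1)] lin_on_compose_into[OF G evW(1)]
        lin_on_compose_into[OF bilin_on_right[OF bil(1)] evV(3)] lin_on_compose_into[OF bilin_on_right[OF bil(2)] evW(3)]
        data | assumption)+
  define bf where "bf X Y = L1 X (fst Y) + L2 X (fst (snd Y)) + L3 X (snd (snd Y))" for X Y
  define l where "l Y = R1 (fst Y) + R2 (fst (snd Y)) + R3 (snd (snd Y))" for Y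
  have idS: "lin_into S S (\<lambda>X. X)"
    by (simp add: lin_into_def lin_on_def)
  have bf: "bilin_on S S bf"
    unfolding bf_def[abs_def]
    by (intro bilin_on_plus bilin_on_compose[OF L1 idS comp(1)] bilin_on_compose[OF L2 idS comp(2)]
        bilin_on_compose[OF L3 idS comp(3)])
  have l: "lin_on S l"
    unfolding l_def[abs_def]
    by (intro lin_on_plus lin_on_compose_into[OF R(1) comp(1)] lin_on_compose_into[OF R(2) comp(2)]
        lin_on_compose_into[OF R(3) comp(3)])
  have nondeg: "X = 0" if X: "X \<in> S" and zero: "\<And>Y. Y \<in> S \<Longrightarrow> bf X Y = 0" for X
  proof -
    obtain u v p where X_eq: "X = (u, v, p)"
      by (metis prod.collapse)
    have "u \<in> PV" "v \<in> PV" "p \<in> PW"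
      using X by (auto simp: X_eq S_def)
    then obtain cu cv cp where
      cu: "\<And>j. cu j \<in> V" "\<And>j. j > k \<Longrightarrow> cu j = 0" "u = time_polynomial k I cu" and
      cv: "\<And>j. cv j \<in> V" "\<And>j. j > k \<Longrightarrow> cv j = 0" "v = time_polynomial k I cv" and
      cp: "\<And>j. cp j \<in> W" "\<And>j. j > k \<Longrightarrow> cp j = 0" "p = time_polynomial k I cp"
      unfolding PV_def PW_def by (metis (no_types, lifting) time_polyE[OF _ V] time_polyE[OF _ W])
    have "\<forall>x\<in>PV. \<forall>y\<in>PV. \<forall>z\<in>PW. L1 X x = 0 \<and> L2 X y = 0 \<and> L3 X z = 0"
      using test_triples[OF sub(1,1,2) bilin_on_right[OF L1 X] lin_on_const_zero bilin_on_right[OF L2 X] lin_on_const_zero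
          bilin_on_right[OF L3 X] lin_on_const_zero] zero
      unfolding S_def bf_def by simp
    then have test: "L1 X x = 0" "L2 X x = 0" "L3 X z = 0" if "x \<in> PV" "z \<in> PW" for x z
      using that by blast+
    have z0: "0 \<in> PV" "0 \<in> PW"
      by (rule subspace_0[OF sub(1)], rule subspace_0[OF sub(2)])
    have ev: "x \<in> {1..k+1} \<Longrightarrow> time_polynomial k I d (s x) = peval k d (s x)" for x and d :: "nat \<Rightarrow> 'a \<Rightarrow> 'd::real_normed_vector"
      by (rule time_polynomial_eval[OF nodes])
    have dt: "x \<in> {1..k+1} \<Longrightarrow> dt I (time_polynomial k I d) (s x) = pdiff k d (s x)" for x and d :: "nat \<Rightarrow> 'a \<Rightarrow> 'd::real_normed_vector"
      using nodes unfolding I by (rule dt_time_fun)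
    have rl: "right_lim a (time_polynomial k I d) = peval k d a" for d :: "nat \<Rightarrow> 'a \<Rightarrow> 'd::real_normed_vector"
      unfolding I by (rule right_lim_time_fun[OF interval])
    interpret biot_homogeneous k a b s w V W mV mW A C B \<rho> c cu cv cp
    proof
      fix \<phi> :: "nat \<Rightarrow> 'a \<Rightarrow> 'b" assume \<phi>: "\<And>j. \<phi> j \<in> V"
      have \<phi>P: "time_polynomial k I \<phi> \<in> PV"
        unfolding PV_def by (rule time_polynomial_in[OF \<phi>])
      show "(\<Sum>\<mu>=1..k+1. w \<mu> * (mV (pdiff k cu (s \<mu>)) (peval k \<phi> (s \<mu>)) - mV (peval k cv (s \<mu>)) (peval k \<phi> (s \<mu>))))
        + mV (peval k cu a) (peval k \<phi> a) = 0"
        using test(1)[OF \<phi>P z0(2)] unfolding L1_def X_eq cu(3) cv(3) by (simp add: ev dt rl del: sum.cl_ivl_Suc)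
      show "(\<Sum>\<mu>=1..k+1. w \<mu> * (\<rho> * mV (pdiff k cv (s \<mu>)) (peval k \<phi> (s \<mu>)) + A (peval k cu (s \<mu>)) (peval k \<phi> (s \<mu>))
        + C (peval k \<phi> (s \<mu>)) (peval k cp (s \<mu>)))) + \<rho> * mV (peval k cv a) (peval k \<phi> a) = 0"
        using test(2)[OF \<phi>P z0(2)] unfolding L2_def X_eq cu(3) cv(3) cp(3) by (simp add: ev dt rl del: sum.cl_ivl_Suc)
    next
      fix \<psi> :: "nat \<Rightarrow> 'a \<Rightarrow> 'c" assume \<psi>: "\<And>j. \<psi> j \<in> W"
      have \<psi>P: "time_polynomial k I \<psi> \<in> PW"
        unfolding PW_def by (rule time_polynomial_in[OF \<psi>])
      show "(\<Sum>\<mu>=1..k+1. w \<mu> * (c * mW (pdiff k cp (s \<mu>)) (peval k \<psi> (s \<mu>)) - C (peval k cv (s \<mu>)) (peval k \<psi> (s \<mu>))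
        + B (peval k cp (s \<mu>)) (peval k \<psi> (s \<mu>)))) + c * mW (peval k cp a) (peval k \<psi> a) = 0"
        using test(3)[OF z0(1) \<psi>P] unfolding L3_def X_eq cv(3) cp(3) by (simp add: ev dt rl del: sum.cl_ivl_Suc)
    qed (use cu(1,2) cv(1,2) cp(1,2) in auto)
    have "cu = (\<lambda>_. 0)" "cv = (\<lambda>_. 0)" "cp = (\<lambda>_. 0)"
      using displacement_zero velocity_zero pressure_zero by blast+
    then show "X = 0"
      by (simp only: X_eq cu(3) cv(3) cp(3) zero_prod_def time_polynomial_zero)
  qed
  have equations: "(\<forall>Y\<in>S. bf X Y = l Y) \<longleftrightarrow>
      (\<forall>x\<in>PV. \<forall>y\<in>PV. \<forall>z\<in>PW. L1 X x = R1 x \<and> L2 X y = R2 y \<and> L3 X z = R3 z)" if X: "X \<in> S" for X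
    unfolding S_def bf_def l_def
    by (rule test_triples[OF sub(1,1,2) bilin_on_right[OF L1 X] R(1) bilin_on_right[OF L2 X] R(2)
          bilin_on_right[OF L3 X] R(3)])
  have "\<exists>!X. X \<in> S \<and> (\<forall>Y\<in>S. bf X Y = l Y)"
    by (rule galerkin[OF finS bf l nondeg])
  then have "\<exists>!X. X \<in> S \<and> (\<forall>x\<in>PV. \<forall>y\<in>PV. \<forall>z\<in>PW. L1 X x = R1 x \<and> L2 X y = R2 y \<and> L3 X z = R3 z)"
    using equations by (simp cong: conj_cong)
  moreover have "(\<lambda>X. X \<in> S \<and> (\<forall>x\<in>PV. \<forall>y\<in>PV. \<forall>z\<in>PW. L1 X x = R1 x \<and> L2 X y = R2 y \<and> L3 X z = R3 z)) =
    (\<lambda>(u, v, p). u \<in> PV \<and> v \<in> PV \<and> p \<in> PW \<and>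
      (\<forall>x\<in>PV. \<forall>y\<in>PV. \<forall>z\<in>PW. L1 (u, v, p) x = R1 x \<and> L2 (u, v, p) y = R2 y \<and> L3 (u, v, p) z = R3 z))"
    by (auto simp: fun_eq_iff S_def)
  ultimately show ?thesis
    unfolding L1_def L2_def L3_def R1_def R2_def R3_def fst_conv snd_conv PV_def PW_def by simp
qed

section \<open>Application to the discretized Biot system\<close>

text \<open>Moves the density out of the inner product to the place where the abstract time step has
  it; \<open>ip_mult\<close> does the same for \<open>c0\<close>.\<close>

lemma ip_scaleR: "ip S (\<lambda>x. c *\<^sub>R f x) g = c * ip S f g"
proof -
  have "(\<lambda>x. indicat_real S x *\<^sub>R ((c *\<^sub>R f x) \<bullet> g x)) = (\<lambda>x. c * (indicat_real S x *\<^sub>R (f x \<bullet> g x)))"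
    by (auto simp: fun_eq_iff)
  then show ?thesis
    by (simp only: ip_def set_lebesgue_integral_def integral_mult_right_zero)
qed

lemma ip_mult: "ip S (\<lambda>x. c * f x) g = c * ip S f (g :: 'a::euclidean_space \<Rightarrow> real)"
  using ip_scaleR[of S c f g] by simp

lemma quad_eq_sum: "quad k \<zeta> \<omega> t n f =
  (\<Sum>\<mu>=1..k+1. (t n - t (n - 1)) / 2 * \<omega> \<mu> * f (quad_node \<zeta> t n \<mu>))"
  by (simp only: quad_def sum_distrib_left mult.assoc)

lemma quad_node_in_interval:
  assumes "gauss_radau k \<zeta> \<omega>" "\<mu> \<in> {1..k+1}" "t (n - 1) < t n"
  shows "quad_node \<zeta> t n \<mu> \<in> {t (n - 1) <.. t n}"
proof -
  have \<zeta>: "-1 < \<zeta> \<mu>" "\<zeta> \<mu> \<le> 1"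
    using assms(1,2) by (auto simp: gauss_radau_def)
  have "0 < (t n - t (n - 1)) / 2 * (\<zeta> \<mu> + 1)"
    using \<zeta> assms(3) by (intro mult_pos_pos) auto
  moreover have "(t n - t (n - 1)) / 2 * (\<zeta> \<mu> + 1) \<le> (t n - t (n - 1)) / 2 * 2"
    using \<zeta> assms(3) by (intro mult_left_mono) auto
  ultimately show ?thesis
    by (simp add: quad_node_def)
qed

theorem lemma3p2:
  fixes P :: "'n::finite biot" and \<T> :: "'n mesh set" and M :: "'n mesh"
    and ch :: pressure_space and r k :: nat and \<zeta> \<omega> :: "nat \<Rightarrow> real"
  assumes dim: "CARD('n) \<in> {2, 3}"
    and problem: "biot_problem P"
    and mesh: "quasi_uniform P \<T>" "M \<in> \<T>" "boundary_compatible P M"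
    and degree: "r \<ge> 2"
    and quadrature: "gauss_radau k \<zeta> \<omega>"
  shows "\<exists>\<gamma>\<^sub>a\<^sub>0 \<gamma>\<^sub>0 :: real. \<forall>\<gamma>\<^sub>a > \<gamma>\<^sub>a\<^sub>0. \<forall>\<gamma> > \<gamma>\<^sub>0.
    \<forall>(N::nat) (T::real) (t::nat \<Rightarrow> real) (D :: 'n biot_data).
    time_mesh N T t \<longrightarrow> admissible_data P M r ch k \<zeta> N T t D \<longrightarrow>
    (\<forall>n \<in> {1..N}. \<forall>u0 \<in> Vh P M r. \<forall>v0 \<in> Vh P M r. \<forall>p0 \<in> Qh P M r ch.
      (let \<Omega> = Omega P; I = time_interval t n; Q = quad k \<zeta> \<omega> t n; t0 = t (n - 1);
           PV = time_poly k I (Vh P M r); PQ = time_poly k I (Qh P M r ch)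
       in \<exists>!(u, v, p). u \<in> PV \<and> v \<in> PV \<and> p \<in> PQ \<and>
         (\<forall>\<phi> \<in> PV. \<forall>\<eta> \<in> PV. \<forall>\<psi> \<in> PQ.
            Q (\<lambda>s. ip \<Omega> (dt I u s) (\<phi> s) - ip \<Omega> (v s) (\<phi> s))
              + ip \<Omega> (right_lim t0 u) (right_lim t0 \<phi>)
            = ip \<Omega> u0 (right_lim t0 \<phi>)
          \<and> Q (\<lambda>s. ip \<Omega> (\<lambda>x. rho P *\<^sub>R dt I v s x) (\<eta> s)
                    + A_form P M \<gamma>\<^sub>a (u s) (\<eta> s) + C_form P M (\<eta> s) (p s))
              + ip \<Omega> (\<lambda>x. rho P *\<^sub>R right_lim t0 v x) (right_lim t0 \<eta>)
            = Q (\<lambda>s. F_functional P M \<gamma>\<^sub>a D s (\<eta> s))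
              + ip \<Omega> (\<lambda>x. rho P *\<^sub>R v0 x) (right_lim t0 \<eta>)
          \<and> Q (\<lambda>s. ip \<Omega> (\<lambda>x. c0 P * dt I p s x) (\<psi> s)
                    - C_form P M (v s) (\<psi> s) + B_form P M ch \<gamma> (p s) (\<psi> s))
              + ip \<Omega> (\<lambda>x. c0 P * right_lim t0 p x) (right_lim t0 \<psi>)
            = Q (\<lambda>s. G_functional P M ch \<gamma> D s (\<psi> s))
              + ip \<Omega> (\<lambda>x. c0 P * p0 x) (right_lim t0 \<psi>))))"
proof -
  have mesh_of: "mesh_of P M"
    using mesh by (simp add: quasi_uniform_def)
  interpret biot_mesh P M
    using dim problem mesh_of by unfold_locales auto
  \<comment> \<open>The bilinear forms involve neither the time mesh nor the data, so both
    thresholds are fixed before these are given.\<close>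
  obtain \<gamma>\<^sub>a\<^sub>0 where A: "\<And>\<gamma>. \<gamma> > \<gamma>\<^sub>a\<^sub>0 \<Longrightarrow> psd_form (Vh P M r) (A_form P M \<gamma>)"
    using A_form_psd by blast
  obtain \<gamma>\<^sub>0 where B: "\<And>\<gamma>. \<gamma> > \<gamma>\<^sub>0 \<Longrightarrow> psd_form (Qh P M r ch) (B_form P M ch \<gamma>)"
    using B_form_psd by blast
  show ?thesis
  proof (rule exI[of _ \<gamma>\<^sub>a\<^sub>0], rule exI[of _ \<gamma>\<^sub>0], intro allI impI ballI)
    fix \<gamma>\<^sub>a \<gamma> :: real and N :: nat and T :: real and t :: "nat \<Rightarrow> real" and D :: "'n biot_data" and n u0 v0 p0
    assume \<gamma>: "\<gamma>\<^sub>a > \<gamma>\<^sub>a\<^sub>0" "\<gamma> > \<gamma>\<^sub>0" and time: "time_mesh N T t"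
      and admissible: "admissible_data P M r ch k \<zeta> N T t D" and n: "n \<in> {1..N}"
      and data: "u0 \<in> Vh P M r" "v0 \<in> Vh P M r" "p0 \<in> Qh P M r ch"
    have tn: "t (n - 1) < t n"
      using time n by (simp add: time_mesh_def)
    have D: "admissible_data_at P M r ch T D (quad_node \<zeta> t n \<mu>)" if "\<mu> \<in> {1..k+1}" for \<mu>
      using admissible n that unfolding admissible_data_def by blast
    have forms: "biot_forms (Vh P M r) (Qh P M r ch) (ip (Omega P)) (ip (Omega P))
      (A_form P M \<gamma>\<^sub>a) (C_form P M) (B_form P M ch \<gamma>) (rho P) (c0 P)"
      by unfold_locales
        (use V_subspace W_subspace V_mass W_mass A[OF \<gamma>(1)] B[OF \<gamma>(2)] V_mass_definite W_mass_definite
          C_form_bilin coefficients in auto)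
    note solution = time_step_unique_solution[OF forms V_fin_dim W_fin_dim gauss_radau_rule[OF quadrature tn]
        quad_node_in_interval[OF quadrature _ tn] F_functional_lin_on[OF D] G_functional_lin_on[OF D] data refl]
    show "let \<Omega> = Omega P; I = time_interval t n; Q = quad k \<zeta> \<omega> t n; t0 = t (n - 1);
           PV = time_poly k I (Vh P M r); PQ = time_poly k I (Qh P M r ch)
       in \<exists>!(u, v, p). u \<in> PV \<and> v \<in> PV \<and> p \<in> PQ \<and>
         (\<forall>\<phi> \<in> PV. \<forall>\<eta> \<in> PV. \<forall>\<psi> \<in> PQ.
            Q (\<lambda>s. ip \<Omega> (dt I u s) (\<phi> s) - ip \<Omega> (v s) (\<phi> s))
              + ip \<Omega> (right_lim t0 u) (right_lim t0 \<phi>)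
            = ip \<Omega> u0 (right_lim t0 \<phi>)
          \<and> Q (\<lambda>s. ip \<Omega> (\<lambda>x. rho P *\<^sub>R dt I v s x) (\<eta> s)
                    + A_form P M \<gamma>\<^sub>a (u s) (\<eta> s) + C_form P M (\<eta> s) (p s))
              + ip \<Omega> (\<lambda>x. rho P *\<^sub>R right_lim t0 v x) (right_lim t0 \<eta>)
            = Q (\<lambda>s. F_functional P M \<gamma>\<^sub>a D s (\<eta> s))
              + ip \<Omega> (\<lambda>x. rho P *\<^sub>R v0 x) (right_lim t0 \<eta>)
          \<and> Q (\<lambda>s. ip \<Omega> (\<lambda>x. c0 P * dt I p s x) (\<psi> s)
                    - C_form P M (v s) (\<psi> s) + B_form P M ch \<gamma> (p s) (\<psi> s))
              + ip \<Omega> (\<lambda>x. c0 P * right_lim t0 p x) (right_lim t0 \<psi>)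
            = Q (\<lambda>s. G_functional P M ch \<gamma> D s (\<psi> s))
              + ip \<Omega> (\<lambda>x. c0 P * p0 x) (right_lim t0 \<psi>))"
      unfolding Let_def time_interval_def quad_eq_sum ip_scaleR ip_mult by (rule solution)
  qed
qed

end
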